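(* Let $T>0$, $\sigma>0$, $\varepsilon=1$, $x_0\in\mathbb T^2$, $w=e_1$, $x_c(t)=x_0+tw$. Let $u_n$ be the smooth divergence-free coefficients on $[0,T]\times\mathbb T^2$ defined in the context. For a smooth coefficient $u$ let $\mathcal U_u(T)\in\mathcal L(\mathcal H_2)$ be the terminal evolution operator $X_0\mapsto X(T)$ of the planar Maxwell--Ohm system with coefficient $u$; write $\mathcal U_n(T)=\mathcal U_{u_n}(T)$ and let $\mathcal U_0(T)$ be the operator for the zero coefficient. Then $$\|\mathcal U_n(T)-\mathcal U_0(T)\|_{\mathcal L(\mathcal H_2)}\longrightarrow\infty.$$ Consequently, there exists one fixed nonzero initial state $X_*\in\mathcal H_2$ such that $$\sup_n\|\mathcal U_n(T)X_*-\mathcal U_0(T)X_*\|_{\mathcal H_2}=\infty.$$ In particular, for this $X_*$ the map $u\mapsto\mathcal U_u(T)X_*$, from smooth coefficients equipped with the $L^2(0,T;H^1(\mathbb T^2))$ topology into $\mathcal H_2$, is discontinuous at $u=0$.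
   Context: $\mathbb T^2=(\mathbb R/2\pi\mathbb Z)^2$; $R(z_1,z_2)=(z_2,-z_1)$. States are $X=(E,b)$, $E$ $\mathbb R^2$-valued and $b$ real-valued; with $\varepsilon=1$, $\|X\|_{\mathcal H_2}^2=\|E\|_{L^2}^2+\|b\|_{L^2}^2$. The planar Maxwell--Ohm system with coefficient $v$ is $$\partial_tE-R\nabla b=-j,\qquad \partial_tb+\operatorname{curl}E=0,\qquad j=\sigma(E+bRv),\qquad \operatorname{curl}E=\partial_1E_2-\partial_2E_1.$$ Solutions are the unique mild energy solutions $X\in C([0,T];\mathcal H_2)$: $X(t)=S(t)X_0+\int_0^tS(t-s)(-\sigma b(s)Rv(s),0)\,ds$, with $S$ the contraction semigroup on $\mathcal H_2$ generated by $(E,b)\mapsto(R\nabla b-\sigma E,-\operatorname{curl}E)$ on its maximal domain. Coefficients $u_n$: fix $r_0>0$ such that the closed disk of radius $r_0$ about the origin lies in one coordinate chart of $\mathbb T^2$. Fix $\Theta\in C^\infty(\mathbb R;[0,1])$ with $\Theta(z)=0$ for $z\le0$, $\Theta(z)=z$ for $\frac14\le z\le\frac34$, $\Theta(z)=1$ for $z\ge1$, with $|\Theta'|+|\Theta''|\le C$ and $\Theta(z)\le Cz$ on $[0,1]$. For $L\ge2$ let $\chi_L(r)=\Theta(L^{-1}\log(r_0/r))$ for $0<r<r_0$, $\chi_L(r)=0$ for $r\ge r_0$, $\chi_L(0)=1$. For $A\ge1$ set $\psi_{A,L}(x)=-A(Rw\cdot x)\chi_L(|x|)$ and $W_{A,L}=R\nabla\psi_{A,L}$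 (extended by zero to $\mathbb T^2$). With $\delta_n=e^{-n}$ ($n\ge1$), $A_n(t)=1+\frac{2}{\sigma(t+\delta_n)}$ and $L_n(t)=n+A_n(t)^2$, set $u_n(t,x)=W_{A_n(t),L_n(t)}(x-x_c(t))$. These are smooth, divergence-free, and tend to $0$ strongly in $L^2(0,T;H^1(\mathbb T^2))$. *)

theory Defs
  imports "HOL-Analysis.Analysis"
begin

text \<open>Functions on the torus \<open>(\<real>/2\<pi>\<int>)\<^sup>2\<close> are functions on the plane. The space
  \<open>L\<^sup>2\<close> only sees their values on the fundamental cell \<open>[0,2\<pi>)\<^sup>2\<close>; test functions and
  coefficients, which are smooth on the torus, are required to be \<open>2\<pi>\<close>-periodic in both variables.\<close>

type_synonym plane = "real \<times> real"

definition torus :: "plane measure" where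
  "torus = restrict_space lborel ({0..<2*pi} \<times> {0..<2*pi})"

definition periodic :: "(plane \<Rightarrow> 'b) \<Rightarrow> bool" where
  "periodic f \<longleftrightarrow> (\<forall>x y. f (x + 2*pi, y) = f (x, y) \<and> f (x, y + 2*pi) = f (x, y))"

text \<open>The representative in \<open>[-\<pi>,\<pi>)\<^sup>2\<close> of a point of the torus.\<close>

definition wrap :: "plane \<Rightarrow> plane" where
  "wrap x = (fst x - 2*pi * of_int \<lfloor>(fst x + pi) / (2*pi)\<rfloor>,
             snd x - 2*pi * of_int \<lfloor>(snd x + pi) / (2*pi)\<rfloor>)"

subsection \<open>Smoothness\<close>

text \<open>\<open>S\<close> is either the whole space or \<open>[0,T] \<times> \<real>\<^sup>2\<close> with \<open>T > 0\<close>. On both, the derivative within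
  \<open>S\<close> is unique; at \<open>t = 0\<close> and \<open>t = T\<close> it is one-sided in time.\<close>

primrec Ck_on :: "nat \<Rightarrow> 'a::real_normed_vector set \<Rightarrow> ('a \<Rightarrow> 'b::real_normed_vector) \<Rightarrow> bool" where
  "Ck_on 0 S f \<longleftrightarrow> continuous_on S f"
| "Ck_on (Suc k) S f \<longleftrightarrow>
     (\<exists>f'. (\<forall>x\<in>S. (f has_derivative f' x) (at x within S)) \<and> (\<forall>v. Ck_on k S (\<lambda>x. f' x v)))"

definition smooth_on :: "'a::real_normed_vector set \<Rightarrow> ('a \<Rightarrow> 'b::real_normed_vector) \<Rightarrow> bool" where
  "smooth_on S f \<longleftrightarrow> (\<forall>k. Ck_on k S f)"

definition pd1 :: "(plane \<Rightarrow> 'b::real_normed_vector) \<Rightarrow> plane \<Rightarrow> 'b" where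
  "pd1 f x = frechet_derivative f (at x) (1, 0)"

definition pd2 :: "(plane \<Rightarrow> 'b::real_normed_vector) \<Rightarrow> plane \<Rightarrow> 'b" where
  "pd2 f x = frechet_derivative f (at x) (0, 1)"

definition grad :: "(plane \<Rightarrow> real) \<Rightarrow> plane \<Rightarrow> plane" where
  "grad f x = (pd1 f x, pd2 f x)"

definition Rot :: "plane \<Rightarrow> plane" where
  "Rot z = (snd z, - fst z)"

subsection \<open>The space \<open>L\<^sup>2\<close> of the torus\<close>

definition sq_integrable :: "(plane \<Rightarrow> 'b::euclidean_space) \<Rightarrow> bool" where
  "sq_integrable f \<longleftrightarrow> f \<in> borel_measurable torus \<and> integrable torus (\<lambda>x. (norm (f x))\<^sup>2)"

definition L2_eq :: "(plane \<Rightarrow> 'b::euclidean_space) \<Rightarrow> (plane \<Rightarrow> 'b) \<Rightarrow> bool" where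
  "L2_eq f g \<longleftrightarrow> sq_integrable f \<and> sq_integrable g \<and> (AE x in torus. f x = g x)"

lemma sq_integrable_zero: "sq_integrable (\<lambda>x. 0)"
  by (simp add: sq_integrable_def)

lemma sq_integrable_add:
  assumes "sq_integrable f" "sq_integrable g"
  shows "sq_integrable (\<lambda>x. f x + g x)"
proof -
  have m: "f \<in> borel_measurable torus" "g \<in> borel_measurable torus"
    using assms by (auto simp: sq_integrable_def)
  have "integrable torus (\<lambda>x. 2 * (norm (f x))\<^sup>2 + 2 * (norm (g x))\<^sup>2)"
    using assms by (simp add: sq_integrable_def)
  then have "integrable torus (\<lambda>x. (norm (f x + g x))\<^sup>2)"
  proof (rule Bochner_Integration.integrable_bound)
    show "(\<lambda>x. (norm (f x + g x))\<^sup>2) \<in> borel_measurable torus" using m by measurable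
    have "(norm (f x + g x))\<^sup>2 \<le> 2 * (norm (f x))\<^sup>2 + 2 * (norm (g x))\<^sup>2" for x
    proof -
      have "(norm (f x + g x))\<^sup>2 \<le> (norm (f x) + norm (g x))\<^sup>2"
        by (simp add: norm_triangle_ineq power_mono)
      also have "\<dots> \<le> 2 * (norm (f x))\<^sup>2 + 2 * (norm (g x))\<^sup>2"
        by (smt (verit) sum_squares_bound power2_sum)
      finally show ?thesis .
    qed
    then show "AE x in torus. norm ((norm (f x + g x))\<^sup>2)
        \<le> norm (2 * (norm (f x))\<^sup>2 + 2 * (norm (g x))\<^sup>2)"
      by simp
  qed
  with m show ?thesis by (simp add: sq_integrable_def)
qed

lemma sq_integrable_scaleR:
  assumes "sq_integrable f"
  shows "sq_integrable (\<lambda>x. c *\<^sub>R f x)"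
  using assms by (auto simp: sq_integrable_def power_mult_distrib)

lemma sq_integrable_uminus:
  assumes "sq_integrable f"
  shows "sq_integrable (\<lambda>x. - f x)"
  using sq_integrable_scaleR[OF assms, of "-1"] by simp

lemma sq_integrable_diff:
  assumes "sq_integrable f" "sq_integrable g"
  shows "sq_integrable (\<lambda>x. f x - g x)"
  using sq_integrable_add[OF assms(1) sq_integrable_uminus[OF assms(2)]] by simp

lemma sq_integrable_inner:
  assumes "sq_integrable f" "sq_integrable g"
  shows "integrable torus (\<lambda>x. f x \<bullet> g x)"
proof -
  have m: "f \<in> borel_measurable torus" "g \<in> borel_measurable torus"
    using assms by (auto simp: sq_integrable_def)
  have "integrable torus (\<lambda>x. (norm (f x))\<^sup>2 + (norm (g x))\<^sup>2)"
    using assms by (simp add: sq_integrable_def)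
  then show ?thesis
  proof (rule Bochner_Integration.integrable_bound)
    show "(\<lambda>x. f x \<bullet> g x) \<in> borel_measurable torus" using m by measurable
    have "\<bar>f x \<bullet> g x\<bar> \<le> (norm (f x))\<^sup>2 + (norm (g x))\<^sup>2" for x
    proof -
      have "\<bar>f x \<bullet> g x\<bar> \<le> norm (f x) * norm (g x)" by (rule Cauchy_Schwarz_ineq2)
      also have "\<dots> \<le> (norm (f x))\<^sup>2 + (norm (g x))\<^sup>2"
        using sum_squares_bound[of "norm (f x)" "norm (g x)"]
          mult_nonneg_nonneg[OF norm_ge_zero norm_ge_zero, of "f x" "g x"] by linarith
      finally show ?thesis .
    qed
    then show "AE x in torus. norm (f x \<bullet> g x) \<le> norm ((norm (f x))\<^sup>2 + (norm (g x))\<^sup>2)"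
      by simp
  qed
qed

quotient_type (overloaded) 'b L2 = "plane \<Rightarrow> 'b::euclidean_space" / partial: L2_eq
proof (rule part_equivpI)
  show "\<exists>f. L2_eq f f" using sq_integrable_zero by (auto simp: L2_eq_def)
  show "symp L2_eq" by (auto simp: symp_def L2_eq_def)
  show "transp L2_eq" unfolding transp_def L2_eq_def by (auto elim: AE_mp)
qed

instantiation L2 :: (euclidean_space) real_inner
begin

lift_definition zero_L2 :: "'a L2" is "\<lambda>x. 0"
  by (simp add: L2_eq_def sq_integrable_zero)

lift_definition plus_L2 :: "'a L2 \<Rightarrow> 'a L2 \<Rightarrow> 'a L2" is "\<lambda>f g x. f x + g x"
  by (auto simp: L2_eq_def sq_integrable_add)

lift_definition minus_L2 :: "'a L2 \<Rightarrow> 'a L2 \<Rightarrow> 'a L2" is "\<lambda>f g x. f x - g x"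
  by (auto simp: L2_eq_def sq_integrable_diff)

lift_definition uminus_L2 :: "'a L2 \<Rightarrow> 'a L2" is "\<lambda>f x. - f x"
  by (auto simp: L2_eq_def sq_integrable_uminus)

lift_definition scaleR_L2 :: "real \<Rightarrow> 'a L2 \<Rightarrow> 'a L2" is "\<lambda>c f x. c *\<^sub>R f x"
  by (auto simp: L2_eq_def sq_integrable_scaleR)

lift_definition inner_L2 :: "'a L2 \<Rightarrow> 'a L2 \<Rightarrow> real" is "\<lambda>f g. \<integral>x. f x \<bullet> g x \<partial>torus"
  unfolding L2_eq_def sq_integrable_def
  by (intro integral_cong_AE) auto

definition norm_L2 :: "'a L2 \<Rightarrow> real" where "norm_L2 f = sqrt (f \<bullet> f)"
definition sgn_L2 :: "'a L2 \<Rightarrow> 'a L2" where "sgn_L2 f = scaleR (inverse (norm f)) f"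
definition dist_L2 :: "'a L2 \<Rightarrow> 'a L2 \<Rightarrow> real" where "dist_L2 f g = norm (f - g)"
definition uniformity_L2 :: "('a L2 \<times> 'a L2) filter" where
  "uniformity_L2 = (INF e\<in>{0<..}. principal {(x, y). dist x y < e})"
definition open_L2 :: "'a L2 set \<Rightarrow> bool" where
  "open_L2 U = (\<forall>x\<in>U. eventually (\<lambda>(x', y). x' = x \<longrightarrow> y \<in> U) uniformity)"

instance
proof
  fix f g h :: "'a L2" and a b :: real
  show "f + g + h = f + (g + h)"
    by transfer (auto simp: L2_eq_def add.assoc intro!: sq_integrable_add)
  show "f + g = g + f"
    by transfer (auto simp: L2_eq_def add.commute intro!: sq_integrable_add)
  show "0 + f = f" by transfer (auto simp: L2_eq_def)
  show "- f + f = 0" by transfer (auto simp: L2_eq_def sq_integrable_zero)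
  show "f - g = f + - g"
    by transfer (auto simp: L2_eq_def intro!: sq_integrable_diff)
  show "a *\<^sub>R (f + g) = a *\<^sub>R f + a *\<^sub>R g"
    by transfer (auto simp: L2_eq_def scaleR_add_right
        intro!: sq_integrable_add sq_integrable_scaleR)
  show "(a + b) *\<^sub>R f = a *\<^sub>R f + b *\<^sub>R f"
    by transfer (auto simp: L2_eq_def scaleR_add_left
        intro!: sq_integrable_add sq_integrable_scaleR)
  show "a *\<^sub>R b *\<^sub>R f = (a * b) *\<^sub>R f"
    by transfer (auto simp: L2_eq_def intro!: sq_integrable_scaleR)
  show "1 *\<^sub>R f = f" by transfer (auto simp: L2_eq_def)
  show "dist f g = norm (f - g)" by (rule dist_L2_def)
  show "sgn f = inverse (norm f) *\<^sub>R f" by (rule sgn_L2_def)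
  show "(uniformity :: ('a L2 \<times> 'a L2) filter) = (INF e\<in>{0<..}. principal {(x, y). dist x y < e})"
    by (rule uniformity_L2_def)
  show "open U = (\<forall>x\<in>U. eventually (\<lambda>(x', y). x' = x \<longrightarrow> y \<in> U) uniformity)" for U :: "'a L2 set"
    by (rule open_L2_def)
  show "f \<bullet> g = g \<bullet> f" by transfer (simp add: inner_commute)
  show "(f + g) \<bullet> h = f \<bullet> h + g \<bullet> h"
    by transfer (simp add: L2_eq_def inner_add_left sq_integrable_inner)
  show "(a *\<^sub>R f) \<bullet> g = a * (f \<bullet> g)" by transfer simp
  show "0 \<le> f \<bullet> f" by transfer simp
  show "(f \<bullet> f = 0) = (f = 0)"
  proof transfer
    fix f :: "plane \<Rightarrow> 'a"
    assume "L2_eq f f"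
    then have f: "sq_integrable f" by (simp add: L2_eq_def)
    have "(\<integral>x. f x \<bullet> f x \<partial>torus) = 0 \<longleftrightarrow> (AE x in torus. f x \<bullet> f x = 0)"
      using sq_integrable_inner[OF f f] by (intro integral_nonneg_eq_0_iff_AE) auto
    then show "((\<integral>x. f x \<bullet> f x \<partial>torus) = 0) = L2_eq f (\<lambda>x. 0)"
      using f by (simp add: L2_eq_def sq_integrable_zero)
  qed
  show "norm f = sqrt (f \<bullet> f)" by (rule norm_L2_def)
qed

end

subsection \<open>The Maxwell--Ohm semigroup\<close>

text \<open>States \<open>(E, b)\<close>; the norm of the product type is \<open>sqrt (\<parallel>E\<parallel>\<^sup>2 + \<parallel>b\<parallel>\<^sup>2)\<close>.\<close>

type_synonym state = "plane L2 \<times> real L2"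

definition test_fun :: "(plane \<Rightarrow> real) \<Rightarrow> bool" where
  "test_fun \<phi> \<longleftrightarrow> smooth_on UNIV \<phi> \<and> periodic \<phi>"

text \<open>\<open>weak_grad b g\<close> and \<open>weak_curl E c\<close>: the distributional gradient of \<open>b\<close> is \<open>g\<close> and the
  distributional curl \<open>\<partial>\<^sub>1E\<^sub>2 - \<partial>\<^sub>2E\<^sub>1\<close> of \<open>E\<close> is \<open>c\<close>.\<close>

definition weak_grad :: "real L2 \<Rightarrow> plane L2 \<Rightarrow> bool" where
  "weak_grad b g \<longleftrightarrow> (\<forall>\<phi>. test_fun \<phi> \<longrightarrow>
     (\<integral>x. \<phi> x *\<^sub>R rep_L2 g x \<partial>torus) = - (\<integral>x. rep_L2 b x *\<^sub>R grad \<phi> x \<partial>torus))"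

definition weak_curl :: "plane L2 \<Rightarrow> real L2 \<Rightarrow> bool" where
  "weak_curl E c \<longleftrightarrow> (\<forall>\<phi>. test_fun \<phi> \<longrightarrow>
     (\<integral>x. \<phi> x * rep_L2 c x \<partial>torus) =
     - (\<integral>x. snd (rep_L2 E x) * pd1 \<phi> x - fst (rep_L2 E x) * pd2 \<phi> x \<partial>torus))"

text \<open>The graph of \<open>(E, b) \<mapsto> (R\<nabla>b - \<sigma>E, -curl E)\<close> on its maximal domain.\<close>

definition maxwell_ohm :: "real \<Rightarrow> state \<Rightarrow> state \<Rightarrow> bool" where
  "maxwell_ohm \<sigma> X Y \<longleftrightarrow> (\<exists>g c. weak_grad (snd X) g \<and> weak_curl (fst X) c \<and>
     Y = (abs_L2 (\<lambda>x. Rot (rep_L2 g x)) - \<sigma> *\<^sub>R fst X, - c))"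

definition contraction_semigroup :: "(real \<Rightarrow> 'a::real_normed_vector \<Rightarrow>\<^sub>L 'a) \<Rightarrow> bool" where
  "contraction_semigroup S \<longleftrightarrow>
     S 0 = id_blinfun \<and>
     (\<forall>s\<ge>0. \<forall>t\<ge>0. S (s + t) = S s o\<^sub>L S t) \<and>
     (\<forall>t\<ge>0. norm (S t) \<le> 1) \<and>
     (\<forall>X. continuous_on {0..} (\<lambda>t. S t X))"

definition generated_by ::
    "(real \<Rightarrow> 'a::real_normed_vector \<Rightarrow>\<^sub>L 'a) \<Rightarrow> ('a \<Rightarrow> 'a \<Rightarrow> bool) \<Rightarrow> bool" where
  "generated_by S A \<longleftrightarrow>
     (\<forall>X Y. A X Y \<longleftrightarrow> ((\<lambda>h. (S h X - X) /\<^sub>R h) \<longlongrightarrow> Y) (at_right 0))"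

subsection \<open>Coefficients, mild solutions, evolution operators\<close>

definition smooth_coeff :: "real \<Rightarrow> (real \<Rightarrow> plane \<Rightarrow> plane) \<Rightarrow> bool" where
  "smooth_coeff T u \<longleftrightarrow>
     smooth_on ({0..T} \<times> UNIV) (\<lambda>(t, x). u t x) \<and> (\<forall>t\<in>{0..T}. periodic (u t))"

text \<open>The norm of \<open>L\<^sup>2(0,T;H\<^sup>1)\<close>, for smooth coefficients.\<close>

definition L2H1_norm :: "real \<Rightarrow> (real \<Rightarrow> plane \<Rightarrow> plane) \<Rightarrow> real" where
  "L2H1_norm T u = sqrt (LINT t:{0..T}|lborel. LINT x|torus.
     (norm (u t x))\<^sup>2 + (norm (pd1 (u t) x))\<^sup>2 + (norm (pd2 (u t) x))\<^sup>2)"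

definition ohm_source :: "real \<Rightarrow> (plane \<Rightarrow> plane) \<Rightarrow> state \<Rightarrow> state" where
  "ohm_source \<sigma> v X = (abs_L2 (\<lambda>x. (- \<sigma> * rep_L2 (snd X) x) *\<^sub>R Rot (v x)), 0)"

text \<open>For smooth \<open>v\<close> the integrand is continuous in \<open>s\<close>, so the gauge integral used
  here is the Riemann and the Bochner integral.\<close>

definition mild_solution ::
    "real \<Rightarrow> (real \<Rightarrow> state \<Rightarrow>\<^sub>L state) \<Rightarrow> real \<Rightarrow> (real \<Rightarrow> plane \<Rightarrow> plane) \<Rightarrow> state
      \<Rightarrow> (real \<Rightarrow> state) \<Rightarrow> bool" where
  "mild_solution \<sigma> S T v X0 X \<longleftrightarrow>
     continuous_on {0..T} X \<and>
     (\<forall>t\<in>{0..T}. ((\<lambda>s. S (t - s) (ohm_source \<sigma> (v s) (X s))) has_integral (X t - S t X0)) {0..t})"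

definition evolution ::
    "real \<Rightarrow> (real \<Rightarrow> state \<Rightarrow>\<^sub>L state) \<Rightarrow> real \<Rightarrow> (real \<Rightarrow> plane \<Rightarrow> plane) \<Rightarrow> state \<Rightarrow>\<^sub>L state" where
  "evolution \<sigma> S T v = Blinfun (\<lambda>X0. THE Y. \<exists>X. mild_solution \<sigma> S T v X0 X \<and> Y = X T)"

subsection \<open>The moving vortices\<close>

definition cutoff_profile :: "(real \<Rightarrow> real) \<Rightarrow> bool" where
  "cutoff_profile \<Theta> \<longleftrightarrow>
     smooth_on UNIV \<Theta> \<and> (\<forall>z. \<Theta> z \<in> {0..1}) \<and>
     (\<forall>z\<le>0. \<Theta> z = 0) \<and> (\<forall>z\<in>{1/4..3/4}. \<Theta> z = z) \<and> (\<forall>z\<ge>1. \<Theta> z = 1) \<and>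
     (\<exists>C. (\<forall>z. \<bar>deriv \<Theta> z\<bar> + \<bar>deriv (deriv \<Theta>) z\<bar> \<le> C) \<and> (\<forall>z\<in>{0..1}. \<Theta> z \<le> C * z))"

definition chi :: "real \<Rightarrow> (real \<Rightarrow> real) \<Rightarrow> real \<Rightarrow> real \<Rightarrow> real" where
  "chi r\<^sub>0 \<Theta> L r = (if r = 0 then 1 else if r < r\<^sub>0 then \<Theta> (ln (r\<^sub>0 / r) / L) else 0)"

definition w_dir :: plane where "w_dir = (1, 0)"

definition psi :: "real \<Rightarrow> (real \<Rightarrow> real) \<Rightarrow> real \<Rightarrow> real \<Rightarrow> plane \<Rightarrow> real" where
  "psi r\<^sub>0 \<Theta> A L x = - A * (Rot w_dir \<bullet> x) * chi r\<^sub>0 \<Theta> L (norm x)"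

definition vortex :: "real \<Rightarrow> (real \<Rightarrow> real) \<Rightarrow> real \<Rightarrow> real \<Rightarrow> plane \<Rightarrow> plane" where
  "vortex r\<^sub>0 \<Theta> A L x = Rot (grad (psi r\<^sub>0 \<Theta> A L) x)"

definition delta :: "nat \<Rightarrow> real" where "delta n = exp (- real n)"

definition amp :: "real \<Rightarrow> nat \<Rightarrow> real \<Rightarrow> real" where
  "amp \<sigma> n t = 1 + 2 / (\<sigma> * (t + delta n))"

definition len :: "real \<Rightarrow> nat \<Rightarrow> real \<Rightarrow> real" where
  "len \<sigma> n t = real n + (amp \<sigma> n t)\<^sup>2"

definition u_seq ::
    "real \<Rightarrow> real \<Rightarrow> (real \<Rightarrow> real) \<Rightarrow> plane \<Rightarrow> nat \<Rightarrow> real \<Rightarrow> plane \<Rightarrow> plane" where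
  "u_seq \<sigma> r\<^sub>0 \<Theta> x\<^sub>0 n t x =
     vortex r\<^sub>0 \<Theta> (amp \<sigma> n t) (len \<sigma> n t) (wrap (x - (x\<^sub>0 + t *\<^sub>R w_dir)))"

end

theory Submission
  imports Defs
begin

text \<open>
  Inside its core the vortex \<open>u\<^sub>n\<close> equals the constant \<open>A\<^sub>n(t)w\<close>, and this core moves with velocity
  \<open>w = e\<^sub>1\<close>, whose length is the speed of light. For \<open>v = Aw\<close> and fields that depend mainly on \<open>x\<^sub>1\<close>, the
  variables \<open>p = b + E\<^sub>2\<close> and \<open>q = b - E\<^sub>2\<close> obey
  \<open>\<partial>\<^sub>tp + \<partial>\<^sub>1p = \<sigma>(A - 1)/2 p + \<sigma>(A + 1)/2 q\<close> and \<open>\<partial>\<^sub>tq - \<partial>\<^sub>1q = \<sigma>(1 - A)/2 p - \<sigma>(A + 1)/2 q\<close>. A pulse in \<open>p\<close> that rides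
  with the core is amplified at the rate \<open>\<sigma>(A\<^sub>n - 1)/2 = 1/(t + \<delta>\<^sub>n)\<close> during the whole time interval,
  hence by the factor \<open>(T + \<delta>\<^sub>n)/\<delta>\<^sub>n\<close>, whereas \<open>q\<close> travels the opposite way and stays small when the pulse
  is thin.

  This is made rigorous with an explicit approximate solution built from products \<open>h(x\<^sub>1 - t) g(x\<^sub>2)\<close> of
  periodic profiles. Its leading part is \<open>p = m(t) h' g\<close> with \<open>m(t) = (t + \<delta>\<^sub>n)/\<delta>\<^sub>n\<close>; the corrections
  \<open>q = h g/(2\<delta>\<^sub>n)\<close> and \<open>E\<^sub>1 = - m(t) h g'/2\<close> cancel every term of the equation that contains a derivative of
  \<open>h\<close>. What remains is a residual in which only \<open>h\<close> itself occurs, and by a Poincare inequality on a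
  short arc (\<open>bump_poincare\<close>) \<open>h\<close> is as small as desired compared with \<open>h'\<close>. Duhamel's formula
  (\<open>classical_solution_duhamel\<close>) and the stability of Volterra equations (\<open>volterra_end_close\<close>) transfer
  the growth to the true evolution, with \<open>n\<close> fixed while the pulse gets thin. The result is
  \<open>evolution_norm_lower_bound\<close>. Since the evolution of the zero coefficient is the contraction \<open>S(T)\<close>,
  the operator norms of the differences diverge, and the uniform boundedness principle provides the
  single initial state.

  The discontinuity at \<open>u = 0\<close> needs in addition that the \<open>u\<^sub>n\<close> are admissible and small. Smoothness is
  local: away from its centre the vortex is an explicit smooth expression, near the centre it is
  constant, and where the wrapping map jumps it vanishes. The \<open>H\<^sup>1\<close> energy of a vortex is at most a
  multiple of \<open>A\<^sup>2/L\<close>, because all the \<open>L\<close> concentric shells \<open>|x| \<sim> r\<^sub>0e\<^sup>-\<^sup>j\<close> contribute equally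
  to an integrand of order \<open>(A/L)\<^sup>2|x|\<^sup>-\<^sup>2\<close>. With \<open>L\<^sub>n = n + A\<^sub>n\<^sup>2\<close> this ratio is bounded by \<open>1\<close> and tends to
  \<open>0\<close> for every \<open>t > 0\<close>, so its time integral tends to \<open>0\<close>.
\<close>

section \<open>Uniform boundedness\<close>

text \<open>The closed sets of points at which all \<open>F n\<close> are bounded by \<open>k\<close> cover the space, so by Baire's
  theorem one of them contains a ball, and differences of points of this ball reach every direction.\<close>

lemma uniform_boundedness:
  fixes F :: "nat \<Rightarrow> 'a::banach \<Rightarrow>\<^sub>L 'b::real_normed_vector"
  assumes pw: "\<And>x. \<exists>K. \<forall>n. norm (F n x) \<le> K"
  shows "\<exists>K. \<forall>n. norm (F n) \<le> K"
proof -
  define C where "C k = {x. \<forall>n. norm (F n x) \<le> real k}" for k :: nat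
  have cl: "closed (C k)" for k
  proof -
    have "C k = (\<Inter>n. {x. norm (F n x) \<le> real k})" by (auto simp: C_def)
    moreover have "closed {x. norm (F n x) \<le> real k}" for n
      by (intro closed_Collect_le continuous_intros)
    ultimately show ?thesis by auto
  qed
  have cov: "(\<Union>k. C k) = UNIV"
  proof -
    have "\<exists>k. x \<in> C k" for x
    proof -
      obtain K where K: "\<And>n. norm (F n x) \<le> K" using pw by metis
      obtain k where "K \<le> real k" using real_arch_simple by blast
      with K have "x \<in> C k" unfolding C_def using order_trans by blast
      then show ?thesis ..
    qed
    then show ?thesis by auto
  qed
  have "\<exists>k. interior (C k) \<noteq> {}"
  proof (rule ccontr)
    assume "\<not> ?thesis"
    then have emp: "interior (C k) = {}" for k by auto
    have "Met_TC.mtopology interior_of \<Union> (range C) = {}"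
      using cl emp
      by (intro Met_TC.metric_Baire_category_alt) (auto simp: complete_UNIV)
    then show False using cov by simp
  qed
  then obtain k z e where e: "e > 0" "cball z e \<subseteq> C k"
    by (metis all_not_in_conv mem_interior_cball)
  have "norm (F n) \<le> 2 * real k / e" for n
  proof (rule norm_blinfun_bound)
    show "0 \<le> 2 * real k / e" using e by simp
    fix x
    show "norm (F n x) \<le> 2 * real k / e * norm x"
    proof (cases "x = 0")
      case False
      define y where "y = (e / norm x) *\<^sub>R x"
      have "z + y \<in> cball z e" "z \<in> cball z e"
        using e False by (auto simp: y_def dist_norm)
      then have "z + y \<in> C k" "z \<in> C k" using e by auto
      then have "norm (F n (z + y)) \<le> k" "norm (F n z) \<le> k"
        by (auto simp: C_def)
      moreover have "F n y = F n (z + y) - F n z" by (simp add: blinfun.add_right)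
      ultimately have "norm (F n y) \<le> 2 * k"
        using norm_triangle_ineq4[of "F n (z + y)" "F n z"] by simp
      moreover have "norm (F n y) = e / norm x * norm (F n x)"
        using e by (simp add: y_def blinfun.scaleR_right)
      ultimately show ?thesis using False e by (simp add: field_simps)
    qed simp
  qed
  then show ?thesis by blast
qed

section \<open>Contraction semigroups and Volterra equations\<close>

text \<open>Strong continuity gives continuity in the time argument; contractivity makes the error from
  moving the vector uniform in time.\<close>

lemma semigroup_continuous_on:
  fixes S :: "real \<Rightarrow> 'a::real_normed_vector \<Rightarrow>\<^sub>L 'a" and f :: "'b::topological_space \<Rightarrow> 'a"
  assumes S: "contraction_semigroup S"
    and \<tau>: "continuous_on D \<tau>" "\<And>x. x \<in> D \<Longrightarrow> \<tau> x \<ge> 0" and f: "continuous_on D f"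
  shows "continuous_on D (\<lambda>x. S (\<tau> x) (f x))"
  unfolding continuous_on_def
proof
  fix x0 assume x0: "x0 \<in> D"
  have "continuous_on D (\<lambda>x. S (\<tau> x) (f x0))"
    using S \<tau> continuous_on_compose2[of "{0..}" "\<lambda>t. S t (f x0)" D \<tau>]
    by (auto simp: contraction_semigroup_def)
  then have 1: "((\<lambda>x. S (\<tau> x) (f x0)) \<longlongrightarrow> S (\<tau> x0) (f x0)) (at x0 within D)"
    using x0 by (auto simp: continuous_on_def)
  have f0: "((\<lambda>x. norm (f x - f x0)) \<longlongrightarrow> 0) (at x0 within D)"
    using f x0 by (simp add: continuous_on_def tendsto_norm_zero LIM_zero)
  have 2: "((\<lambda>x. S (\<tau> x) (f x - f x0)) \<longlongrightarrow> 0) (at x0 within D)"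
  proof (rule Lim_null_comparison[OF _ f0])
    have "norm (S (\<tau> x) (f x - f x0)) \<le> norm (f x - f x0)" if "x \<in> D" for x
      using norm_blinfun[of "S (\<tau> x)" "f x - f x0"] S \<tau>(2)[OF that]
        mult_right_mono[of "norm (S (\<tau> x))" 1 "norm (f x - f x0)"]
      by (fastforce simp: contraction_semigroup_def)
    then show "\<forall>\<^sub>F x in at x0 within D. norm (S (\<tau> x) (f x - f x0)) \<le> norm (f x - f x0)"
      by (simp add: eventually_at_topological) blast
  qed
  from tendsto_add[OF 1 2] show "((\<lambda>x. S (\<tau> x) (f x)) \<longlongrightarrow> S (\<tau> x0) (f x0)) (at x0 within D)"
    by (simp add: blinfun.diff_right)
qed

lemma semigroup_norm_le:
  assumes "contraction_semigroup S" "t \<ge> 0"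
  shows "norm (S t x) \<le> norm x"
  using norm_blinfun[of "S t" x] assms mult_right_mono[of "norm (S t)" 1 "norm x"]
  by (fastforce simp: contraction_semigroup_def)

definition duhamel :: "(real \<Rightarrow> 'a::banach \<Rightarrow>\<^sub>L 'a) \<Rightarrow> (real \<Rightarrow> 'a) \<Rightarrow> real \<Rightarrow> 'a" where
  "duhamel S f t = integral {0..t} (\<lambda>s. S (t - s) (f s))"

lemma duhamel_has_integral:
  assumes S: "contraction_semigroup S" and f: "continuous_on {0..T} f" and t: "t \<in> {0..T}"
  shows "((\<lambda>s. S (t - s) (f s)) has_integral duhamel S f t) {0..t}"
  unfolding duhamel_def
proof (intro integrable_integral integrable_continuous_real semigroup_continuous_on[OF S])
  show "continuous_on {0..t} f" using f t by (auto elim: continuous_on_subset)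
qed (auto intro!: continuous_intros)

text \<open>The substitution \<open>s = t\<theta>\<close> moves the dependence on \<open>t\<close> from the bounds into the integrand, and the
  continuity of integrals over \<open>[0,1]\<close> with respect to a parameter applies.\<close>

lemma continuous_on_duhamel:
  assumes S: "contraction_semigroup S" and f: "continuous_on {0..T} f"
  shows "continuous_on {0..T} (duhamel S f)"
proof -
  have "continuous_on {0..T} (\<lambda>t. integral (cbox 0 1) (\<lambda>\<theta>. t *\<^sub>R S (t - t * \<theta>) (f (t * \<theta>))))"
  proof (rule integral_continuous_on_param)
    have "continuous_on ({0..T} \<times> cbox 0 1)
        (\<lambda>z. fst z *\<^sub>R S (fst z - fst z * snd z) (f (fst z * snd z)))"
    proof (intro continuous_on_scaleR semigroup_continuous_on[OF S] continuous_intros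
        continuous_on_compose2[OF f])
      fix z assume z: "z \<in> {0..T} \<times> cbox 0 (1::real)"
      then show "0 \<le> fst z - fst z * snd z"
        using mult_left_mono[of "snd z" 1 "fst z"] by auto
    next
      show "(\<lambda>z. fst z * snd z) ` ({0..T} \<times> cbox 0 1) \<subseteq> {0..T}"
      proof (clarsimp)
        fix a b :: real assume "0 \<le> a" "a \<le> T" "0 \<le> b" "b \<le> 1"
        then show "a * b \<le> T" using mult_left_mono[of b 1 a] by simp
      qed
    qed
    then show "continuous_on ({0..T} \<times> cbox 0 1) (\<lambda>(t, \<theta>). t *\<^sub>R S (t - t * \<theta>) (f (t * \<theta>)))"
      by (simp add: case_prod_beta)
  qed
  then show ?thesis
  proof (rule continuous_on_eq)
    fix t assume t: "t \<in> {0..T}"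
    show "integral (cbox 0 1) (\<lambda>\<theta>. t *\<^sub>R S (t - t * \<theta>) (f (t * \<theta>))) = duhamel S f t"
    proof (cases "t = 0")
      case True
      then show ?thesis by (simp add: duhamel_def)
    next
      case False
      with t have "t > 0" by simp
      from has_integral_affinity'[of "\<lambda>s. S (t - s) (f s)" "duhamel S f t" 0 t t 0] this
      have "((\<lambda>\<theta>. S (t - t * \<theta>) (f (t * \<theta>))) has_integral duhamel S f t /\<^sub>R t) (cbox 0 1)"
        using duhamel_has_integral[OF S f t] by simp
      from has_integral_cmul[OF this, of t] False show ?thesis
        by (intro integral_unique) simp
    qed
  qed
qed

lemma duhamel_norm_le:
  assumes S: "contraction_semigroup S" and f: "continuous_on {0..T} f" and t: "t \<in> {0..T}"
    and g: "(g has_integral I) {0..t}" and le: "\<And>s. s \<in> {0..t} \<Longrightarrow> norm (f s) \<le> g s"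
  shows "norm (duhamel S f t) \<le> I"
proof -
  have "norm (S (t - s) (f s)) \<le> g s" if "s \<in> {0..t}" for s
    using semigroup_norm_le[OF S, of "t - s" "f s"] le[OF that] that by auto
  then have "norm (duhamel S f t) \<le> integral {0..t} g"
    unfolding duhamel_def
    using duhamel_has_integral[OF S f t] g
    by (intro integral_norm_bound_integral) (auto simp: integrable_on_def)
  then show ?thesis using g by (simp add: integral_unique)
qed

lemma has_integral_exp_scaled:
  fixes M t :: real
  assumes "M > 0" "t \<ge> 0"
  shows "((\<lambda>s. exp (M * s)) has_integral (exp (M * t) - 1) / M) {0..t}"
proof -
  have "((\<lambda>s. exp (M * s)) has_integral exp (M * t) / M - exp (M * 0) / M) {0..t}"
    using assms
    by (intro fundamental_theorem_of_calculus)
       (auto intro!: derivative_eq_intros simp: has_real_derivative_iff_has_vector_derivative[symmetric])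
  then show ?thesis by (simp add: diff_divide_distrib)
qed

text \<open>Measured against the weight \<open>exp (2Mt)\<close>, the integral term reproduces at most half of the maximum,
  which can be absorbed on the left. This costs a factor \<open>2\<close> in front and in the exponent.\<close>

lemma gronwall_doubled:
  fixes D :: "real \<Rightarrow> real"
  assumes D: "continuous_on {0..T} D" and M: "M > 0" and T: "T \<ge> 0"
    and le: "\<And>t. t \<in> {0..T} \<Longrightarrow> D t \<le> R + M * integral {0..t} D"
  shows "\<And>t. t \<in> {0..T} \<Longrightarrow> D t \<le> 2 * max R 0 * exp (2 * M * t)"
proof -
  define E where "E t = exp (- 2 * M * t) * D t" for t
  have "continuous_on {0..T} E" unfolding E_def by (intro continuous_intros D)
  then obtain a where a: "a \<in> {0..T}" "\<And>t. t \<in> {0..T} \<Longrightarrow> E t \<le> E a"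
    using continuous_attains_sup[of "{0..T}" E] T by auto
  define K where "K = max (E a) 0"
  have DK: "D t \<le> K * exp (2 * M * t)" if "t \<in> {0..T}" for t
  proof -
    have "E t \<le> K" using a(2)[OF that] by (simp add: K_def)
    then have "exp (2 * M * t) * E t \<le> exp (2 * M * t) * K" by simp
    moreover have "exp (2 * M * t) * E t = D t"
      by (simp add: E_def mult_exp_exp flip: mult.assoc)
    ultimately show ?thesis by (simp only: mult.commute)
  qed
  have I: "((\<lambda>s. K * exp (2 * M * s)) has_integral K * ((exp (2 * M * a) - 1) / (2 * M))) {0..a}"
    using has_integral_exp_scaled[of "2 * M" a] M a(1) by (intro has_integral_mult_right) auto
  have "D integrable_on {0..a}"
    using a(1) D by (intro integrable_continuous_real) (auto elim: continuous_on_subset)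
  then have "integral {0..a} D \<le> K * ((exp (2 * M * a) - 1) / (2 * M))"
    using I DK a(1)
    by (intro has_integral_le[OF integrable_integral I]) auto
  then have "M * integral {0..a} D \<le> K / 2 * (exp (2 * M * a) - 1)"
    using M by (simp add: field_simps)
  also have "\<dots> \<le> K / 2 * exp (2 * M * a)" by (simp add: K_def mult_left_mono)
  finally have "D a \<le> R + K / 2 * exp (2 * M * a)" using le[OF a(1)] by simp
  then have "E a \<le> exp (- 2 * M * a) * (R + K / 2 * exp (2 * M * a))"
    by (simp add: E_def)
  also have "\<dots> = exp (- 2 * M * a) * R + K / 2"
    by (simp add: ring_distribs mult_exp_exp flip: exp_minus)
  also have "exp (- 2 * M * a) * R \<le> 1 * max R 0"
  proof -
    have "exp (- 2 * M * a) * R \<le> exp (- 2 * M * a) * max R 0" by (intro mult_left_mono) auto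
    also have "\<dots> \<le> 1 * max R 0" using M a(1) by (intro mult_right_mono) auto
    finally show ?thesis .
  qed
  finally have "K \<le> 2 * max R 0" unfolding K_def by linarith
  then show "D t \<le> 2 * max R 0 * exp (2 * M * t)" if "t \<in> {0..T}" for t
    using DK[OF that] by (meson exp_ge_zero mult_right_mono order_trans)
qed


lemma duhamel_add:
  assumes S: "contraction_semigroup S" and f: "continuous_on {0..T} f" and g: "continuous_on {0..T} g"
    and t: "t \<in> {0..T}"
  shows "duhamel S (\<lambda>s. f s + g s) t = duhamel S f t + duhamel S g t"
proof -
  have "((\<lambda>s. S (t - s) (f s + g s)) has_integral duhamel S f t + duhamel S g t) {0..t}"
    using has_integral_add[OF duhamel_has_integral[OF S f t] duhamel_has_integral[OF S g t]]
    by (simp add: blinfun.add_right)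
  then show ?thesis unfolding duhamel_def by (rule integral_unique)
qed

lemma duhamel_scaleR:
  assumes S: "contraction_semigroup S" and f: "continuous_on {0..T} f" and t: "t \<in> {0..T}"
  shows "duhamel S (\<lambda>s. c *\<^sub>R f s) t = c *\<^sub>R duhamel S f t"
proof -
  have "((\<lambda>s. S (t - s) (c *\<^sub>R f s)) has_integral c *\<^sub>R duhamel S f t) {0..t}"
    using has_integral_cmul[OF duhamel_has_integral[OF S f t], of c]
    by (simp add: blinfun.scaleR_right)
  then show ?thesis unfolding duhamel_def by (rule integral_unique)
qed

lemma duhamel_diff:
  assumes S: "contraction_semigroup S" and f: "continuous_on {0..T} f" and g: "continuous_on {0..T} g"
    and t: "t \<in> {0..T}"
  shows "duhamel S (\<lambda>s. f s - g s) t = duhamel S f t - duhamel S g t"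
  using duhamel_add[OF S f continuous_on_minus[OF g] t] duhamel_scaleR[OF S g t, of "-1"] by simp

definition volterra_solution ::
    "(real \<Rightarrow> 'a::banach \<Rightarrow>\<^sub>L 'a) \<Rightarrow> (real \<Rightarrow> 'a \<Rightarrow>\<^sub>L 'a) \<Rightarrow> real \<Rightarrow> 'a \<Rightarrow> (real \<Rightarrow> 'a) \<Rightarrow> bool" where
  "volterra_solution S B T X0 X \<longleftrightarrow> continuous_on {0..T} X \<and>
     (\<forall>t\<in>{0..T}. X t = S t X0 + duhamel S (\<lambda>s. B s (X s)) t)"

primrec picard_term ::
    "(real \<Rightarrow> 'a::banach \<Rightarrow>\<^sub>L 'a) \<Rightarrow> (real \<Rightarrow> 'a \<Rightarrow>\<^sub>L 'a) \<Rightarrow> 'a \<Rightarrow> nat \<Rightarrow> real \<Rightarrow> 'a" where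
  "picard_term S B X0 0 = (\<lambda>t. S t X0)"
| "picard_term S B X0 (Suc k) = duhamel S (\<lambda>s. B s (picard_term S B X0 k s))"

definition volterra_end ::
    "(real \<Rightarrow> 'a::banach \<Rightarrow>\<^sub>L 'a) \<Rightarrow> (real \<Rightarrow> 'a \<Rightarrow>\<^sub>L 'a) \<Rightarrow> real \<Rightarrow> 'a \<Rightarrow> 'a" where
  "volterra_end S B T X0 = (THE Y. \<exists>X. volterra_solution S B T X0 X \<and> Y = X T)"

context
  fixes S :: "real \<Rightarrow> 'a::banach \<Rightarrow>\<^sub>L 'a" and B :: "real \<Rightarrow> 'a \<Rightarrow>\<^sub>L 'a" and T M :: real
  assumes S: "contraction_semigroup S" and B: "continuous_on {0..T} B"
    and M: "M > 0" and BM: "\<And>s. s \<in> {0..T} \<Longrightarrow> norm (B s) \<le> M" and T: "T \<ge> 0"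
begin

lemma source_continuous:
  assumes "continuous_on {0..T} X"
  shows "continuous_on {0..T} (\<lambda>s. B s (X s))"
  using B assms by (intro continuous_intros)

lemma source_norm_le: "s \<in> {0..T} \<Longrightarrow> norm (B s x) \<le> M * norm x"
  using norm_blinfun[of "B s" x] mult_right_mono[OF BM, of s "norm x"] by simp

lemma picard_term_continuous: "continuous_on {0..T} (picard_term S B X0 k)"
proof (induction k)
  case 0
  have "continuous_on {0..T} (\<lambda>t. S t X0)"
    by (intro semigroup_continuous_on[OF S] continuous_intros) auto
  then show ?case by simp
next
  case (Suc k)
  then show ?case by (auto intro!: continuous_on_duhamel[OF S] source_continuous)
qed

text \<open>Integrating the weight \<open>exp (2Mt)\<close> against the bound \<open>M\<close> of the source gains the factor \<open>1/2\<close> in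
  every step of the iteration.\<close>

lemma picard_term_norm_le:
  "t \<in> {0..T} \<Longrightarrow> norm (picard_term S B X0 k t) \<le> norm X0 * (1/2) ^ k * exp (2 * M * t)"
proof (induction k arbitrary: t)
  case 0
  have "norm (S t X0) \<le> norm X0 * 1" using semigroup_norm_le[OF S, of t X0] 0 by simp
  also have "\<dots> \<le> norm X0 * exp (2 * M * t)"
    using 0 M by (intro mult_left_mono) auto
  finally show ?case by simp
next
  case (Suc k)
  let ?c = "M * (norm X0 * (1/2) ^ k)"
  have I: "((\<lambda>s. ?c * exp (2 * M * s)) has_integral ?c * ((exp (2 * M * t) - 1) / (2 * M))) {0..t}"
    using has_integral_exp_scaled[of "2 * M" t] M Suc.prems by (intro has_integral_mult_right) auto
  have "norm (picard_term S B X0 (Suc k) t) \<le> ?c * ((exp (2 * M * t) - 1) / (2 * M))"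
    unfolding picard_term.simps
  proof (rule duhamel_norm_le[OF S source_continuous[OF picard_term_continuous] Suc.prems I])
    fix s assume "s \<in> {0..t}"
    then have s: "s \<in> {0..T}" using Suc.prems by auto
    show "norm (B s (picard_term S B X0 k s)) \<le> ?c * exp (2 * M * s)"
      using order_trans[OF source_norm_le[OF s] mult_left_mono[OF Suc.IH[OF s]]] M
      by (simp add: mult_ac)
  qed
  also have "\<dots> = norm X0 * (1/2) ^ Suc k * (exp (2 * M * t) - 1)" using M by simp
  also have "\<dots> \<le> norm X0 * (1/2) ^ Suc k * exp (2 * M * t)"
    by (intro mult_left_mono) auto
  finally show ?case .
qed

lemma volterra_solution_exists: "\<exists>X. volterra_solution S B T X0 X"
proof -
  define P where "P N t = (\<Sum>k<N. picard_term S B X0 k t)" for N t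
  define X where "X t = (\<Sum>k. picard_term S B X0 k t)" for t
  have u: "uniform_limit {0..T} P X sequentially"
    unfolding P_def X_def
  proof (rule Weierstrass_m_test)
    fix k t assume t: "t \<in> {0..T}"
    have "norm (picard_term S B X0 k t) \<le> norm X0 * (1/2) ^ k * exp (2 * M * t)"
      by (rule picard_term_norm_le[OF t])
    also have "\<dots> \<le> norm X0 * (1/2) ^ k * exp (2 * M * T)"
      using t M by (intro mult_left_mono) auto
    finally show "norm (picard_term S B X0 k t) \<le> norm X0 * (1/2) ^ k * exp (2 * M * T)" .
  next
    show "summable (\<lambda>k. norm X0 * (1/2) ^ k * exp (2 * M * T))"
      by (intro summable_mult summable_mult2 summable_geometric) simp
  qed
  have Pc: "continuous_on {0..T} (P N)" for N
    unfolding P_def by (intro continuous_on_sum picard_term_continuous)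
  have Xc: "continuous_on {0..T} X"
    using u Pc by (intro uniform_limit_theorem[OF _ u]) auto
  have step: "P (Suc N) t = S t X0 + duhamel S (\<lambda>s. B s (P N s)) t" if t: "t \<in> {0..T}" for N t
  proof (induction N)
    case 0
    then show ?case by (simp add: P_def duhamel_def)
  next
    case (Suc N)
    have "P (Suc (Suc N)) t = P (Suc N) t + picard_term S B X0 (Suc N) t" by (simp add: P_def)
    also have "\<dots> = S t X0 + (duhamel S (\<lambda>s. B s (P N s)) t
        + duhamel S (\<lambda>s. B s (picard_term S B X0 N s)) t)"
      using Suc by simp
    also have "\<dots> = S t X0 + duhamel S (\<lambda>s. B s (P N s) + B s (picard_term S B X0 N s)) t"
      by (subst duhamel_add[OF S source_continuous source_continuous t])
        (auto intro: Pc picard_term_continuous)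
    also have "(\<lambda>s. B s (P N s) + B s (picard_term S B X0 N s)) = (\<lambda>s. B s (P (Suc N) s))"
      by (simp add: P_def blinfun.add_right fun_eq_iff)
    finally show ?case .
  qed
  have "X t = S t X0 + duhamel S (\<lambda>s. B s (X s)) t" if t: "t \<in> {0..T}" for t
  proof -
    have "(\<lambda>N. duhamel S (\<lambda>s. B s (P N s)) t) \<longlonglongrightarrow> duhamel S (\<lambda>s. B s (X s)) t"
    proof (rule metric_LIMSEQ_I)
      fix e :: real assume e: "e > 0"
      define d where "d = e / (2 * (M * (T + 1)))"
      have d: "d > 0" using e M T by (simp add: d_def)
      have "\<forall>\<^sub>F N in sequentially. \<forall>s\<in>{0..T}. dist (P N s) (X s) < d"
        using u d by (simp add: uniform_limit_iff)
      then obtain N0 where N0: "\<And>N s. N \<ge> N0 \<Longrightarrow> s \<in> {0..T} \<Longrightarrow> norm (P N s - X s) < d"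
        unfolding eventually_sequentially dist_norm by blast
      have "dist (duhamel S (\<lambda>s. B s (P N s)) t) (duhamel S (\<lambda>s. B s (X s)) t) < e" if "N \<ge> N0" for N
      proof -
        have "((\<lambda>s. M * d) has_integral M * d * t) {0..t}"
          using has_integral_const_real[of "M * d" 0 t] t by (simp add: mult.commute)
        then have "norm (duhamel S (\<lambda>s. B s (P N s - X s)) t) \<le> M * d * t"
        proof (rule duhamel_norm_le[OF S source_continuous[OF continuous_on_diff[OF Pc Xc]] t])
          fix s assume "s \<in> {0..t}"
          then have s: "s \<in> {0..T}" using t by auto
          show "norm (B s (P N s - X s)) \<le> M * d"
            using order_trans[OF source_norm_le[OF s] mult_left_mono[OF less_imp_le[OF N0[OF that s]]]] M
            by simp
        qed
        also have "M * d * t \<le> M * d * (T + 1)" using t d M by (intro mult_left_mono) auto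
        also have "\<dots> = e / 2" using M T by (simp add: d_def divide_simps)
        also have "\<dots> < e" using e by simp
        finally show ?thesis
          using duhamel_diff[OF S source_continuous[OF Pc[of N]] source_continuous[OF Xc] t]
          by (simp add: dist_norm blinfun.diff_right)
      qed
      then show "\<exists>N0. \<forall>N\<ge>N0. dist (duhamel S (\<lambda>s. B s (P N s)) t)
          (duhamel S (\<lambda>s. B s (X s)) t) < e" by blast
    qed
    then have "(\<lambda>N. P (Suc N) t) \<longlonglongrightarrow> S t X0 + duhamel S (\<lambda>s. B s (X s)) t"
      unfolding step[OF t] by (intro tendsto_intros)
    moreover have "(\<lambda>N. P (Suc N) t) \<longlonglongrightarrow> X t"
      using tendsto_uniform_limitI[OF u t] by (rule LIMSEQ_Suc)
    ultimately show ?thesis by (rule LIMSEQ_unique[symmetric])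
  qed
  with Xc show ?thesis unfolding volterra_solution_def by blast
qed

text \<open>This one estimate serves three purposes: \<open>r = 0\<close> bounds solutions by their initial value,
  hence gives uniqueness, and \<open>Z = 0\<close> bounds the effect of a residual.\<close>

lemma volterra_perturbation_bound:
  assumes X: "continuous_on {0..T} X" and r: "continuous_on {0..T} r"
    and r\<rho>: "\<And>s. s \<in> {0..T} \<Longrightarrow> norm (r s) \<le> \<rho>"
    and eq: "\<And>t. t \<in> {0..T} \<Longrightarrow> X t = S t Z + duhamel S (\<lambda>s. B s (X s) + r s) t"
    and t: "t \<in> {0..T}"
  shows "norm (X t) \<le> 2 * (norm Z + T * \<rho>) * exp (2 * M * t)"
proof -
  have \<rho>: "\<rho> \<ge> 0" using order_trans[OF norm_ge_zero r\<rho>[of 0]] T by simp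
  have "norm (X t) \<le> 2 * max (norm Z + T * \<rho>) 0 * exp (2 * M * t)"
  proof (rule gronwall_doubled[OF continuous_on_norm[OF X] M T _ t])
    fix t assume t: "t \<in> {0..T}"
    have "norm (duhamel S (\<lambda>s. B s (X s)) t) \<le> M * integral {0..t} (\<lambda>s. norm (X s))"
    proof (rule duhamel_norm_le[OF S source_continuous[OF X] t])
      have "(\<lambda>s. norm (X s)) integrable_on {0..t}"
        using X t by (intro integrable_continuous_real continuous_on_norm)
          (auto elim: continuous_on_subset)
      then show "((\<lambda>s. M * norm (X s)) has_integral M * integral {0..t} (\<lambda>s. norm (X s))) {0..t}"
        by (intro has_integral_mult_right integrable_integral)
    qed (use t source_norm_le in auto)
    moreover have "norm (duhamel S r t) \<le> \<rho> * t"
      using has_integral_const_real[of \<rho> 0 t] t r\<rho>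
      by (intro duhamel_norm_le[OF S r t, of "\<lambda>s. \<rho>"]) (auto simp: mult.commute)
    moreover have "\<rho> * t \<le> T * \<rho>" using t \<rho> by (simp add: mult_left_mono mult.commute[of T])
    moreover have "norm (S t Z) \<le> norm Z" using semigroup_norm_le[OF S] t by auto
    moreover have "norm (X t) \<le> norm (S t Z) + (norm (duhamel S (\<lambda>s. B s (X s)) t) + norm (duhamel S r t))"
      unfolding eq[OF t] duhamel_add[OF S source_continuous[OF X] r t]
      by (meson add_left_mono norm_triangle_ineq order_trans)
    ultimately show "norm (X t) \<le> norm Z + T * \<rho> + M * integral {0..t} (\<lambda>s. norm (X s))"
      by linarith
  qed
  moreover have "norm Z + T * \<rho> \<ge> 0" using T \<rho> by simp
  ultimately show ?thesis by (simp add: max_def)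
qed

lemma volterra_solution_combine:
  assumes "volterra_solution S B T X0 X" "volterra_solution S B T Y0 Y"
  shows "volterra_solution S B T (X0 + c *\<^sub>R Y0) (\<lambda>t. X t + c *\<^sub>R Y t)"
proof -
  have Xc: "continuous_on {0..T} X" and Yc: "continuous_on {0..T} Y"
    using assms by (auto simp: volterra_solution_def)
  have "X t + c *\<^sub>R Y t = S t (X0 + c *\<^sub>R Y0) + duhamel S (\<lambda>s. B s (X s + c *\<^sub>R Y s)) t"
    if t: "t \<in> {0..T}" for t
  proof -
    have "duhamel S (\<lambda>s. B s (X s + c *\<^sub>R Y s)) t
        = duhamel S (\<lambda>s. B s (X s) + c *\<^sub>R B s (Y s)) t"
      by (simp add: blinfun.add_right blinfun.scaleR_right)
    also have "\<dots> = duhamel S (\<lambda>s. B s (X s)) t + c *\<^sub>R duhamel S (\<lambda>s. B s (Y s)) t"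
      by (simp add: duhamel_add[OF S source_continuous[OF Xc] continuous_on_scaleR[OF
          continuous_on_const source_continuous[OF Yc]] t] duhamel_scaleR[OF S source_continuous[OF Yc] t])
    moreover have "X t = S t X0 + duhamel S (\<lambda>s. B s (X s)) t"
      "Y t = S t Y0 + duhamel S (\<lambda>s. B s (Y s)) t"
      using assms t by (auto simp: volterra_solution_def)
    ultimately show ?thesis
      by (simp add: blinfun.add_right blinfun.scaleR_right algebra_simps)
  qed
  then show ?thesis using Xc Yc by (auto simp: volterra_solution_def intro!: continuous_intros)
qed

lemma volterra_solution_norm_le:
  assumes "volterra_solution S B T X0 X" "t \<in> {0..T}"
  shows "norm (X t) \<le> 2 * exp (2 * M * t) * norm X0"
  using volterra_perturbation_bound[of X "\<lambda>_. 0" 0 X0 t] assms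
  by (auto simp: volterra_solution_def mult_ac)

lemma volterra_solution_unique:
  assumes "volterra_solution S B T X0 X" "volterra_solution S B T X0 Y" "t \<in> {0..T}"
  shows "X t = Y t"
  using volterra_solution_norm_le[OF volterra_solution_combine[OF assms(1,2), of "-1"] assms(3)]
  by simp

lemma volterra_end_eq: "volterra_solution S B T X0 X \<Longrightarrow> volterra_end S B T X0 = X T"
  unfolding volterra_end_def using volterra_solution_unique T
  by (intro the_equality) auto

lemma bounded_linear_volterra_end: "bounded_linear (volterra_end S B T)"
proof (rule bounded_linear_intro)
  have comb: "volterra_end S B T (x + c *\<^sub>R y) = volterra_end S B T x + c *\<^sub>R volterra_end S B T y" for x y c
  proof -
    obtain X Y where XY: "volterra_solution S B T x X" "volterra_solution S B T y Y"
      using volterra_solution_exists by meson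
    from volterra_solution_combine[OF this, of c] XY show ?thesis by (simp add: volterra_end_eq)
  qed
  fix x y :: 'a and c :: real
  show "volterra_end S B T (x + y) = volterra_end S B T x + volterra_end S B T y" using comb[of x 1 y] by simp
  have "volterra_end S B T 0 = 0" using comb[of 0 1 0] by simp
  then show "volterra_end S B T (c *\<^sub>R x) = c *\<^sub>R volterra_end S B T x" using comb[of 0 c x] by simp
  obtain X where X: "volterra_solution S B T x X" using volterra_solution_exists by meson
  from volterra_solution_norm_le[OF this, of T] T
  show "norm (volterra_end S B T x) \<le> norm x * (2 * exp (2 * M * T))"
    by (simp add: volterra_end_eq[OF X] mult_ac)
qed

lemma volterra_end_close:
  assumes X: "continuous_on {0..T} X" and r: "continuous_on {0..T} r"
    and r\<rho>: "\<And>s. s \<in> {0..T} \<Longrightarrow> norm (r s) \<le> \<rho>"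
    and eq: "\<And>t. t \<in> {0..T} \<Longrightarrow> X t = S t (X 0) + duhamel S (\<lambda>s. B s (X s) + r s) t"
  shows "norm (volterra_end S B T (X 0) - X T) \<le> 2 * T * \<rho> * exp (2 * M * T)"
proof -
  obtain Y where Y: "volterra_solution S B T (X 0) Y" using volterra_solution_exists by meson
  then have Yc: "continuous_on {0..T} Y" by (simp add: volterra_solution_def)
  have "norm (X T - Y T) \<le> 2 * (norm (0::'a) + T * \<rho>) * exp (2 * M * T)"
  proof (rule volterra_perturbation_bound[OF continuous_on_diff[OF X Yc] r r\<rho>])
    fix t assume t: "t \<in> {0..T}"
    have "X t - Y t = duhamel S (\<lambda>s. B s (X s) + r s) t - duhamel S (\<lambda>s. B s (Y s)) t"
      using eq[OF t] Y t by (auto simp: volterra_solution_def)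
    also have "\<dots> = duhamel S (\<lambda>s. (B s (X s) + r s) - B s (Y s)) t"
      by (rule duhamel_diff[OF S continuous_on_add[OF source_continuous[OF X] r]
          source_continuous[OF Yc] t, symmetric])
    finally show "X t - Y t = S t 0 + duhamel S (\<lambda>s. B s (X s - Y s) + r s) t"
      by (simp add: blinfun.diff_right algebra_simps)
  qed (use T in auto)
  then show ?thesis by (simp add: volterra_end_eq[OF Y] norm_minus_commute)
qed

end

text \<open>The formula is the fundamental theorem of calculus for \<open>s \<mapsto> S(t - s) Y(s)\<close>. The generator
  only provides right derivatives at \<open>0\<close>, but this determines the difference quotients on both sides of
  \<open>s\<close>: with \<open>h = |y - s|\<close>, the semigroup property writes the increment as
  \<open>S(t - y) (Y(y) - S(h) Y(s))\<close> for \<open>y > s\<close> and as \<open>S(t - s) (S(h) Y(y) - Y(s))\<close> for \<open>y < s\<close>. The proof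
  bounds both by the same four terms, which are \<open>o(h)\<close>.\<close>

lemma classical_solution_duhamel:
  fixes S :: "real \<Rightarrow> 'a::banach \<Rightarrow>\<^sub>L 'a"
  assumes S: "contraction_semigroup S" and gen: "generated_by S A"
    and Y: "\<And>s. s \<in> {0..T} \<Longrightarrow> (Y has_vector_derivative Y' s) (at s within {0..T})"
    and dom: "\<And>s. s \<in> {0..T} \<Longrightarrow> A (Y s) (Y' s - f s)"
    and t: "t \<in> {0..T}"
  shows "Y t = S t (Y 0) + duhamel S f t"
proof -
  have der: "((\<lambda>s. S (t - s) (Y s)) has_vector_derivative S (t - s) (f s)) (at s within {0..t})"
    if s: "s \<in> {0..t}" for s
  proof -
    have sT: "s \<in> {0..T}" using s t by auto
    define \<rho> where "\<rho> y = Y y - (Y s + (y - s) *\<^sub>R Y' s)" for y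
    define \<kappa> where "\<kappa> h = S h (Y s) - Y s - h *\<^sub>R (Y' s - f s)" for h
    have "(Y has_vector_derivative Y' s) (at s within {0..t})"
      using Y[OF sT] t by (auto elim: has_vector_derivative_within_subset)
    then have l1: "((\<lambda>y. norm ((1 / norm (y - s)) *\<^sub>R \<rho> y)) \<longlongrightarrow> 0) (at s within {0..t})"
      unfolding has_vector_derivative_def has_derivative_within \<rho>_def
      by (intro tendsto_norm_zero) auto
    have quot: "((\<lambda>h. (S h (Y s) - Y s) /\<^sub>R h) \<longlongrightarrow> Y' s - f s) (at_right 0)"
      using gen dom[OF sT] by (auto simp: generated_by_def)
    have "((\<lambda>h. norm ((S h (Y s) - Y s) /\<^sub>R h - (Y' s - f s))) \<longlongrightarrow> 0) (at_right 0)"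
      by (intro tendsto_norm_zero LIM_zero quot)
    moreover have "filterlim (\<lambda>y. \<bar>y - s\<bar>) (at_right 0) (at s within {0..t})"
      unfolding filterlim_at
    proof
      show "\<forall>\<^sub>F y in at s within {0..t}. \<bar>y - s\<bar> \<in> {0<..} \<and> \<bar>y - s\<bar> \<noteq> 0"
        by (auto simp: eventually_at_filter)
      have "((\<lambda>y. \<bar>y - s\<bar>) \<longlongrightarrow> \<bar>s - s\<bar>) (at s within {0..t})" by (intro tendsto_intros)
      then show "((\<lambda>y. \<bar>y - s\<bar>) \<longlongrightarrow> 0) (at s within {0..t})" by simp
    qed
    ultimately have l2: "((\<lambda>y. norm ((S \<bar>y - s\<bar> (Y s) - Y s) /\<^sub>R \<bar>y - s\<bar> - (Y' s - f s))) \<longlongrightarrow> 0)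
        (at s within {0..t})"
      by (rule filterlim_compose)
    have "continuous_on {0..t} (\<lambda>y. S (t - y) (f s))"
      by (intro semigroup_continuous_on[OF S] continuous_intros) auto
    then have l3: "((\<lambda>y. norm (S (t - y) (f s) - S (t - s) (f s))) \<longlongrightarrow> 0) (at s within {0..t})"
      using s by (intro tendsto_norm_zero LIM_zero) (auto simp: continuous_on_def)
    have "continuous_on {0..t} (\<lambda>y. S \<bar>y - s\<bar> (Y' s))"
      by (intro semigroup_continuous_on[OF S] continuous_intros) auto
    then have "((\<lambda>y. S \<bar>y - s\<bar> (Y' s)) \<longlongrightarrow> S \<bar>s - s\<bar> (Y' s)) (at s within {0..t})"
      using s unfolding continuous_on_def by blast
    moreover have "S \<bar>s - s\<bar> (Y' s) = Y' s" using S by (simp add: contraction_semigroup_def)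
    ultimately have l4: "((\<lambda>y. norm (S \<bar>y - s\<bar> (Y' s) - Y' s)) \<longlongrightarrow> 0) (at s within {0..t})"
      by (intro tendsto_norm_zero LIM_zero) auto
    let ?\<phi> = "\<lambda>s. S (t - s) (Y s)"
    let ?R = "\<lambda>y. ?\<phi> y - (?\<phi> s + (y - s) *\<^sub>R S (t - s) (f s))"
    have semi: "S (a + b) x = S a (S b x)" if "a \<ge> 0" "b \<ge> 0" for a b x
      using S that by (simp add: contraction_semigroup_def)
    let ?w = "\<lambda>y. norm (S (t - y) (f s) - S (t - s) (f s)) + norm (S \<bar>y - s\<bar> (Y' s) - Y' s)"
    have bound: "norm (?R y) \<le> norm (\<rho> y) + norm (\<kappa> \<bar>y - s\<bar>) + \<bar>y - s\<bar> * ?w y"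
      if y: "y \<in> {0..t}" for y
    proof (cases "s \<le> y")
      case True
      have "S (t - s) (Y s) = S (t - y) (S (y - s) (Y s))"
        using semi[of "t - y" "y - s"] y True by simp
      then have "?R y = S (t - y) (\<rho> y - \<kappa> (y - s))
          + (y - s) *\<^sub>R (S (t - y) (f s) - S (t - s) (f s))"
        by (simp add: \<rho>_def \<kappa>_def blinfun.bilinear_simps algebra_simps)
      also have "norm \<dots> \<le> (norm (\<rho> y) + norm (\<kappa> (y - s)))
          + (y - s) * norm (S (t - y) (f s) - S (t - s) (f s))"
        using semigroup_norm_le[OF S, of "t - y" "\<rho> y - \<kappa> (y - s)"] y True
          norm_triangle_ineq4[of "\<rho> y" "\<kappa> (y - s)"]
        by (intro norm_triangle_le add_mono) auto
      also have "\<dots> \<le> norm (\<rho> y) + norm (\<kappa> \<bar>y - s\<bar>) + \<bar>y - s\<bar> * ?w y"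
        using True by (intro add_mono mult_mono) auto
      finally show ?thesis .
    next
      case False
      have "S (t - y) (Y y) = S (t - s) (S (s - y) (Y y))"
        using semi[of "t - s" "s - y"] y s False by simp
      moreover have "Y y = \<rho> y + Y s + (y - s) *\<^sub>R Y' s" by (simp add: \<rho>_def)
      ultimately have "S (t - y) (Y y) = S (t - s) (S (s - y) (\<rho> y + Y s + (y - s) *\<^sub>R Y' s))"
        by simp
      then have "?R y = S (t - s) (\<kappa> (s - y) + S (s - y) (\<rho> y)
          + (s - y) *\<^sub>R (Y' s - S (s - y) (Y' s)))"
        by (simp add: \<kappa>_def blinfun.bilinear_simps algebra_simps)
      also have "norm \<dots> \<le> norm (\<kappa> (s - y) + S (s - y) (\<rho> y)
          + (s - y) *\<^sub>R (Y' s - S (s - y) (Y' s)))"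
        using semigroup_norm_le[OF S] s by auto
      also have "\<dots> \<le> (norm (\<kappa> (s - y)) + norm (\<rho> y)) + (s - y) * norm (Y' s - S (s - y) (Y' s))"
        using semigroup_norm_le[OF S, of "s - y" "\<rho> y"] False
          norm_triangle_ineq[of "\<kappa> (s - y)" "S (s - y) (\<rho> y)"]
        by (intro norm_triangle_le add_mono) auto
      also have "\<dots> \<le> norm (\<rho> y) + norm (\<kappa> \<bar>y - s\<bar>) + \<bar>y - s\<bar> * ?w y"
        using False by (simp add: ring_distribs norm_minus_commute abs_minus_commute mult_right_mono)
      finally show ?thesis .
    qed
    have "((\<lambda>y. (1 / norm (y - s)) *\<^sub>R ?R y) \<longlongrightarrow> 0) (at s within {0..t})"
    proof (rule Lim_null_comparison)
      have *: "norm ((1 / norm (y - s)) *\<^sub>R ?R y) \<le> norm ((1 / norm (y - s)) *\<^sub>R \<rho> y)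
          + norm ((S \<bar>y - s\<bar> (Y s) - Y s) /\<^sub>R \<bar>y - s\<bar> - (Y' s - f s))
          + norm (S (t - y) (f s) - S (t - s) (f s)) + norm (S \<bar>y - s\<bar> (Y' s) - Y' s)"
        if y: "y \<in> {0..t}" "y \<noteq> s" for y
      proof -
        have "(S \<bar>y - s\<bar> (Y s) - Y s) /\<^sub>R \<bar>y - s\<bar> - (Y' s - f s) = \<kappa> \<bar>y - s\<bar> /\<^sub>R \<bar>y - s\<bar>"
          using y by (simp add: \<kappa>_def scaleR_diff_right)
        then have "norm ((S \<bar>y - s\<bar> (Y s) - Y s) /\<^sub>R \<bar>y - s\<bar> - (Y' s - f s)) = norm (\<kappa> \<bar>y - s\<bar>) / \<bar>y - s\<bar>"
          by (simp add: divide_inverse mult.commute)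
        moreover have "norm (?R y) / \<bar>y - s\<bar> \<le> (norm (\<rho> y) + norm (\<kappa> \<bar>y - s\<bar>)
          + \<bar>y - s\<bar> * ?w y) / \<bar>y - s\<bar>"
          using bound[OF y(1)] by (rule divide_right_mono) simp
        ultimately show ?thesis using y(2) by (simp add: add_divide_distrib)
      qed
      show "\<forall>\<^sub>F y in at s within {0..t}. norm ((1 / norm (y - s)) *\<^sub>R ?R y)
          \<le> norm ((1 / norm (y - s)) *\<^sub>R \<rho> y)
          + norm ((S \<bar>y - s\<bar> (Y s) - Y s) /\<^sub>R \<bar>y - s\<bar> - (Y' s - f s))
          + norm (S (t - y) (f s) - S (t - s) (f s)) + norm (S \<bar>y - s\<bar> (Y' s) - Y' s)"
        unfolding eventually_at_filter using * by (intro always_eventually) blast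
      show "((\<lambda>y. norm ((1 / norm (y - s)) *\<^sub>R \<rho> y)
          + norm ((S \<bar>y - s\<bar> (Y s) - Y s) /\<^sub>R \<bar>y - s\<bar> - (Y' s - f s))
          + norm (S (t - y) (f s) - S (t - s) (f s)) + norm (S \<bar>y - s\<bar> (Y' s) - Y' s)) \<longlongrightarrow> 0)
          (at s within {0..t})"
        using tendsto_add[OF tendsto_add[OF tendsto_add[OF l1 l2] l3] l4] by simp
    qed
    then show ?thesis
      by (simp add: has_vector_derivative_def has_derivative_within bounded_linear_scaleR_left)
  qed
  have "((\<lambda>s. S (t - s) (f s)) has_integral S (t - t) (Y t) - S (t - 0) (Y 0)) {0..t}"
    using t der by (intro fundamental_theorem_of_calculus) auto
  then have "duhamel S f t = S (t - t) (Y t) - S (t - 0) (Y 0)"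
    unfolding duhamel_def by (rule integral_unique)
  then show ?thesis using S by (simp add: contraction_semigroup_def)
qed

section \<open>The space \<open>L\<^sup>2\<close> of the torus\<close>

lemma space_torus: "space torus = {0..<2*pi} \<times> {0..<2*pi}"
  by (simp add: torus_def space_restrict_space)

lemma cell_sets [measurable]: "{0..<2*pi} \<times> {0..<2*pi} \<in> sets (borel :: plane measure)"
  by (simp add: borel_prod[symmetric])

lemma borel_measurable_torus:
  "f \<in> borel_measurable borel \<Longrightarrow> f \<in> borel_measurable torus"
  by (simp add: torus_def measurable_restrict_space1)

lemma emeasure_torus: "emeasure torus (space torus) = ennreal (4 * pi\<^sup>2)"
proof -
  have "emeasure torus (space torus) = emeasure (lborel \<Otimes>\<^sub>M lborel) ({0..<2*pi} \<times> {0..<2*pi::real})"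
    by (simp add: torus_def space_restrict_space emeasure_restrict_space lborel_prod)
  also have "\<dots> = ennreal (2*pi) * ennreal (2*pi)"
    by (subst lborel.emeasure_pair_measure_Times) auto
  finally show ?thesis by (simp add: ennreal_mult[symmetric] power2_eq_square)
qed

interpretation torus: finite_measure torus
  by standard (simp add: emeasure_torus)

lemma measure_torus: "measure torus (space torus) = 4 * pi\<^sup>2"
  by (simp add: measure_def emeasure_torus)

lemma rep_L2_sq: "sq_integrable (rep_L2 f)"
  using Quotient_rep_reflp[OF Quotient_L2, of f] by (simp add: L2_eq_def)

lemma abs_rep_L2 [simp]: "abs_L2 (rep_L2 f) = f"
  by (rule Quotient_abs_rep[OF Quotient_L2])

lemma rep_abs_L2_AE: "sq_integrable f \<Longrightarrow> AE x in torus. rep_L2 (abs_L2 f) x = f x"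
  using Quotient_rep_abs[OF Quotient_L2, of f] by (simp add: L2_eq_def)

lemma abs_L2_eqI:
  "sq_integrable f \<Longrightarrow> sq_integrable g \<Longrightarrow> (AE x in torus. f x = g x) \<Longrightarrow> abs_L2 f = abs_L2 g"
  by (rule Quotient_rel_abs[OF Quotient_L2]) (simp add: L2_eq_def)

lemma abs_L2_add:
  "sq_integrable f \<Longrightarrow> sq_integrable g \<Longrightarrow> abs_L2 f + abs_L2 g = abs_L2 (\<lambda>x. f x + g x)"
  by (rule plus_L2.abs_eq) (auto simp: L2_eq_def)

lemma abs_L2_diff:
  "sq_integrable f \<Longrightarrow> sq_integrable g \<Longrightarrow> abs_L2 f - abs_L2 g = abs_L2 (\<lambda>x. f x - g x)"
  by (rule minus_L2.abs_eq) (auto simp: L2_eq_def)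

lemma abs_L2_uminus: "sq_integrable f \<Longrightarrow> - abs_L2 f = abs_L2 (\<lambda>x. - f x)"
  by (rule uminus_L2.abs_eq) (auto simp: L2_eq_def)

lemma abs_L2_scaleR: "sq_integrable f \<Longrightarrow> c *\<^sub>R abs_L2 f = abs_L2 (\<lambda>x. c *\<^sub>R f x)"
  by (rule scaleR_L2.abs_eq) (auto simp: L2_eq_def)

lemma abs_L2_zero: "abs_L2 (\<lambda>x. 0) = 0"
  by (simp add: zero_L2_def)

lemma norm_abs_L2: "sq_integrable f \<Longrightarrow> (norm (abs_L2 f))\<^sup>2 = (\<integral>x. (norm (f x))\<^sup>2 \<partial>torus)"
  unfolding power2_norm_eq_inner
  by (subst inner_L2.abs_eq) (auto simp: L2_eq_def)

lemma nn_integral_norm_abs_L2: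
  "sq_integrable f \<Longrightarrow> (\<integral>\<^sup>+x. ennreal ((norm (f x))\<^sup>2) \<partial>torus) = ennreal ((norm (abs_L2 f))\<^sup>2)"
  unfolding norm_abs_L2 by (intro nn_integral_eq_integral) (auto simp: sq_integrable_def)

lemma sq_integrable_bounded:
  assumes "f \<in> borel_measurable torus" "\<And>x. x \<in> space torus \<Longrightarrow> norm (f x) \<le> C"
  shows "sq_integrable f"
proof -
  have "norm ((norm (f x))\<^sup>2) \<le> C\<^sup>2" if "x \<in> space torus" for x
    using assms(2)[OF that] by (simp add: power_mono)
  then show ?thesis
    using assms(1) unfolding sq_integrable_def
    by (auto intro!: torus.integrable_const_bound[of _ "C\<^sup>2"] AE_I2)
qed

lemma norm_abs_L2_le_mono:
  assumes "sq_integrable f" "sq_integrable g" "C \<ge> 0"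
    and "\<And>x. x \<in> space torus \<Longrightarrow> norm (f x) \<le> C * norm (g x)"
  shows "norm (abs_L2 f) \<le> C * norm (abs_L2 g)"
proof (rule power2_le_imp_le)
  have "(norm (f x))\<^sup>2 \<le> C\<^sup>2 * (norm (g x))\<^sup>2" if "x \<in> space torus" for x
    using power_mono[OF assms(4)[OF that], of 2] by (simp add: power_mult_distrib)
  then have "(norm (abs_L2 f))\<^sup>2 \<le> (\<integral>x. C\<^sup>2 * (norm (g x))\<^sup>2 \<partial>torus)"
    using assms unfolding norm_abs_L2[OF assms(1)]
    by (intro integral_mono) (auto simp: sq_integrable_def)
  then show "(norm (abs_L2 f))\<^sup>2 \<le> (C * norm (abs_L2 g))\<^sup>2"
    by (simp add: power_mult_distrib norm_abs_L2[OF assms(2)])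
qed (use assms in simp)

lemma norm_abs_L2_le_sup:
  assumes "f \<in> borel_measurable torus" "C \<ge> 0" "\<And>x. x \<in> space torus \<Longrightarrow> norm (f x) \<le> C"
  shows "norm (abs_L2 f) \<le> 2 * pi * C"
proof (rule power2_le_imp_le)
  have f: "sq_integrable f" using sq_integrable_bounded assms(1,3) by blast
  have "(norm (f x))\<^sup>2 \<le> C\<^sup>2" if "x \<in> space torus" for x
    using power_mono[OF assms(3)[OF that], of 2] by simp
  then have "(norm (abs_L2 f))\<^sup>2 \<le> (\<integral>x. C\<^sup>2 \<partial>torus)"
    using f unfolding norm_abs_L2[OF f] by (intro integral_mono) (auto simp: sq_integrable_def)
  then show "(norm (abs_L2 f))\<^sup>2 \<le> (2 * pi * C)\<^sup>2"
    by (simp add: measure_torus power_mult_distrib)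
qed (use assms in simp)

lemma compact_cell: "compact (cbox (0, 0) (2*pi, 2*pi) :: plane set)"
  by (rule compact_cbox)

lemma torus_subset_cell: "space torus \<subseteq> cbox (0, 0) (2*pi, 2*pi)"
  by (auto simp: space_torus cbox_Pair_eq)

lemma continuous_bounded_on_torus:
  fixes v :: "plane \<Rightarrow> 'b::real_normed_vector"
  assumes "continuous_on UNIV v"
  shows "\<exists>C\<ge>0. \<forall>x\<in>space torus. norm (v x) \<le> C"
proof -
  have "compact (v ` cbox (0, 0) (2*pi, 2*pi))"
    using assms compact_cell by (blast intro: compact_continuous_image continuous_on_subset)
  then obtain C where C: "\<And>x. x \<in> cbox (0, 0) (2*pi, 2*pi) \<Longrightarrow> norm (v x) \<le> C"
    using compact_imp_bounded bounded_iff by (metis imageI)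
  then have "norm (v x) \<le> max C 0" if "x \<in> space torus" for x
    using that torus_subset_cell by (meson max.coboundedI1 subsetD)
  then show ?thesis by (intro exI[of _ "max C 0"]) auto
qed

lemma continuous_integrable_torus:
  fixes f :: "plane \<Rightarrow> 'b::euclidean_space"
  assumes f: "continuous_on UNIV f"
  shows "integrable torus f"
proof -
  obtain C where "\<And>x. x \<in> space torus \<Longrightarrow> norm (f x) \<le> C"
    using continuous_bounded_on_torus[OF f] by blast
  then show ?thesis
    by (intro torus.integrable_const_bound[of _ C] borel_measurable_torus
        borel_measurable_continuous_onI f AE_I2) auto
qed

lemma continuous_sq_integrable:
  assumes f: "continuous_on UNIV f"
  shows "sq_integrable f"
  unfolding sq_integrable_def
  by (intro conjI borel_measurable_torus borel_measurable_continuous_onI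
      continuous_integrable_torus continuous_intros f)

text \<open>Riesz--Fischer. On a finite measure space, consecutive differences \<open>d\<^sub>k\<close> with
  \<open>\<parallel>d\<^sub>k\<parallel> \<le> 2\<^sup>-\<^sup>k\<close> obey \<open>|d\<^sub>k| \<le> 2\<^sup>-\<^sup>k + 2\<^sup>k|d\<^sub>k|\<^sup>2\<close>, so their sum is integrable, hence finite almost
  everywhere; Fatou's lemma identifies the pointwise limit as the limit in \<open>L\<^sup>2\<close>.\<close>

lemma L2_fast_Cauchy_convergent:
  fixes X :: "nat \<Rightarrow> 'a::euclidean_space L2"
  assumes X: "\<And>j k. j \<ge> k \<Longrightarrow> norm (X j - X k) \<le> (1/2) ^ k"
  shows "\<exists>L. X \<longlonglongrightarrow> L"
proof -
  define f where "f k = rep_L2 (X k)" for k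
  have fsq: "sq_integrable (f k)" for k by (simp add: f_def rep_L2_sq)
  have fm [measurable]: "f k \<in> borel_measurable torus" for k
    using fsq by (simp add: sq_integrable_def)
  have dist: "(\<integral>\<^sup>+x. ennreal ((norm (f j x - f k x))\<^sup>2) \<partial>torus) = ennreal ((norm (X j - X k))\<^sup>2)" for j k
    using nn_integral_norm_abs_L2[OF sq_integrable_diff[OF fsq fsq]] abs_L2_diff[OF fsq fsq]
    by (simp add: f_def)
  let ?g = "\<lambda>k x. norm (f (Suc k) x - f k x)"
  have gint: "(\<integral>\<^sup>+x. ennreal (?g k x) \<partial>torus) \<le> ennreal ((4 * pi\<^sup>2 + 1) * (1/2) ^ k)" for k
  proof -
    have "?g k x \<le> (1/2) ^ k + 2 ^ k * (?g k x)\<^sup>2" for x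
    proof -
      have "0 \<le> (1 - 2 ^ k * ?g k x)\<^sup>2 + 2 ^ k * ?g k x" by simp
      also have "\<dots> \<le> 1 - 2 ^ k * ?g k x + (2 ^ k * ?g k x)\<^sup>2" 
        by (simp add: power2_eq_square algebra_simps)
      finally have "(1/2) ^ k * (2 ^ k * ?g k x) \<le> (1/2) ^ k * (1 + (2 ^ k * ?g k x)\<^sup>2)"
        by (intro mult_left_mono) auto
      then show ?thesis by (simp add: power2_eq_square field_simps)
    qed
    then have "(\<integral>\<^sup>+x. ennreal (?g k x) \<partial>torus)
        \<le> (\<integral>\<^sup>+x. ennreal ((1/2) ^ k) + ennreal (2 ^ k) * ennreal ((?g k x)\<^sup>2) \<partial>torus)"
      by (intro nn_integral_mono) (simp add: ennreal_mult[symmetric] ennreal_plus[symmetric] del: ennreal_plus)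
    also have "\<dots> = ennreal ((1/2) ^ k) * emeasure torus (space torus)
        + ennreal (2 ^ k) * ennreal ((norm (X (Suc k) - X k))\<^sup>2)"
      by (subst nn_integral_add) (auto simp: nn_integral_cmult dist)
    also have "\<dots> \<le> ennreal ((1/2) ^ k) * ennreal (4 * pi\<^sup>2) + ennreal (2 ^ k) * ennreal (((1/2) ^ k)\<^sup>2)"
      using X[of k "Suc k"]
      by (intro add_mono mult_left_mono ennreal_leI power_mono) (auto simp: emeasure_torus)
    also have "\<dots> = ennreal ((4 * pi\<^sup>2 + 1) * (1/2) ^ k)"
      by (simp add: ennreal_mult[symmetric] ennreal_plus[symmetric] power2_eq_square
          field_simps del: ennreal_plus)
    finally show ?thesis .
  qed
  have "(\<integral>\<^sup>+x. (\<Sum>k. ennreal (?g k x)) \<partial>torus) = (\<Sum>k. \<integral>\<^sup>+x. ennreal (?g k x) \<partial>torus)"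
    by (intro nn_integral_suminf) auto
  also have "\<dots> \<le> (\<Sum>k. ennreal ((4 * pi\<^sup>2 + 1) * (1/2) ^ k))"
    by (intro suminf_le gint) auto
  also have "\<dots> < \<infinity>"
    by (subst suminf_ennreal2) (auto intro!: summable_mult summable_geometric)
  finally have "AE x in torus. (\<Sum>k. ennreal (?g k x)) \<noteq> \<infinity>"
    by (intro nn_integral_noteq_infinite) auto
  then have conv: "AE x in torus. (\<lambda>k. f k x) \<longlonglongrightarrow> lim (\<lambda>k. f k x)"
  proof (rule AE_mp, intro AE_I2 impI)
    fix x assume "(\<Sum>k. ennreal (?g k x)) \<noteq> \<infinity>"
    then have "summable (\<lambda>k. ?g k x)"
      by (intro summable_suminf_not_top) auto
    then have "summable (\<lambda>k. f (Suc k) x - f k x)" by (rule summable_norm_cancel)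
    then have "(\<lambda>n. (\<Sum>k<n. f (Suc k) x - f k x) + f 0 x) \<longlonglongrightarrow> (\<Sum>k. f (Suc k) x - f k x) + f 0 x"
      by (intro tendsto_intros summable_LIMSEQ)
    moreover have "(\<lambda>n. (\<Sum>k<n. f (Suc k) x - f k x) + f 0 x) = (\<lambda>n. f n x)"
      by (rule ext, subst sum_lessThan_telescope[of "\<lambda>k. f k x"]) (rule diff_add_cancel)
    ultimately have *: "(\<lambda>n. f n x) \<longlonglongrightarrow> (\<Sum>k. f (Suc k) x - f k x) + f 0 x"
      by (simp only:)
    show "(\<lambda>k. f k x) \<longlonglongrightarrow> lim (\<lambda>k. f k x)"
      unfolding limI[OF *] by (rule *)
  qed
  define F where "F x = lim (\<lambda>k. f k x)" for x
  have Fm [measurable]: "F \<in> borel_measurable torus"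
    unfolding F_def by (rule borel_measurable_lim_metric) measurable
  have close: "(\<integral>\<^sup>+x. ennreal ((norm (F x - f k x))\<^sup>2) \<partial>torus) \<le> ennreal (((1/2) ^ k)\<^sup>2)" for k
  proof -
    have "AE x in torus. ennreal ((norm (F x - f k x))\<^sup>2)
        = liminf (\<lambda>j. ennreal ((norm (f j x - f k x))\<^sup>2))"
      using conv
    proof (rule AE_mp, intro AE_I2 impI)
      fix x assume "(\<lambda>k. f k x) \<longlonglongrightarrow> lim (\<lambda>k. f k x)"
      then have "(\<lambda>j. ennreal ((norm (f j x - f k x))\<^sup>2)) \<longlonglongrightarrow> ennreal ((norm (F x - f k x))\<^sup>2)"
        unfolding F_def by (intro tendsto_intros)
      then show "ennreal ((norm (F x - f k x))\<^sup>2) = liminf (\<lambda>j. ennreal ((norm (f j x - f k x))\<^sup>2))"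
        by (intro lim_imp_Liminf[symmetric]) auto
    qed
    then have "(\<integral>\<^sup>+x. ennreal ((norm (F x - f k x))\<^sup>2) \<partial>torus)
        = (\<integral>\<^sup>+x. liminf (\<lambda>j. ennreal ((norm (f j x - f k x))\<^sup>2)) \<partial>torus)"
      by (rule nn_integral_cong_AE)
    also have "\<dots> \<le> liminf (\<lambda>j. \<integral>\<^sup>+x. ennreal ((norm (f j x - f k x))\<^sup>2) \<partial>torus)"
      by (rule nn_integral_liminf) measurable
    also have "\<dots> \<le> ennreal (((1/2) ^ k)\<^sup>2)"
    proof (rule Liminf_le)
      show "\<forall>\<^sub>F j in sequentially.
          (\<integral>\<^sup>+x. ennreal ((norm (f j x - f k x))\<^sup>2) \<partial>torus) \<le> ennreal (((1/2) ^ k)\<^sup>2)"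
        unfolding dist using X by (auto simp: eventually_sequentially intro!: exI[of _ k] ennreal_leI power_mono)
    qed simp
    finally show ?thesis .
  qed
  have dsq: "sq_integrable (\<lambda>x. F x - f k x)" for k
    unfolding sq_integrable_def
  proof
    show "integrable torus (\<lambda>x. (norm (F x - f k x))\<^sup>2)"
      using close[of k] by (intro integrableI_bounded) (auto intro: le_less_trans)
  qed measurable
  have Fsq: "sq_integrable F"
    using sq_integrable_add[OF dsq[of 0] fsq[of 0]] by simp
  have "norm (X k - abs_L2 F) \<le> (1/2) ^ k" for k
  proof (rule power2_le_imp_le)
    have "ennreal ((norm (abs_L2 F - X k))\<^sup>2) \<le> ennreal (((1/2) ^ k)\<^sup>2)"
      using close[of k] unfolding nn_integral_norm_abs_L2[OF dsq[of k]]
        abs_L2_diff[OF Fsq fsq[of k], symmetric] by (simp only: f_def abs_rep_L2)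
    then show "(norm (X k - abs_L2 F))\<^sup>2 \<le> ((1/2) ^ k)\<^sup>2"
      by (simp add: norm_minus_commute)
  qed simp
  then have "\<forall>\<^sub>F k in sequentially. norm (X k - abs_L2 F) \<le> (1/2) ^ k" by simp
  moreover have "(\<lambda>k. (1/2::real) ^ k) \<longlonglongrightarrow> 0" by (intro LIMSEQ_power_zero) simp
  ultimately have "(\<lambda>k. X k - abs_L2 F) \<longlonglongrightarrow> 0" by (rule Lim_null_comparison)
  then have "X \<longlonglongrightarrow> abs_L2 F" by (rule LIM_zero_cancel)
  then show ?thesis ..
qed

instance L2 :: (euclidean_space) banach
proof
  fix X :: "nat \<Rightarrow> 'a L2" assume C: "Cauchy X"
  have "\<exists>N. \<forall>m\<ge>N. \<forall>n\<ge>N. norm (X m - X n) < (1/2) ^ k" for k :: nat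
    using CauchyD[OF C, of "(1/2) ^ k"] by simp
  then obtain N where N: "\<And>k m n. m \<ge> N k \<Longrightarrow> n \<ge> N k \<Longrightarrow> norm (X m - X n) < (1/2) ^ k"
    by metis
  define r where "r k = Max (N ` {..k}) + k" for k
  have rN: "r j \<ge> N k" if "j \<ge> k" for j k
  proof -
    have "N k \<le> Max (N ` {..j})" using that by (intro Max_ge) auto
    then show ?thesis by (simp add: r_def)
  qed
  have "Max (N ` {..k}) \<le> Max (N ` {..Suc k})" for k
    by (intro Max_mono) auto
  then have mono: "strict_mono r"
    unfolding strict_mono_Suc_iff r_def by (intro allI add_le_less_mono lessI)
  have "norm ((X \<circ> r) j - (X \<circ> r) k) \<le> (1/2) ^ k" if "j \<ge> k" for j k
    using N[of k "r j" "r k"] rN that by (simp add: less_imp_le)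
  from L2_fast_Cauchy_convergent[OF this] obtain L where "(X \<circ> r) \<longlonglongrightarrow> L" by blast
  then have "X \<longlonglongrightarrow> L"
    using Met_TC.MCauchy_convergent_subsequence[of X r L] C mono by simp
  then show "convergent X"
    unfolding convergent_def by blast
qed

section \<open>Evolution operators of continuous coefficients\<close>

lemma sq_integrable_dominated:
  assumes "sq_integrable g" "f \<in> borel_measurable torus"
    and "\<And>x. x \<in> space torus \<Longrightarrow> norm (f x) \<le> C * norm (g x)"
  shows "sq_integrable f"
proof -
  have "(norm (f x))\<^sup>2 \<le> C\<^sup>2 * (norm (g x))\<^sup>2" if "x \<in> space torus" for x
    using power_mono[OF assms(3)[OF that], of 2] by (simp add: power_mult_distrib)
  moreover have "integrable torus (\<lambda>x. C\<^sup>2 * (norm (g x))\<^sup>2)"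
    using assms(1) by (simp add: sq_integrable_def)
  ultimately have "integrable torus (\<lambda>x. (norm (f x))\<^sup>2)"
    using assms(2) by (intro Bochner_Integration.integrable_bound[where g = "\<lambda>x. (norm (f x))\<^sup>2"
        and f = "\<lambda>x. C\<^sup>2 * (norm (g x))\<^sup>2"]) (auto intro!: AE_I2)
  then show ?thesis using assms(2) by (simp add: sq_integrable_def)
qed

lemma continuous_slice:
  assumes "continuous_on (I \<times> UNIV) (\<lambda>(t, x). f t x)" "t \<in> I"
  shows "continuous_on UNIV (f t)"
proof -
  have "continuous_on UNIV (\<lambda>x. (\<lambda>(t, x). f t x) (t, x))"
    by (rule continuous_on_compose2[OF assms(1)]) (intro continuous_intros, use assms in auto)
  then show ?thesis by simp
qed

text \<open>Uniform continuity on \<open>[0,T]\<close> times the closed cell. On a space of finite measure the supremum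
  distance of two slices controls their \<open>L\<^sup>2\<close> distance, so joint regularity in \<open>(t,x)\<close> becomes regularity
  of \<open>L\<^sup>2\<close>-valued curves.\<close>

lemma slices_equicontinuous:
  fixes f :: "real \<Rightarrow> plane \<Rightarrow> 'b::metric_space"
  assumes f: "continuous_on ({0..T} \<times> UNIV) (\<lambda>(t, x). f t x)" and t: "t \<in> {0..T}" and e: "e > 0"
  shows "\<exists>d>0. \<forall>s\<in>{0..T}. \<bar>s - t\<bar> < d \<longrightarrow> (\<forall>x\<in>cbox (0, 0) (2*pi, 2*pi). dist (f s x) (f t x) \<le> e)"
proof -
  have "uniformly_continuous_on ({0..T} \<times> cbox (0, 0) (2*pi, 2*pi)) (\<lambda>(t, x). f t x)"
    by (intro compact_uniformly_continuous continuous_on_subset[OF f] compact_Times compact_cell)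
      auto
  then obtain d where "d > 0" and d: "\<And>p q. p \<in> {0..T} \<times> cbox (0, 0) (2*pi, 2*pi) \<Longrightarrow>
      q \<in> {0..T} \<times> cbox (0, 0) (2*pi, 2*pi) \<Longrightarrow> dist q p < d \<Longrightarrow>
      dist ((\<lambda>(t, x). f t x) q) ((\<lambda>(t, x). f t x) p) < e"
    using e unfolding uniformly_continuous_on_def by metis
  have "dist (f s x) (f t x) \<le> e"
    if "s \<in> {0..T}" "\<bar>s - t\<bar> < d" "x \<in> cbox (0, 0) (2*pi, 2*pi)" for s x
    using d[of "(t, x)" "(s, x)"] that t by (auto simp: dist_Pair_Pair dist_real_def)
  with \<open>d > 0\<close> show ?thesis by blast
qed

lemma abs_L2_continuous_on:
  fixes f :: "real \<Rightarrow> plane \<Rightarrow> 'b::euclidean_space"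
  assumes f: "continuous_on ({0..T} \<times> UNIV) (\<lambda>(t, x). f t x)"
  shows "continuous_on {0..T} (\<lambda>t. abs_L2 (f t))"
  unfolding continuous_on_iff
proof (intro ballI allI impI)
  fix t and e :: real assume t: "t \<in> {0..T}" and e: "e > 0"
  define e' where "e' = e / (4 * pi)"
  have "e' > 0" using e by (simp add: e'_def)
  from slices_equicontinuous[OF f t this] obtain d where "d > 0"
    and d: "\<And>s x. s \<in> {0..T} \<Longrightarrow> \<bar>s - t\<bar> < d \<Longrightarrow> x \<in> cbox (0, 0) (2*pi, 2*pi) \<Longrightarrow>
      norm (f s x - f t x) \<le> e'" by (auto simp: dist_norm)
  have "dist (abs_L2 (f s)) (abs_L2 (f t)) < e" if s: "s \<in> {0..T}" "dist s t < d" for s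
  proof -
    have c: "continuous_on UNIV (f s)" "continuous_on UNIV (f t)"
      using continuous_slice[OF f] s t by auto
    have "norm (abs_L2 (\<lambda>x. f s x - f t x)) \<le> 2 * pi * e'"
    proof (rule norm_abs_L2_le_sup)
      show "(\<lambda>x. f s x - f t x) \<in> borel_measurable torus"
        by (intro borel_measurable_torus borel_measurable_continuous_onI continuous_intros c)
    qed (use d s \<open>e' > 0\<close> torus_subset_cell in \<open>auto simp: dist_real_def\<close>)
    then show ?thesis
      using c e by (simp add: dist_norm abs_L2_diff continuous_sq_integrable e'_def)
  qed
  then show "\<exists>d>0. \<forall>s\<in>{0..T}. dist s t < d \<longrightarrow> dist (abs_L2 (f s)) (abs_L2 (f t)) < e"
    using \<open>d > 0\<close> by blast
qed

text \<open>The mean value inequality on the segment from \<open>t\<close> to \<open>y\<close> makes the difference quotients converge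
  uniformly in \<open>x\<close>.\<close>

lemma abs_L2_has_vector_derivative:
  fixes f :: "real \<Rightarrow> plane \<Rightarrow> 'b::euclidean_space"
  assumes f: "continuous_on ({0..T} \<times> UNIV) (\<lambda>(t, x). f t x)"
    and f': "continuous_on ({0..T} \<times> UNIV) (\<lambda>(t, x). f' t x)"
    and der: "\<And>t x. t \<in> {0..T} \<Longrightarrow> ((\<lambda>t. f t x) has_vector_derivative f' t x) (at t within {0..T})"
    and t: "t \<in> {0..T}"
  shows "((\<lambda>t. abs_L2 (f t)) has_vector_derivative abs_L2 (f' t)) (at t within {0..T})"
  unfolding has_vector_derivative_def has_derivative_within_alt
proof (intro conjI allI impI bounded_linear_scaleR_left)
  fix e :: real assume e: "e > 0"
  define e' where "e' = e / (2 * pi)"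
  have "e' > 0" using e by (simp add: e'_def)
  from slices_equicontinuous[OF f' t this] obtain d where "d > 0"
    and d: "\<And>s x. s \<in> {0..T} \<Longrightarrow> \<bar>s - t\<bar> < d \<Longrightarrow> x \<in> cbox (0, 0) (2*pi, 2*pi) \<Longrightarrow>
      norm (f' s x - f' t x) \<le> e'" by (auto simp: dist_norm)
  have "norm (abs_L2 (f y) - abs_L2 (f t) - (y - t) *\<^sub>R abs_L2 (f' t)) \<le> e * norm (y - t)"
    if y: "y \<in> {0..T}" "norm (y - t) < d" for y
  proof -
    have c: "continuous_on UNIV (f y)" "continuous_on UNIV (f t)" "continuous_on UNIV (f' t)"
      using continuous_slice[OF f] continuous_slice[OF f'] y t by auto
    have "norm (f y x - f t x - (y - t) *\<^sub>R f' t x) \<le> norm (y - t) * e'"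
      if x: "x \<in> space torus" for x
    proof (rule vector_differentiable_bound_linearization)
      have sub: "closed_segment t y \<subseteq> {0..T}"
        using t y by (simp add: closed_segment_subset)
      show "closed_segment t y \<subseteq> closed_segment t y" by simp
      fix s assume s: "s \<in> closed_segment t y"
      show "((\<lambda>t. f t x) has_vector_derivative f' s x) (at s within closed_segment t y)"
        using has_vector_derivative_within_subset[OF der[of s x] sub] subsetD[OF sub s] by simp
      have "\<bar>s - t\<bar> < d"
        using dist_in_closed_segment[OF s] y(2) unfolding dist_real_def real_norm_def by linarith
      then show "norm (f' s x - f' t x) \<le> e'"
        using d s sub x torus_subset_cell by blast
    qed simp
    then have "norm (abs_L2 (\<lambda>x. f y x - f t x - (y - t) *\<^sub>R f' t x)) \<le> 2 * pi * (norm (y - t) * e')"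
      using \<open>e' > 0\<close>
      by (intro norm_abs_L2_le_sup borel_measurable_torus borel_measurable_continuous_onI
          continuous_intros c) auto
    moreover have "abs_L2 (f y) - abs_L2 (f t) - (y - t) *\<^sub>R abs_L2 (f' t)
        = abs_L2 (\<lambda>x. f y x - f t x - (y - t) *\<^sub>R f' t x)"
      using c by (simp add: abs_L2_diff abs_L2_scaleR continuous_sq_integrable continuous_intros)
    ultimately show ?thesis by (simp add: e'_def mult_ac)
  qed
  then show "\<exists>d>0. \<forall>y\<in>{0..T}. norm (y - t) < d \<longrightarrow>
      norm (abs_L2 (f y) - abs_L2 (f t) - (y - t) *\<^sub>R abs_L2 (f' t)) \<le> e * norm (y - t)"
    using \<open>d > 0\<close> by blast
qed

lemma norm_Rot [simp]: "norm (Rot z) = norm z"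
  by (simp add: Rot_def norm_prod_def add.commute)

lemma bounded_linear_Rot: "bounded_linear Rot"
  unfolding Rot_def by (intro bounded_linear_Pair bounded_linear_snd bounded_linear_minus bounded_linear_fst)

lemmas continuous_on_Rot [continuous_intros] = bounded_linear.continuous_on[OF bounded_linear_Rot]

lemma sq_integrable_source:
  assumes "continuous_on UNIV v" "sq_integrable b"
  shows "sq_integrable (\<lambda>x. (- \<sigma> * b x) *\<^sub>R Rot (v x))"
proof -
  obtain C where C: "C \<ge> 0" "\<And>x. x \<in> space torus \<Longrightarrow> norm (v x) \<le> C"
    using continuous_bounded_on_torus[OF assms(1)] by blast
  have [measurable]: "b \<in> borel_measurable torus" using assms(2) by (simp add: sq_integrable_def)
  have [measurable]: "(\<lambda>x. Rot (v x)) \<in> borel_measurable torus"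
    by (intro borel_measurable_torus borel_measurable_continuous_onI continuous_intros assms)
  show ?thesis
  proof (rule sq_integrable_dominated[OF assms(2)])
    fix x assume "x \<in> space torus"
    then show "norm ((- \<sigma> * b x) *\<^sub>R Rot (v x)) \<le> \<bar>\<sigma>\<bar> * C * norm (b x)"
      using C mult_left_mono[of "norm (v x)" C "\<bar>\<sigma>\<bar> * \<bar>b x\<bar>"] by (simp add: abs_mult mult_ac)
  qed measurable
qed

text \<open>The source is defined through a chosen representative of \<open>b\<close>; any other one may be used.\<close>

lemma ohm_source_abs:
  assumes v: "continuous_on UNIV v" and b: "sq_integrable b"
  shows "ohm_source \<sigma> v (E, abs_L2 b) = (abs_L2 (\<lambda>x. (- \<sigma> * b x) *\<^sub>R Rot (v x)), 0)"
proof -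
  have "abs_L2 (\<lambda>x. (- \<sigma> * rep_L2 (abs_L2 b) x) *\<^sub>R Rot (v x))
      = abs_L2 (\<lambda>x. (- \<sigma> * b x) *\<^sub>R Rot (v x))"
  proof (rule abs_L2_eqI[OF sq_integrable_source[OF v rep_L2_sq] sq_integrable_source[OF v b]])
    show "AE x in torus. (- \<sigma> * rep_L2 (abs_L2 b) x) *\<^sub>R Rot (v x) = (- \<sigma> * b x) *\<^sub>R Rot (v x)"
      by (rule AE_mp[OF rep_abs_L2_AE[OF b]]) simp
  qed
  then show ?thesis by (simp add: ohm_source_def)
qed

lemma norm_ohm_source_le:
  assumes v: "continuous_on UNIV v" and C: "C \<ge> 0" "\<And>x. x \<in> space torus \<Longrightarrow> norm (v x) \<le> C"
  shows "norm (ohm_source \<sigma> v X) \<le> \<bar>\<sigma>\<bar> * C * norm X"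
proof -
  let ?b = "rep_L2 (snd X)"
  have "norm (abs_L2 (\<lambda>x. (- \<sigma> * ?b x) *\<^sub>R Rot (v x))) \<le> (\<bar>\<sigma>\<bar> * C) * norm (abs_L2 ?b)"
  proof (rule norm_abs_L2_le_mono[OF sq_integrable_source[OF v rep_L2_sq] rep_L2_sq])
    fix x assume "x \<in> space torus"
    then show "norm ((- \<sigma> * ?b x) *\<^sub>R Rot (v x)) \<le> \<bar>\<sigma>\<bar> * C * norm (?b x)"
      using C mult_left_mono[of "norm (v x)" C "\<bar>\<sigma>\<bar> * \<bar>?b x\<bar>"] by (simp add: abs_mult mult_ac)
  qed (use C in auto)
  also have "norm (abs_L2 ?b) \<le> norm X" using norm_snd_le[of "snd X" "fst X"] by simp
  finally show ?thesis using C by (simp add: ohm_source_def mult_left_mono)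
qed

lemma bounded_linear_ohm_source:
  assumes v: "continuous_on UNIV v"
  shows "bounded_linear (ohm_source \<sigma> v)"
proof -
  obtain C where C: "C \<ge> 0" "\<And>x. x \<in> space torus \<Longrightarrow> norm (v x) \<le> C"
    using continuous_bounded_on_torus[OF v] by blast
  show ?thesis
  proof (rule bounded_linear_intro)
    fix X Y :: state and c :: real
    show "norm (ohm_source \<sigma> v X) \<le> norm X * (\<bar>\<sigma>\<bar> * C)"
      using norm_ohm_source_le[OF v C] by (simp add: mult.commute)
    note s = sq_integrable_source[OF v rep_L2_sq]
    have "X + Y = (fst (X + Y), abs_L2 (\<lambda>x. rep_L2 (snd X) x + rep_L2 (snd Y) x))"
      by (simp add: prod_eq_iff flip: abs_L2_add[OF rep_L2_sq rep_L2_sq])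
    then have "ohm_source \<sigma> v (X + Y)
        = (abs_L2 (\<lambda>x. (- \<sigma> * (rep_L2 (snd X) x + rep_L2 (snd Y) x)) *\<^sub>R Rot (v x)), 0)"
      by (rule ssubst) (rule ohm_source_abs[OF v sq_integrable_add[OF rep_L2_sq rep_L2_sq]])
    then show "ohm_source \<sigma> v (X + Y) = ohm_source \<sigma> v X + ohm_source \<sigma> v Y"
      unfolding \<open>ohm_source \<sigma> v (X + Y) = _\<close>
      by (simp only: ohm_source_def add_Pair abs_L2_add[OF s s] distrib_left scaleR_left_distrib
          add_0_left)
    have "c *\<^sub>R X = (fst (c *\<^sub>R X), abs_L2 (\<lambda>x. c *\<^sub>R rep_L2 (snd X) x))"
      using abs_L2_scaleR[OF rep_L2_sq, of c "snd X"] by (simp add: prod_eq_iff)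
    then have "ohm_source \<sigma> v (c *\<^sub>R X)
        = (abs_L2 (\<lambda>x. (- \<sigma> * (c *\<^sub>R rep_L2 (snd X) x)) *\<^sub>R Rot (v x)), 0)"
      by (rule ssubst) (rule ohm_source_abs[OF v sq_integrable_scaleR[OF rep_L2_sq]])
    then show "ohm_source \<sigma> v (c *\<^sub>R X) = c *\<^sub>R ohm_source \<sigma> v X"
      unfolding \<open>ohm_source \<sigma> v (c *\<^sub>R X) = _\<close>
      by (simp only: ohm_source_def scaleR_Pair abs_L2_scaleR[OF s] scaleR_zero_right scaleR_scaleR
          real_scaleR_def mult_ac)
  qed
qed

lemma ohm_source_diff:
  assumes v: "continuous_on UNIV v" and w: "continuous_on UNIV w"
  shows "ohm_source \<sigma> v X - ohm_source \<sigma> w X = ohm_source \<sigma> (\<lambda>x. v x - w x) X"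
  using abs_L2_diff[OF sq_integrable_source[OF v rep_L2_sq] sq_integrable_source[OF w rep_L2_sq],
      of \<sigma> "snd X" \<sigma> "snd X"]
  by (simp add: ohm_source_def bounded_linear.linear[OF bounded_linear_Rot] linear_diff
      scaleR_diff_right)

definition ohm_op :: "real \<Rightarrow> (plane \<Rightarrow> plane) \<Rightarrow> state \<Rightarrow>\<^sub>L state" where
  "ohm_op \<sigma> v = Blinfun (ohm_source \<sigma> v)"

lemma ohm_op_apply: "continuous_on UNIV v \<Longrightarrow> ohm_op \<sigma> v X = ohm_source \<sigma> v X"
  unfolding ohm_op_def by (simp add: bounded_linear_Blinfun_apply bounded_linear_ohm_source)

lemma continuous_on_ohm_op:
  fixes T :: real
  assumes v: "continuous_on ({0..T} \<times> UNIV) (\<lambda>(t, x). v t x)"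
  shows "continuous_on {0..T} (\<lambda>t. ohm_op \<sigma> (v t))"
  unfolding continuous_on_iff
proof (intro ballI allI impI)
  fix t and e :: real assume t: "t \<in> {0..T}" and e: "e > 0"
  define a where "a = \<bar>\<sigma>\<bar> + 1"
  have a: "a > 0" "\<bar>\<sigma>\<bar> \<le> a" by (auto simp: a_def)
  define e' where "e' = e / (2 * a)"
  have e': "e' > 0" using e a by (simp add: e'_def)
  from slices_equicontinuous[OF v t this] obtain d where "d > 0"
    and d: "\<And>s x. s \<in> {0..T} \<Longrightarrow> \<bar>s - t\<bar> < d \<Longrightarrow> x \<in> cbox (0, 0) (2*pi, 2*pi) \<Longrightarrow>
      norm (v s x - v t x) \<le> e'" by (auto simp: dist_norm)
  have "dist (ohm_op \<sigma> (v s)) (ohm_op \<sigma> (v t)) < e" if s: "s \<in> {0..T}" "dist s t < d" for s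
  proof -
    have c: "continuous_on UNIV (v s)" "continuous_on UNIV (v t)"
      using continuous_slice[OF v] s t by auto
    have "norm (ohm_op \<sigma> (v s) - ohm_op \<sigma> (v t)) \<le> \<bar>\<sigma>\<bar> * e'"
    proof (rule norm_blinfun_bound)
      fix X
      have "norm (ohm_source \<sigma> (\<lambda>x. v s x - v t x) X) \<le> \<bar>\<sigma>\<bar> * e' * norm X"
        using d s e' torus_subset_cell
        by (intro norm_ohm_source_le continuous_intros c) (auto simp: dist_real_def)
      then show "norm ((ohm_op \<sigma> (v s) - ohm_op \<sigma> (v t)) X) \<le> \<bar>\<sigma>\<bar> * e' * norm X"
        by (simp add: blinfun.diff_left ohm_op_apply c ohm_source_diff)
    qed (use e' in simp)
    also have "\<bar>\<sigma>\<bar> * e' \<le> a * e'" using e' a by (intro mult_right_mono) auto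
    also have "\<dots> = e / 2" using a by (simp add: e'_def)
    finally show ?thesis using e by (simp add: dist_norm)
  qed
  then show "\<exists>d>0. \<forall>s\<in>{0..T}. dist s t < d \<longrightarrow> dist (ohm_op \<sigma> (v s)) (ohm_op \<sigma> (v t)) < e"
    using \<open>d > 0\<close> by blast
qed

lemma ohm_op_bounded:
  fixes T :: real
  assumes v: "continuous_on ({0..T} \<times> UNIV) (\<lambda>(t, x). v t x)"
  obtains M where "M > 0" "\<And>t. t \<in> {0..T} \<Longrightarrow> norm (ohm_op \<sigma> (v t)) \<le> M"
proof -
  have "bounded ((\<lambda>t. ohm_op \<sigma> (v t)) ` {0..T})"
    using continuous_on_ohm_op[OF v] by (intro compact_imp_bounded compact_continuous_image) auto
  then obtain M where "\<And>t. t \<in> {0..T} \<Longrightarrow> norm (ohm_op \<sigma> (v t)) \<le> M"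
    unfolding bounded_iff by blast
  then show ?thesis by (intro that[of "max M 1"]) fastforce+
qed

lemma mild_solution_iff_volterra:
  fixes T :: real
  assumes S: "contraction_semigroup S" and v: "continuous_on ({0..T} \<times> UNIV) (\<lambda>(t, x). v t x)"
  shows "mild_solution \<sigma> S T v X0 X \<longleftrightarrow> volterra_solution S (\<lambda>s. ohm_op \<sigma> (v s)) T X0 X"
proof -
  let ?f = "\<lambda>s. ohm_op \<sigma> (v s) (X s)"
  have "((\<lambda>s. S (t - s) (ohm_source \<sigma> (v s) (X s))) has_integral (X t - S t X0)) {0..t}
      \<longleftrightarrow> X t = S t X0 + duhamel S ?f t" if X: "continuous_on {0..T} X" and t: "t \<in> {0..T}" for t
  proof -
    have "continuous_on {0..T} ?f"
      by (intro continuous_intros continuous_on_ohm_op v X)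
    from duhamel_has_integral[OF S this t]
    have "((\<lambda>s. S (t - s) (ohm_source \<sigma> (v s) (X s))) has_integral duhamel S ?f t) {0..t}"
      by (rule has_integral_eq[rotated])
        (use t in \<open>auto simp: ohm_op_apply[OF continuous_slice[OF v]]\<close>)
    note D = this
    show ?thesis
    proof
      assume "((\<lambda>s. S (t - s) (ohm_source \<sigma> (v s) (X s))) has_integral (X t - S t X0)) {0..t}"
      then have "X t - S t X0 = duhamel S ?f t" using D by (rule has_integral_unique)
      then show "X t = S t X0 + duhamel S ?f t" by (simp add: algebra_simps)
    qed (use D in simp)
  qed
  then show ?thesis by (auto simp: mild_solution_def volterra_solution_def)
qed

lemma evolution_apply:
  fixes T :: real
  assumes S: "contraction_semigroup S" and T: "T \<ge> 0"
    and v: "continuous_on ({0..T} \<times> UNIV) (\<lambda>(t, x). v t x)"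
  shows "evolution \<sigma> S T v X0 = volterra_end S (\<lambda>s. ohm_op \<sigma> (v s)) T X0"
proof -
  obtain M where "M > 0" "\<And>t. t \<in> {0..T} \<Longrightarrow> norm (ohm_op \<sigma> (v t)) \<le> M"
    using ohm_op_bounded[OF v] by blast
  from bounded_linear_volterra_end[OF S continuous_on_ohm_op[OF v] this T]
  show ?thesis
    unfolding evolution_def mild_solution_iff_volterra[OF S v]
    by (subst bounded_linear_Blinfun_apply) (auto simp: volterra_end_def[abs_def])
qed

text \<open>The constant \<open>K\<close> depends on the coefficient alone. The approximate solution may therefore be chosen
  after \<open>K\<close> is known.\<close>

lemma evolution_close_to_approximation:
  fixes T :: real
  assumes S: "contraction_semigroup S" and gen: "generated_by S (maxwell_ohm \<sigma>)" and T: "T \<ge> 0"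
    and v: "continuous_on ({0..T} \<times> UNIV) (\<lambda>(t, x). v t x)"
  obtains K where "K \<ge> 0"
    "\<And>Y Y' r \<rho>. \<lbrakk>\<And>s. s \<in> {0..T} \<Longrightarrow> (Y has_vector_derivative Y' s) (at s within {0..T});
      \<And>s. s \<in> {0..T} \<Longrightarrow> maxwell_ohm \<sigma> (Y s) (Y' s - (ohm_source \<sigma> (v s) (Y s) + r s));
      continuous_on {0..T} r; \<And>s. s \<in> {0..T} \<Longrightarrow> norm (r s) \<le> \<rho>\<rbrakk>
      \<Longrightarrow> norm (evolution \<sigma> S T v (Y 0) - Y T) \<le> K * \<rho>"
proof -
  let ?B = "\<lambda>s. ohm_op \<sigma> (v s)"
  obtain M where M: "M > 0" "\<And>t. t \<in> {0..T} \<Longrightarrow> norm (?B t) \<le> M"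
    using ohm_op_bounded[OF v] by blast
  show ?thesis
  proof (rule that[of "2 * T * exp (2 * M * T)"])
    show "0 \<le> 2 * T * exp (2 * M * T)" using T by simp
    fix Y Y' r \<rho>
    assume der: "\<And>s. s \<in> {0..T} \<Longrightarrow> (Y has_vector_derivative Y' s) (at s within {0..T})"
      and dom: "\<And>s. s \<in> {0..T} \<Longrightarrow> maxwell_ohm \<sigma> (Y s) (Y' s - (ohm_source \<sigma> (v s) (Y s) + r s))"
      and r: "continuous_on {0..T} r" "\<And>s. s \<in> {0..T} \<Longrightarrow> norm (r s) \<le> \<rho>"
    have Yc: "continuous_on {0..T} Y"
      unfolding continuous_on_eq_continuous_within
      using has_vector_derivative_continuous[OF der] by blast
    have "Y t = S t (Y 0) + duhamel S (\<lambda>s. ?B s (Y s) + r s) t" if t: "t \<in> {0..T}" for t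
    proof (rule classical_solution_duhamel[OF S gen der _ t])
      show "maxwell_ohm \<sigma> (Y s) (Y' s - (?B s (Y s) + r s))" if "s \<in> {0..T}" for s
        using dom[OF that] by (simp add: ohm_op_apply[OF continuous_slice[OF v that]])
    qed
    then have "norm (volterra_end S ?B T (Y 0) - Y T) \<le> 2 * T * \<rho> * exp (2 * M * T)"
      using volterra_end_close[OF S continuous_on_ohm_op[OF v] M T Yc r] by blast
    then show "norm (evolution \<sigma> S T v (Y 0) - Y T) \<le> 2 * T * exp (2 * M * T) * \<rho>"
      by (simp add: evolution_apply[OF S T v] mult_ac)
  qed
qed

lemma evolution_zero:
  assumes S: "contraction_semigroup S" and T: "T \<ge> 0"
  shows "evolution \<sigma> S T (\<lambda>t x. 0) X = S T X"
proof -
  have v: "continuous_on ({0..T} \<times> UNIV) (\<lambda>(t, x). (\<lambda>t x. 0 :: plane) t (x :: plane))"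
    by (rule continuous_on_eq[OF continuous_on_const[of _ 0]]) auto
  obtain M where M: "M > 0" "\<And>t. t \<in> {0..T} \<Longrightarrow> norm (ohm_op \<sigma> (\<lambda>x. 0)) \<le> M"
    using ohm_op_bounded[OF v] by blast
  have 0: "ohm_op \<sigma> (\<lambda>x. 0) Y = 0" for Y
  proof -
    have "Rot 0 = 0" by (simp add: Rot_def zero_prod_def)
    then show ?thesis
      unfolding ohm_op_apply[OF continuous_on_const] ohm_source_def
      by (simp only: scaleR_zero_right abs_L2_zero) (rule zero_prod_def[symmetric])
  qed
  have "continuous_on {0..T} (\<lambda>t. S t X)"
    by (rule semigroup_continuous_on[OF S]) (auto intro: continuous_intros)
  then have "volterra_solution S (\<lambda>s. ohm_op \<sigma> (\<lambda>x. 0)) T X (\<lambda>t. S t X)"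
    unfolding volterra_solution_def duhamel_def 0 blinfun.zero_right integral_0 by simp
  then have "volterra_end S (\<lambda>s. ohm_op \<sigma> (\<lambda>x. 0)) T X = S T X"
    using volterra_end_eq[OF S continuous_on_const M T] by simp
  then show ?thesis
    unfolding evolution_apply[OF S T v] .
qed

section \<open>Calculus of \<open>C\<^sup>k\<close> functions\<close>

lemma Ck_on_SucI:
  assumes "\<And>x. x \<in> S \<Longrightarrow> (f has_derivative f' x) (at x within S)" "\<And>v. Ck_on k S (\<lambda>x. f' x v)"
  shows "Ck_on (Suc k) S f"
  unfolding Ck_on.simps using assms by (intro exI[of _ f']) simp

lemma Ck_on_subset: "Ck_on k S f \<Longrightarrow> S' \<subseteq> S \<Longrightarrow> Ck_on k S' f"
proof (induction k arbitrary: f)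
  case (Suc k)
  from Suc.prems(1) obtain f' where F: "\<forall>x\<in>S. (f has_derivative f' x) (at x within S)"
    "\<forall>v. Ck_on k S (\<lambda>x. f' x v)" unfolding Ck_on.simps(2) by blast
  note f' = F(1)[rule_format] F(2)[rule_format]
  show ?case
  proof (rule Ck_on_SucI)
    show "(f has_derivative f' x) (at x within S')" if "x \<in> S'" for x
      using has_derivative_subset[OF f'(1) Suc.prems(2)] that Suc.prems(2) by auto
  qed (rule Suc.IH[OF f'(2) Suc.prems(2)])
qed (auto elim: continuous_on_subset)

lemma Ck_on_cong:
  assumes f: "Ck_on k S f" and eq: "\<And>x. x \<in> S \<Longrightarrow> g x = f x"
  shows "Ck_on k S g"
proof (cases k)
  case 0
  with f eq show ?thesis by (simp cong: continuous_on_cong)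
next
  case (Suc j)
  from f obtain f' where F: "\<forall>x\<in>S. (f has_derivative f' x) (at x within S)"
    "\<forall>v. Ck_on j S (\<lambda>x. f' x v)" unfolding Suc Ck_on.simps(2) by blast
  note f' = F(1)[rule_format] F(2)[rule_format]
  show ?thesis unfolding Suc
    by (rule Ck_on_SucI[OF has_derivative_transform[OF _ eq f'(1)] f'(2)])
qed

lemma Ck_on_imp_continuous_on: "Ck_on k S f \<Longrightarrow> continuous_on S f"
proof (cases k)
  case (Suc j)
  assume "Ck_on k S f"
  then obtain f' where "\<forall>x\<in>S. (f has_derivative f' x) (at x within S)"
    unfolding Suc Ck_on.simps(2) by blast
  from has_derivative_continuous[OF this[rule_format]] show ?thesis
    unfolding continuous_on_eq_continuous_within by blast
qed simp

lemma Ck_on_SucD: "Ck_on (Suc k) S f \<Longrightarrow> Ck_on k S f"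
proof (induction k arbitrary: f)
  case 0
  then show ?case using Ck_on_imp_continuous_on[of "Suc 0" S f] by simp
next
  case (Suc k)
  from Suc.prems obtain f' where F: "\<forall>x\<in>S. (f has_derivative f' x) (at x within S)"
    "\<forall>v. Ck_on (Suc k) S (\<lambda>x. f' x v)" unfolding Ck_on.simps(2) by blast
  note f' = F(1)[rule_format] F(2)[rule_format]
  show ?case by (rule Ck_on_SucI[OF f'(1) Suc.IH[OF f'(2)]])
qed

lemma Ck_on_const [intro, simp]: "Ck_on k S (\<lambda>x. c)"
proof (induction k arbitrary: c)
  case (Suc k)
  have "\<forall>x\<in>S. ((\<lambda>x. c) has_derivative (\<lambda>v. 0)) (at x within S)" by simp
  with Suc show ?case unfolding Ck_on.simps by (intro exI[of _ "\<lambda>x v. 0"]) auto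
qed simp

lemma Ck_on_bounded_linear: "bounded_linear f \<Longrightarrow> Ck_on k S f"
  by (cases k) (auto simp: bounded_linear.continuous_on intro!: exI[of _ "\<lambda>x. f"]
      bounded_linear_imp_has_derivative linear_continuous_on)

lemma Ck_on_add: "Ck_on k S f \<Longrightarrow> Ck_on k S g \<Longrightarrow> Ck_on k S (\<lambda>x. f x + g x)"
proof (induction k arbitrary: f g)
  case (Suc k)
  from Suc.prems obtain f' g' where
    "\<forall>x\<in>S. (f has_derivative f' x) (at x within S)" "\<forall>v. Ck_on k S (\<lambda>x. f' x v)"
    "\<forall>x\<in>S. (g has_derivative g' x) (at x within S)" "\<forall>v. Ck_on k S (\<lambda>x. g' x v)"
    by auto
  with Suc.IH show ?case unfolding Ck_on.simps
    by (intro exI[of _ "\<lambda>x v. f' x v + g' x v"]) (auto intro!: has_derivative_add)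
qed (auto intro: continuous_on_add)

lemma Ck_on_mult:
  fixes f g :: "'a::real_normed_vector \<Rightarrow> real"
  shows "Ck_on k S f \<Longrightarrow> Ck_on k S g \<Longrightarrow> Ck_on k S (\<lambda>x. f x * g x)"
proof (induction k arbitrary: f g)
  case (Suc k)
  from Suc.prems obtain f' g' where F: "\<forall>x\<in>S. (f has_derivative f' x) (at x within S)"
      "\<forall>v. Ck_on k S (\<lambda>x. f' x v)"
    and G: "\<forall>x\<in>S. (g has_derivative g' x) (at x within S)" "\<forall>v. Ck_on k S (\<lambda>x. g' x v)"
    unfolding Ck_on.simps(2) by blast
  note f' = F[rule_format] and g' = G[rule_format]
  show ?case
  proof (rule Ck_on_SucI)
    show "((\<lambda>x. f x * g x) has_derivative (\<lambda>v. f x * g' x v + f' x v * g x)) (at x within S)"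
      if "x \<in> S" for x
      by (rule has_derivative_mult[OF f'(1)[OF that] g'(1)[OF that]])
    show "Ck_on k S (\<lambda>x. f x * g' x v + f' x v * g x)" for v
      by (rule Ck_on_add[OF Suc.IH[OF Ck_on_SucD[OF Suc.prems(1)] g'(2)]
          Suc.IH[OF f'(2) Ck_on_SucD[OF Suc.prems(2)]]])
  qed
qed (auto intro: continuous_on_mult)

lemma Ck_on_Pair: "Ck_on k S f \<Longrightarrow> Ck_on k S g \<Longrightarrow> Ck_on k S (\<lambda>x. (f x, g x))"
proof (induction k arbitrary: f g)
  case (Suc k)
  from Suc.prems obtain f' g' where F: "\<forall>x\<in>S. (f has_derivative f' x) (at x within S)"
      "\<forall>v. Ck_on k S (\<lambda>x. f' x v)"
    and G: "\<forall>x\<in>S. (g has_derivative g' x) (at x within S)" "\<forall>v. Ck_on k S (\<lambda>x. g' x v)"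
    unfolding Ck_on.simps(2) by blast
  note f' = F[rule_format] and g' = G[rule_format]
  show ?case
    by (rule Ck_on_SucI[OF has_derivative_Pair[OF f'(1) g'(1)] Suc.IH[OF f'(2) g'(2)]])
qed (auto intro: continuous_on_Pair)

lemma Ck_on_compose:
  fixes \<phi> :: "real \<Rightarrow> real"
  shows "Ck_on k A \<phi> \<Longrightarrow> Ck_on k S g \<Longrightarrow> (\<And>x. x \<in> S \<Longrightarrow> g x \<in> A) \<Longrightarrow> Ck_on k S (\<lambda>x. \<phi> (g x))"
proof (induction k arbitrary: \<phi> g)
  case 0
  then show ?case using continuous_on_compose2[of A \<phi> S g] by auto
next
  case (Suc k)
  from Suc.prems obtain \<phi>' g' where F: "\<forall>x\<in>A. (\<phi> has_derivative \<phi>' x) (at x within A)"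
      "\<forall>v. Ck_on k A (\<lambda>x. \<phi>' x v)"
    and G: "\<forall>x\<in>S. (g has_derivative g' x) (at x within S)" "\<forall>v. Ck_on k S (\<lambda>x. g' x v)"
    unfolding Ck_on.simps(2) by blast
  note \<phi>' = F[rule_format] and g' = G[rule_format]
  have "Ck_on k S (\<lambda>x. \<phi>' (g x) 1 * g' x v)" for v
    by (rule Ck_on_mult[OF Suc.IH[OF \<phi>'(2) Ck_on_SucD[OF Suc.prems(2)] Suc.prems(3)] g'(2)])
  moreover have "((\<lambda>x. \<phi> (g x)) has_derivative (\<lambda>v. \<phi>' (g x) 1 * g' x v)) (at x within S)"
    if x: "x \<in> S" for x
  proof -
    have "g ` S \<subseteq> A" using Suc.prems(3) by auto
    from has_derivative_subset[OF \<phi>'(1)[OF Suc.prems(3)[OF x]] this]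
    have "((\<lambda>x. \<phi> (g x)) has_derivative (\<lambda>v. \<phi>' (g x) (g' x v))) (at x within S)"
      by (rule has_derivative_in_compose[OF g'(1)[OF x]])
  moreover have "linear (\<phi>' (g x))"
      by (rule has_derivative_linear[OF \<phi>'(1)[OF Suc.prems(3)[OF x]]])
    then have "\<phi>' (g x) (g' x v) = \<phi>' (g x) 1 * g' x v" for v
      using linear_scale[of "\<phi>' (g x)" "g' x v" 1] by (simp add: mult.commute)
    ultimately show ?thesis by (simp only:)
  qed
  ultimately show ?case by (intro Ck_on_SucI)
qed

lemma Ck_on_cmult:
  fixes f :: "'a::real_normed_vector \<Rightarrow> real"
  shows "Ck_on k S f \<Longrightarrow> Ck_on k S (\<lambda>x. c * f x)"
  by (intro Ck_on_mult Ck_on_const)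

lemma Ck_on_diff:
  fixes f g :: "'a::real_normed_vector \<Rightarrow> real"
  shows "Ck_on k S f \<Longrightarrow> Ck_on k S g \<Longrightarrow> Ck_on k S (\<lambda>x. f x - g x)"
  using Ck_on_add[of k S f "\<lambda>x. - 1 * g x"] Ck_on_cmult[of k S g "- 1"] by simp

lemma Ck_on_inverse_real: "Ck_on k (- {0}) (inverse :: real \<Rightarrow> real)"
proof (induction k)
  case 0
  then show ?case by (auto intro!: continuous_intros)
next
  case (Suc k)
  have "Ck_on k (- {0}) (\<lambda>x. - (inverse x * v * inverse x :: real))" for v
    using Ck_on_mult[OF Suc Suc] Ck_on_cmult[of k "- {0}" "\<lambda>x. inverse x * inverse x" "- v"]
    by (simp add: mult_ac)
  then show ?case unfolding Ck_on.simps
    by (intro exI[of _ "\<lambda>x v. - (inverse x * v * inverse x)"]) (auto intro!: has_derivative_inverse')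
qed

lemma Ck_on_inverse:
  fixes f :: "'a::real_normed_vector \<Rightarrow> real"
  assumes "Ck_on k S f" "\<And>x. x \<in> S \<Longrightarrow> f x \<noteq> 0"
  shows "Ck_on k S (\<lambda>x. inverse (f x))"
  using Ck_on_compose[OF Ck_on_inverse_real assms(1)] assms(2) by auto

lemma Ck_on_ln_real: "Ck_on k {0<..} (ln :: real \<Rightarrow> real)"
proof (cases k)
  case 0
  then show ?thesis by (auto intro!: continuous_intros)
next
  case (Suc j)
  have "Ck_on j {0<..} (\<lambda>x. inverse x * v :: real)" for v
    using Ck_on_subset[OF Ck_on_inverse_real, of "{0<..}" j] by (intro Ck_on_mult Ck_on_const) auto
  moreover have "(ln has_derivative (\<lambda>v. inverse x * v)) (at x within {0<..})" if "x > 0" for x :: real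
    using DERIV_ln[OF that] by (auto simp: has_field_derivative_def intro: has_derivative_at_withinI)
  ultimately show ?thesis unfolding Suc Ck_on.simps
    by (intro exI[of _ "\<lambda>x v. inverse x * v"]) auto
qed

lemma Ck_on_ln:
  fixes f :: "'a::real_normed_vector \<Rightarrow> real"
  assumes "Ck_on k S f" "\<And>x. x \<in> S \<Longrightarrow> f x > 0"
  shows "Ck_on k S (\<lambda>x. ln (f x))"
  using Ck_on_compose[OF Ck_on_ln_real assms(1)] assms(2) by auto

lemma smooth_on_has_deriv:
  fixes f :: "real \<Rightarrow> real"
  assumes "smooth_on UNIV f"
  shows "(f has_real_derivative deriv f x) (at x)"
proof -
  have "Ck_on (Suc 0) UNIV f" using assms unfolding smooth_on_def by blast
  then have "f differentiable (at x)" by (auto simp: differentiable_def)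
  then show ?thesis
    using DERIV_deriv_iff_real_differentiable by blast
qed

lemma smooth_on_deriv:
  fixes f :: "real \<Rightarrow> real"
  assumes "smooth_on UNIV f"
  shows "smooth_on UNIV (deriv f)"
  unfolding smooth_on_def
proof
  fix k
  have "Ck_on (Suc k) UNIV f" using assms unfolding smooth_on_def by blast
  then obtain f' where f': "\<And>x. (f has_derivative f' x) (at x)" "\<And>v. Ck_on k UNIV (\<lambda>x. f' x v)"
    by auto
  have "deriv f x = f' x 1" for x
  proof -
    have "(f has_derivative (*) (deriv f x)) (at x)"
      using smooth_on_has_deriv[OF assms] by (simp add: has_field_derivative_def)
    from has_derivative_unique[OF this f'(1)] show ?thesis by (metis mult.right_neutral)
  qed
  with f'(2)[of 1] show "Ck_on k UNIV (deriv f)" by presburger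
qed

text \<open>Near each point the derivative whose existence is assumed is the Frechet derivative, because the
  neighbourhood is open. The local derivatives thus are restrictions of one global function.\<close>

lemma Ck_on_local:
  assumes "\<And>x. x \<in> S \<Longrightarrow> \<exists>U. open U \<and> x \<in> U \<and> Ck_on k U f"
  shows "Ck_on k S f"
  using assms
proof (induction k arbitrary: f)
  case 0
  have "continuous (at x within S) f" if x: "x \<in> S" for x
  proof -
    obtain U where "open U" "x \<in> U" "continuous_on U f" using 0[OF x] by auto
    then have "continuous (at x) f" by (simp add: continuous_on_eq_continuous_at)
    then show ?thesis by (rule continuous_at_imp_continuous_at_within)
  qed
  then show ?case by (simp add: continuous_on_eq_continuous_within)
next
  case (Suc k)
  have loc: "\<exists>U. open U \<and> x \<in> U \<and> (\<forall>y\<in>U. (f has_derivative frechet_derivative f (at y)) (at y))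
      \<and> (\<forall>v. Ck_on k U (\<lambda>y. frechet_derivative f (at y) v))" if x: "x \<in> S" for x
  proof -
    obtain U where U: "open U" "x \<in> U" "Ck_on (Suc k) U f" using Suc.prems[OF x] by auto
    then obtain f' where F: "\<forall>y\<in>U. (f has_derivative f' y) (at y within U)"
      "\<forall>v. Ck_on k U (\<lambda>y. f' y v)" unfolding Ck_on.simps(2) by blast
    have at: "(f has_derivative f' y) (at y)" if "y \<in> U" for y
      using F(1)[rule_format, OF that] by (simp add: at_within_open[OF that U(1)])
    have fr: "frechet_derivative f (at y) = f' y" if "y \<in> U" for y
      using frechet_derivative_at[OF at[OF that]] by simp
    show ?thesis
    proof (intro exI[of _ U] conjI ballI allI U)
      fix y assume y: "y \<in> U"
      show "(f has_derivative frechet_derivative f (at y)) (at y)"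
        unfolding fr[OF y] by (rule at[OF y])
    next
      fix v
      show "Ck_on k U (\<lambda>y. frechet_derivative f (at y) v)"
        by (rule Ck_on_cong[OF F(2)[rule_format]]) (simp add: fr)
    qed
  qed
  show ?case
  proof (rule Ck_on_SucI)
    show "(f has_derivative frechet_derivative f (at x)) (at x within S)" if "x \<in> S" for x
      using loc[OF that] by (auto intro: has_derivative_at_withinI)
    show "Ck_on k S (\<lambda>y. frechet_derivative f (at y) v)" for v
      using loc by (intro Suc.IH) blast
  qed
qed

section \<open>The vortex in explicit form\<close>

lemma norm_plane_sq: "(norm (p :: plane))\<^sup>2 = (fst p)\<^sup>2 + (snd p)\<^sup>2"
  by (simp add: norm_prod_def)

lemma cutoff_profile_bounds:
  assumes "cutoff_profile \<Theta>"
  obtains C where "C \<ge> 1" "\<And>z. \<bar>deriv \<Theta> z\<bar> \<le> C" "\<And>z. \<bar>deriv (deriv \<Theta>) z\<bar> \<le> C"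
    "\<forall>z\<in>{0..1}. \<Theta> z \<le> C * z"
proof -
  obtain C where C: "\<forall>z. \<bar>deriv \<Theta> z\<bar> + \<bar>deriv (deriv \<Theta>) z\<bar> \<le> C" "\<forall>z\<in>{0..1}. \<Theta> z \<le> C * z"
    and one: "\<forall>z\<ge>1. \<Theta> z = 1"
    using assms unfolding cutoff_profile_def by blast
  show ?thesis
  proof (rule that[of C])
    show "C \<ge> 1" using C(2)[rule_format, of 1] one by simp
    show "\<bar>deriv \<Theta> z\<bar> \<le> C" "\<bar>deriv (deriv \<Theta>) z\<bar> \<le> C" for z
      using C(1)[rule_format, of z] by linarith+
  qed (rule C(2))
qed

context
  fixes r\<^sub>0 :: real and \<Theta> :: "real \<Rightarrow> real"
  assumes r0: "r\<^sub>0 > 0" and \<Theta>: "cutoff_profile \<Theta>"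
begin

lemma \<Theta>_smooth: "smooth_on UNIV \<Theta>" "smooth_on UNIV (deriv \<Theta>)"
  using \<Theta> smooth_on_deriv by (auto simp: cutoff_profile_def)

lemma \<Theta>_le_0: "z \<le> 0 \<Longrightarrow> \<Theta> z = 0" and \<Theta>_ge_1: "z \<ge> 1 \<Longrightarrow> \<Theta> z = 1"
  and \<Theta>_range: "0 \<le> \<Theta> z" "\<Theta> z \<le> 1"
  using \<Theta> by (auto simp: cutoff_profile_def)

lemma log_radius_ge_1_iff:
  assumes "L > 0" "r > 0"
  shows "(ln r\<^sub>0 - ln r) / L \<ge> 1 \<longleftrightarrow> r \<le> r\<^sub>0 * exp (- L)"
proof -
  have "(ln r\<^sub>0 - ln r) / L \<ge> 1 \<longleftrightarrow> ln r \<le> ln (r\<^sub>0 * exp (- L))"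
    using assms r0 by (simp add: ln_mult le_divide_eq algebra_simps)
  also have "\<dots> \<longleftrightarrow> r \<le> r\<^sub>0 * exp (- L)" using assms r0 by (intro ln_le_cancel_iff) auto
  finally show ?thesis .
qed

lemma chi_eq: "L > 0 \<Longrightarrow> r > 0 \<Longrightarrow> chi r\<^sub>0 \<Theta> L r = \<Theta> ((ln r\<^sub>0 - ln r) / L)"
proof (cases "r < r\<^sub>0")
  case False
  assume "L > 0" "r > 0"
  moreover have "ln r\<^sub>0 \<le> ln r" using False r0 by simp
  ultimately have "(ln r\<^sub>0 - ln r) / L \<le> 0" by (intro divide_nonpos_pos) auto
  with False \<open>r > 0\<close> show ?thesis by (simp add: chi_def \<Theta>_le_0)
qed (use r0 in \<open>simp add: chi_def ln_div\<close>)

lemma psi_eq: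
  "L > 0 \<Longrightarrow> p \<noteq> 0 \<Longrightarrow> psi r\<^sub>0 \<Theta> A L p = A * snd p * \<Theta> ((ln r\<^sub>0 - ln (norm p)) / L)"
  by (simp add: psi_def chi_eq Rot_def w_dir_def inner_prod_def)

lemma psi_core:
  assumes "L > 0" "norm p \<le> r\<^sub>0 * exp (- L)"
  shows "psi r\<^sub>0 \<Theta> A L p = A * snd p"
proof (cases "p = 0")
  case True
  then show ?thesis by (simp add: psi_def)
next
  case False
  with assms have "(ln r\<^sub>0 - ln (norm p)) / L \<ge> 1" by (subst log_radius_ge_1_iff) auto
  with False assms show ?thesis by (simp add: psi_eq \<Theta>_ge_1)
qed

text \<open>On the core the cutoff is constant, \<open>\<psi> = A x\<^sub>2\<close>, and \<open>R\<nabla>\<psi> = A w\<close>.\<close>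

lemma vortex_core:
  assumes "L > 0" "norm p < r\<^sub>0 * exp (- L)"
  shows "vortex r\<^sub>0 \<Theta> A L p = (A, 0)"
proof -
  have "((\<lambda>p. A * snd p) has_derivative (\<lambda>v. A * snd v)) (at p)"
    by (auto intro!: derivative_eq_intros)
  moreover have "open {p :: plane. norm p < r\<^sub>0 * exp (- L)}"
    by (intro open_Collect_less continuous_intros)
  ultimately have "(psi r\<^sub>0 \<Theta> A L has_derivative (\<lambda>v. A * snd v)) (at p)"
    by (rule has_derivative_transform_within_open[where s = "{p. norm p < r\<^sub>0 * exp (- L)}"])
      (use assms psi_core[OF assms(1)] in auto)
  from frechet_derivative_at[OF this, symmetric] show ?thesis
    by (simp add: vortex_def grad_def pd1_def pd2_def Rot_def)
qed

text \<open>With \<open>z = log (r\<^sub>0/|p|)/L\<close> one has \<open>\<psi> = A p\<^sub>2 \<Theta>(z)\<close> and \<open>\<nabla>z = - p/(L|p|\<^sup>2)\<close>. The factors \<open>p\<^sub>i/|p|\<close>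
  are bounded, and every derivative that falls on the cutoff gains \<open>1/L\<close>.\<close>

lemma vortex_eq:
  fixes p :: plane
  assumes L: "L > 0" and p: "p \<noteq> 0"
  defines "z \<equiv> (ln r\<^sub>0 - ln (norm p)) / L"
  shows "vortex r\<^sub>0 \<Theta> A L p =
    (A * \<Theta> z - A / L * ((snd p / norm p) * (snd p / norm p) * deriv \<Theta> z),
     A / L * ((fst p / norm p) * (snd p / norm p) * deriv \<Theta> z))"
proof -
  let ?z = "\<lambda>p::plane. (ln r\<^sub>0 - ln (norm p)) / L"
  have dz: "(?z has_derivative (\<lambda>v. - (v \<bullet> sgn p) / norm p / L)) (at p)"
    using p L by (auto intro!: derivative_eq_intros has_derivative_norm simp: fun_eq_iff divide_inverse)
  have d\<Theta>: "(\<Theta> has_derivative (*) (deriv \<Theta> z)) (at z)"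
    using smooth_on_has_deriv[OF \<Theta>_smooth(1)] by (simp add: has_field_derivative_def)
  have "((\<lambda>p. \<Theta> (?z p)) has_derivative (\<lambda>v. deriv \<Theta> z * (- (v \<bullet> sgn p) / norm p / L))) (at p)"
    using has_derivative_compose[OF dz] d\<Theta> unfolding z_def by blast
  from has_derivative_mult[OF has_derivative_mult_right[OF has_derivative_snd[OF has_derivative_ident], of A] this]
  have D: "((\<lambda>p. A * snd p * \<Theta> (?z p)) has_derivative
      (\<lambda>v. A * snd p * (deriv \<Theta> z * (- (v \<bullet> sgn p) / norm p / L)) + A * snd v * \<Theta> z)) (at p)"
    by (simp add: z_def)
  have "(psi r\<^sub>0 \<Theta> A L has_derivative
      (\<lambda>v. A * snd p * (deriv \<Theta> z * (- (v \<bullet> sgn p) / norm p / L)) + A * snd v * \<Theta> z)) (at p)"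
    by (rule has_derivative_transform_within_open[where s = "- {0}", OF D])
      (use p psi_eq[OF L] in auto)
  from frechet_derivative_at[OF this, symmetric] show ?thesis
    by (simp add: vortex_def grad_def pd1_def pd2_def Rot_def sgn_div_norm inner_prod_def
        divide_inverse mult_ac)
qed

lemma vortex_outside:
  fixes p :: plane
  assumes "L > 0" "norm p > r\<^sub>0"
  shows "vortex r\<^sub>0 \<Theta> A L p = 0"
proof -
  have c: "((\<lambda>p. 0 :: real) has_derivative (\<lambda>v. 0)) (at p)" by simp
  have o: "open {p :: plane. norm p > r\<^sub>0}"
    by (intro open_Collect_less continuous_intros)
  have z: "0 = psi r\<^sub>0 \<Theta> A L q" if "q \<in> {p. norm p > r\<^sub>0}" for q
    using that r0 by (auto simp: psi_def chi_def)
  have "(psi r\<^sub>0 \<Theta> A L has_derivative (\<lambda>v. 0)) (at p)"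
    by (rule has_derivative_transform_within_open[OF c o _ z]) (use assms in auto)
  from frechet_derivative_at[OF this, symmetric] show ?thesis
    by (simp add: vortex_def grad_def pd1_def pd2_def Rot_def zero_prod_def)
qed

end

section \<open>Derivative bounds\<close>

text \<open>Bounds on derivatives in a form that passes through sums, products and compositions without the
  derivative being written out.\<close>

definition der_bound :: "(plane \<Rightarrow> 'b::real_normed_vector) \<Rightarrow> plane \<Rightarrow> real \<Rightarrow> bool" where
  "der_bound f p B \<longleftrightarrow> (\<exists>D. (f has_derivative D) (at p) \<and> (\<forall>v. norm (D v) \<le> B * norm v))"

lemma der_bound_mono: "der_bound f p B \<Longrightarrow> B \<le> B' \<Longrightarrow> der_bound f p B'"
  unfolding der_bound_def by (meson mult_right_mono norm_ge_zero order_trans)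

lemma der_bound_mult:
  fixes f g :: "plane \<Rightarrow> real"
  assumes "der_bound f p B" "der_bound g p B'" "\<bar>f p\<bar> \<le> a" "\<bar>g p\<bar> \<le> b"
  shows "der_bound (\<lambda>p. f p * g p) p (a * B' + b * B)"
proof -
  obtain D D' where D: "(f has_derivative D) (at p)" "\<And>v. \<bar>D v\<bar> \<le> B * norm v"
    and D': "(g has_derivative D') (at p)" "\<And>v. \<bar>D' v\<bar> \<le> B' * norm v"
    using assms(1,2) by (auto simp: der_bound_def)
  have "\<bar>f p * D' v + D v * g p\<bar> \<le> (a * B' + b * B) * norm v" for v
  proof -
    have "\<bar>f p * D' v\<bar> \<le> a * (B' * norm v)" "\<bar>D v * g p\<bar> \<le> (B * norm v) * b"
      unfolding abs_mult using D(2)[of v] D'(2)[of v] assms(3,4)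
        order_trans[OF abs_ge_zero D(2)[of v]] order_trans[OF abs_ge_zero assms(3)]
      by (auto intro!: mult_mono)
    then show ?thesis by (simp add: algebra_simps)
  qed
  with has_derivative_mult[OF D(1) D'(1)] show ?thesis unfolding der_bound_def by auto
qed

lemma der_bound_add:
  assumes "der_bound f p B" "der_bound g p B'"
  shows "der_bound (\<lambda>p. f p + g p) p (B + B')"
proof -
  obtain D D' where D: "(f has_derivative D) (at p)" "\<And>v. norm (D v) \<le> B * norm v"
    and D': "(g has_derivative D') (at p)" "\<And>v. norm (D' v) \<le> B' * norm v"
    using assms(1,2) by (auto simp: der_bound_def)
  have "norm (D v + D' v) \<le> (B + B') * norm v" for v
    using norm_triangle_le[OF add_mono[OF D(2)[of v] D'(2)[of v]]] by (simp add: algebra_simps)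
  with has_derivative_add[OF D(1) D'(1)] show ?thesis unfolding der_bound_def by auto
qed

lemma der_bound_cmult:
  fixes f :: "plane \<Rightarrow> real"
  assumes "der_bound f p B"
  shows "der_bound (\<lambda>p. c * f p) p (\<bar>c\<bar> * B)"
proof -
  have "der_bound (\<lambda>p. c) p 0"
    unfolding der_bound_def by (intro exI[of _ "\<lambda>v. 0"]) auto
  from der_bound_mult[OF this assms order_refl order_refl] show ?thesis by simp
qed

lemma der_bound_Pair:
  fixes f g :: "plane \<Rightarrow> real"
  assumes "der_bound f p B" "der_bound g p B'"
  shows "der_bound (\<lambda>p. (f p, g p)) p (B + B')"
proof -
  obtain D D' where D: "(f has_derivative D) (at p)" "\<And>v. norm (D v) \<le> B * norm v"
    and D': "(g has_derivative D') (at p)" "\<And>v. norm (D' v) \<le> B' * norm v"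
    using assms(1,2) by (auto simp: der_bound_def)
  have "norm (D v, D' v) \<le> (B + B') * norm v" for v
    using order_trans[OF norm_Pair_le add_mono[OF D(2)[of v] D'(2)[of v]]] by (simp add: algebra_simps)
  with has_derivative_Pair[OF D(1) D'(1)] show ?thesis unfolding der_bound_def by auto
qed

lemma der_bound_compose:
  fixes f :: "plane \<Rightarrow> real"
  assumes "der_bound f p B" "(\<phi> has_real_derivative d) (at (f p))" "\<bar>d\<bar> \<le> C"
  shows "der_bound (\<lambda>p. \<phi> (f p)) p (C * B)"
proof -
  obtain D where D: "(f has_derivative D) (at p)" "\<And>v. \<bar>D v\<bar> \<le> B * norm v"
    using assms(1) by (auto simp: der_bound_def)
  have "((\<lambda>p. \<phi> (f p)) has_derivative (\<lambda>v. d * D v)) (at p)"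
    using has_derivative_compose[OF D(1)] assms(2) by (simp add: has_field_derivative_def)
  moreover have "\<bar>d * D v\<bar> \<le> C * B * norm v" for v
    unfolding abs_mult using mult_mono[OF assms(3) D(2)[of v]] assms(3) by (simp add: mult.assoc)
  ultimately show ?thesis unfolding der_bound_def by auto
qed

lemma der_bound_transform:
  assumes "der_bound f p B" "open U" "p \<in> U" "\<And>q. q \<in> U \<Longrightarrow> g q = f q"
  shows "der_bound g p B"
proof -
  obtain D where D: "(f has_derivative D) (at p)" "\<And>v. norm (D v) \<le> B * norm v"
    using assms(1) by (auto simp: der_bound_def)
  have "(g has_derivative D) (at p)"
    by (rule has_derivative_transform_within_open[OF D(1) assms(2,3)]) (simp add: assms(4))
  with D(2) show ?thesis unfolding der_bound_def by auto
qed

lemma der_bound_translate: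
  assumes "der_bound f (p - m) B"
  shows "der_bound (\<lambda>q. f (q - m)) p B"
proof -
  obtain D where D: "(f has_derivative D) (at (p - m))" "\<And>v. norm (D v) \<le> B * norm v"
    using assms(1) by (auto simp: der_bound_def)
  have "((\<lambda>q. q - m) has_derivative (\<lambda>v. v)) (at p)"
    by (auto intro!: derivative_eq_intros)
  from has_derivative_compose[OF this D(1)] D(2) show ?thesis unfolding der_bound_def by auto
qed

lemma der_bound_const: "der_bound (\<lambda>p. c) p 0"
  unfolding der_bound_def by (intro exI[of _ "\<lambda>v. 0"]) auto

lemma der_bound_pd:
  assumes "der_bound f p B"
  shows "norm (pd1 f p) \<le> B" "norm (pd2 f p) \<le> B"
proof -
  obtain D where D: "(f has_derivative D) (at p)" "\<And>v. norm (D v) \<le> B * norm v"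
    using assms(1) by (auto simp: der_bound_def)
  from frechet_derivative_at[OF D(1), symmetric]
  show "norm (pd1 f p) \<le> B" "norm (pd2 f p) \<le> B"
    using D(2)[of "(1, 0)"] D(2)[of "(0, 1)"] by (simp_all add: pd1_def pd2_def)
qed

lemma der_bound_norm:
  fixes p :: plane
  assumes "p \<noteq> 0"
  shows "der_bound norm p 1"
proof -
  have "\<bar>v \<bullet> sgn p\<bar> \<le> 1 * norm v" for v
    using Cauchy_Schwarz_ineq2[of v "sgn p"] assms by (simp add: norm_sgn)
  with has_derivative_norm[OF assms] show ?thesis unfolding der_bound_def real_norm_def by blast
qed

lemma der_bound_linear:
  fixes f :: "plane \<Rightarrow> real"
  assumes "bounded_linear f" "\<And>v. \<bar>f v\<bar> \<le> norm v"
  shows "der_bound f p 1"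
  unfolding der_bound_def using assms by (auto intro!: exI[of _ f] bounded_linear_imp_has_derivative)

lemma abs_fst_le_norm: "\<bar>fst (p :: plane)\<bar> \<le> norm p" and abs_snd_le_norm: "\<bar>snd (p :: plane)\<bar> \<le> norm p"
  using norm_fst_le[of "fst p" "snd p"] norm_snd_le[of "snd p" "fst p"] by auto

lemma der_bound_div_norm:
  fixes f :: "plane \<Rightarrow> real"
  assumes f: "bounded_linear f" "\<And>v. \<bar>f v\<bar> \<le> norm v" and p: "p \<noteq> 0"
  shows "der_bound (\<lambda>p. f p / norm p) p (2 / norm p)"
proof -
  have "der_bound (\<lambda>p. inverse (norm p)) p (inverse (norm p) * inverse (norm p) * 1)"
    by (rule der_bound_compose[OF der_bound_norm[OF p]], rule DERIV_inverse')
      (use p in \<open>auto simp: power2_eq_square intro!: derivative_eq_intros\<close>)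
  note der_bound_mult[OF der_bound_linear[OF f] this f(2) order_refl]
  moreover  have "norm p * (inverse (norm p) * inverse (norm p) * 1) + \<bar>inverse (norm p)\<bar> * 1 = 2 * inverse (norm p)"
    using p by (simp add: field_simps)
  ultimately show ?thesis unfolding divide_inverse by (simp only:)
qed

text \<open>Homogeneous factors \<open>p\<^sub>i/|p|\<close> have derivatives at most \<open>2/|p|\<close>, functions of \<open>z\<close> at most
  \<open>C/(L|p|)\<close>. The term \<open>A\<Theta>(z)\<close> contributes \<open>1\<close> and each of the two products \<open>5\<close> to the constant \<open>11\<close>.\<close>

lemma vortex_der_bound:
  fixes p :: plane
  assumes r0: "r\<^sub>0 > 0" and \<Theta>: "cutoff_profile \<Theta>"
    and C: "C \<ge> 1" "\<And>z. \<bar>deriv \<Theta> z\<bar> \<le> C" "\<And>z. \<bar>deriv (deriv \<Theta>) z\<bar> \<le> C"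
    and L: "L \<ge> 1" and A: "A \<ge> 0" and p: "p \<noteq> 0"
  shows "der_bound (vortex r\<^sub>0 \<Theta> A L) p (11 * (A * C / L) / norm p)"
proof -
  let ?z = "\<lambda>p::plane. (ln r\<^sub>0 - ln (norm p)) / L"
  let ?e1 = "\<lambda>p::plane. fst p / norm p" and ?e2 = "\<lambda>p::plane. snd p / norm p"
  let ?r = "norm p"
  have r: "?r > 0" using p by simp
  have "((\<lambda>r. (ln r\<^sub>0 - ln r) / L) has_real_derivative (- inverse ?r / L)) (at ?r)"
    using r L by (auto intro!: derivative_eq_intros simp: inverse_eq_divide)
  from der_bound_compose[OF der_bound_norm[OF p] this order_refl]
  have z: "der_bound ?z p (1 / (L * ?r))" using r L by (simp add: inverse_eq_divide mult.commute)
  note sm = \<Theta>_smooth[OF r0 \<Theta>]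
  have t1: "der_bound (\<lambda>p. \<Theta> (?z p)) p (C * (1 / (L * ?r)))"
    by (rule der_bound_compose[OF z smooth_on_has_deriv[OF sm(1)] C(2)])
  have t2: "der_bound (\<lambda>p. deriv \<Theta> (?z p)) p (C * (1 / (L * ?r)))"
    by (rule der_bound_compose[OF z smooth_on_has_deriv[OF sm(2)] C(3)])
  have e: "der_bound ?e1 p (2 / ?r)" "der_bound ?e2 p (2 / ?r)"
    using abs_fst_le_norm abs_snd_le_norm
    by (auto intro!: der_bound_div_norm p bounded_linear_fst bounded_linear_snd)
  have e1: "\<bar>?e1 p\<bar> \<le> 1" "\<bar>?e2 p\<bar> \<le> 1"
    using abs_fst_le_norm[of p] abs_snd_le_norm[of p] r by (auto simp: divide_le_eq)
  have ee1: "\<bar>?e1 p * ?e2 p\<bar> \<le> 1" "\<bar>?e2 p * ?e2 p\<bar> \<le> 1"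
    unfolding abs_mult using mult_mono[OF e1(1) e1(2)] mult_mono[OF e1(2) e1(2)] by auto
  have q: "der_bound (\<lambda>p. ?e1 p * ?e2 p * deriv \<Theta> (?z p)) p
      (1 * (C * (1 / (L * ?r))) + C * (1 * (2 / ?r) + 1 * (2 / ?r)))"
    "der_bound (\<lambda>p. ?e2 p * ?e2 p * deriv \<Theta> (?z p)) p
      (1 * (C * (1 / (L * ?r))) + C * (1 * (2 / ?r) + 1 * (2 / ?r)))"
    by (intro der_bound_mult e e1 ee1 t2 C)+
  have "C * (1 / (L * ?r)) \<le> C * (1 / ?r)"
    using C(1) L r by (intro mult_left_mono divide_left_mono) (auto simp: mult_le_cancel_right1)
  then have le: "1 * (C * (1 / (L * ?r))) + C * (1 * (2 / ?r) + 1 * (2 / ?r)) \<le> 5 * C / ?r"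
  proof -
    have "C * (1 * (2 / ?r) + 1 * (2 / ?r)) = 4 * (C * (1 / ?r))" "5 * C / ?r = 5 * (C * (1 / ?r))"
      by simp_all
    with \<open>C * (1 / (L * ?r)) \<le> C * (1 / ?r)\<close> show ?thesis by linarith
  qed
  have "der_bound (\<lambda>p. (A * \<Theta> (?z p) + (- (A / L)) * (?e2 p * ?e2 p * deriv \<Theta> (?z p)),
      A / L * (?e1 p * ?e2 p * deriv \<Theta> (?z p)))) p
      ((\<bar>A\<bar> * (C * (1 / (L * ?r))) + \<bar>- (A / L)\<bar> * (5 * C / ?r)) + \<bar>A / L\<bar> * (5 * C / ?r))"
    by (intro der_bound_Pair der_bound_add der_bound_cmult t1 der_bound_mono[OF q(1) le]
        der_bound_mono[OF q(2) le])
  then have "der_bound (\<lambda>p. (A * \<Theta> (?z p) + (- (A / L)) * (?e2 p * ?e2 p * deriv \<Theta> (?z p)),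
      A / L * (?e1 p * ?e2 p * deriv \<Theta> (?z p)))) p (11 * (A * C / L) / ?r)"
    by (rule der_bound_mono) (use A L r in \<open>simp add: field_simps\<close>)
  then show ?thesis
    by (rule der_bound_transform[of _ _ _ "- {0}"]) (use L p vortex_eq[OF r0 \<Theta>] in auto)
qed

section \<open>Wrapping and smoothness of the moving vortices\<close>

definition wrap1 :: "real \<Rightarrow> real" where
  "wrap1 a = a - 2*pi * of_int \<lfloor>(a + pi) / (2*pi)\<rfloor>"

lemma wrap_eq_wrap1: "wrap x = (wrap1 (fst x), wrap1 (snd x))"
  by (simp add: wrap_def wrap1_def)

lemma wrap1_bounds: "- pi \<le> wrap1 a" "wrap1 a < pi"
proof -
  define k where "k = \<lfloor>(a + pi) / (2*pi)\<rfloor>"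
  have "real_of_int k \<le> (a + pi) / (2*pi)" "(a + pi) / (2*pi) < real_of_int k + 1"
    unfolding k_def by linarith+
  then have "real_of_int k * (2*pi) \<le> a + pi" "a + pi < (real_of_int k + 1) * (2*pi)"
    by (simp_all only: pos_le_divide_eq pos_divide_less_eq pi_gt_zero mult_pos_pos zero_less_numeral)
  then show "- pi \<le> wrap1 a" "wrap1 a < pi"
    unfolding wrap1_def k_def[symmetric] by (simp_all add: algebra_simps)
qed

lemma wrap1_eqI:
  assumes "2*pi * real_of_int k - pi \<le> b" "b < 2*pi * real_of_int k + pi"
  shows "wrap1 b = b - 2*pi * real_of_int k"
proof -
  have "real_of_int k * (2*pi) \<le> b + pi" "b + pi < (real_of_int k + 1) * (2*pi)"
    using assms by (simp_all add: algebra_simps)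
  then have "\<lfloor>(b + pi) / (2*pi)\<rfloor> = k"
    by (intro floor_unique)
      (simp_all only: pos_le_divide_eq pos_divide_less_eq pi_gt_zero mult_pos_pos zero_less_numeral)
  then show ?thesis by (simp add: wrap1_def)
qed

lemma wrap1_periodic: "wrap1 (a + 2*pi) = wrap1 a"
proof -
  have "(a + 2*pi + pi) / (2*pi) = (a + pi) / (2*pi) + 1" by (simp add: field_simps)
  then have "\<lfloor>(a + 2*pi + pi) / (2*pi)\<rfloor> = \<lfloor>(a + pi) / (2*pi)\<rfloor> + 1" by linarith
  then show ?thesis by (simp add: wrap1_def algebra_simps)
qed

lemma wrap1_interior:
  assumes "wrap1 a > - pi"
  shows "\<exists>U. open U \<and> a \<in> U \<and> (\<forall>b\<in>U. wrap1 b = b - (a - wrap1 a))"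
proof -
  define k where "k = \<lfloor>(a + pi) / (2*pi)\<rfloor>"
  let ?U = "{2*pi * real_of_int k - pi <..< 2*pi * real_of_int k + pi}"
  have a: "a - wrap1 a = 2*pi * real_of_int k" by (simp add: wrap1_def k_def)
  have "wrap1 b = b - (a - wrap1 a)" if "b \<in> ?U" for b
    unfolding a using that by (intro wrap1_eqI) auto
  moreover have "a \<in> ?U" using assms wrap1_bounds[of a] a by auto
  moreover have "open ?U" by (rule open_greaterThanLessThan)
  ultimately show ?thesis by blast
qed

text \<open>At its jumps the representative switches between \<open>-\<pi>\<close> and \<open>\<pi>\<close>, both of absolute value \<open>\<pi>\<close>. Near a
  jump it is therefore far from \<open>0\<close>, outside the support of a vortex.\<close>

lemma wrap1_boundary:
  assumes "wrap1 a = - pi"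
  shows "\<bar>wrap1 b\<bar> \<ge> pi - \<bar>b - a\<bar>"
proof -
  let ?k = "\<lambda>a. \<lfloor>(a + pi) / (2*pi)\<rfloor>"
  let ?j = "2 * (?k a - ?k b) - 1"
  have eq: "wrap1 b = (b - a) + pi * of_int ?j"
    using assms by (simp add: wrap1_def algebra_simps)
  have "\<bar>2 * (i - i') - 1\<bar> \<ge> 1" for i i' :: int by presburger
  then have "\<bar>?j\<bar> \<ge> 1" by blast
  then have "(1::real) \<le> \<bar>of_int ?j\<bar>" by linarith
  then have "pi * 1 \<le> pi * \<bar>of_int ?j\<bar>" by (intro mult_left_mono) auto
  also have "\<dots> = \<bar>pi * of_int ?j\<bar>" by (simp add: abs_mult)
  finally show ?thesis unfolding eq by linarith
qed

lemma wrap_local: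
  assumes r0: "0 < r\<^sub>0" "r\<^sub>0 < pi"
  obtains (inside) U m where "open U" "y \<in> U" "\<And>y'. y' \<in> U \<Longrightarrow> wrap y' = y' - m"
  | (outside) U where "open U" "y \<in> U" "\<And>y'. y' \<in> U \<Longrightarrow> norm (wrap y') > r\<^sub>0"
proof (cases "wrap1 (fst y) > - pi \<and> wrap1 (snd y) > - pi")
  case True
  then obtain U V where U: "open U" "fst y \<in> U" "\<forall>b\<in>U. wrap1 b = b - (fst y - wrap1 (fst y))"
    and V: "open V" "snd y \<in> V" "\<forall>b\<in>V. wrap1 b = b - (snd y - wrap1 (snd y))"
    using wrap1_interior by meson
  show ?thesis
  proof (rule inside[of "U \<times> V" "y - wrap y"])
    fix y' assume "y' \<in> U \<times> V"
    then show "wrap y' = y' - (y - wrap y)"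
      using U(3) V(3) by (auto simp: wrap_eq_wrap1 prod_eq_iff)
  qed (use U V in \<open>auto simp: open_Times mem_Times_iff\<close>)
next
  case False
  let ?U = "ball y (pi - r\<^sub>0)"
  show ?thesis
  proof (rule outside[of ?U])
    fix y' assume y': "y' \<in> ?U"
    have d: "\<bar>fst y' - fst y\<bar> < pi - r\<^sub>0" "\<bar>snd y' - snd y\<bar> < pi - r\<^sub>0"
      using y' abs_fst_le_norm[of "y' - y"] abs_snd_le_norm[of "y' - y"]
      by (auto simp: dist_norm norm_minus_commute)
    have "wrap1 (fst y) = - pi \<or> wrap1 (snd y) = - pi"
      using False wrap1_bounds(1)[of "fst y"] wrap1_bounds(1)[of "snd y"] by linarith
    then have "\<bar>fst (wrap y')\<bar> > r\<^sub>0 \<or> \<bar>snd (wrap y')\<bar> > r\<^sub>0"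
      using d wrap1_boundary[of "fst y" "fst y'"] wrap1_boundary[of "snd y" "snd y'"]
      by (auto simp: wrap_eq_wrap1)
    then show "norm (wrap y') > r\<^sub>0"
      using abs_fst_le_norm[of "wrap y'"] abs_snd_le_norm[of "wrap y'"] by linarith
  qed (use r0 in auto)
qed

lemma amp_ge_1: "\<sigma> > 0 \<Longrightarrow> t > - delta n \<Longrightarrow> amp \<sigma> n t \<ge> 1"
  by (simp add: amp_def)

lemma len_ge_1:
  assumes "\<sigma> > 0" "t > - delta n"
  shows "len \<sigma> n t \<ge> 1"
proof -
  have "1\<^sup>2 \<le> (amp \<sigma> n t)\<^sup>2" using amp_ge_1[OF assms] by (intro power_mono) auto
  then show ?thesis by (simp add: len_def)
qed

lemma delta_pos: "delta n > 0" by (simp add: delta_def)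

lemma Ck_on_coord:
  "Ck_on k S (\<lambda>q :: real \<times> plane. fst q)" "Ck_on k S (\<lambda>q :: real \<times> plane. fst (snd q))"
  "Ck_on k S (\<lambda>q :: real \<times> plane. snd (snd q))"
  by (intro Ck_on_bounded_linear bounded_linear_fst bounded_linear_snd bounded_linear_compose[OF bounded_linear_fst]
      bounded_linear_compose[OF bounded_linear_snd])+

lemma Ck_on_amp_len:
  assumes \<sigma>: "\<sigma> > 0"
  shows "Ck_on k ({- delta n<..} \<times> (UNIV :: plane set)) (\<lambda>q. amp \<sigma> n (fst q))"
    "Ck_on k ({- delta n<..} \<times> (UNIV :: plane set)) (\<lambda>q. len \<sigma> n (fst q))"
proof -
  have "Ck_on k ({- delta n<..} \<times> (UNIV :: plane set)) (\<lambda>q. 1 + 2 * inverse (\<sigma> * (fst q + delta n)))"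
    by (intro Ck_on_add Ck_on_cmult Ck_on_inverse Ck_on_const Ck_on_coord) (use \<sigma> in auto)
  then show amp: "Ck_on k ({- delta n<..} \<times> (UNIV :: plane set)) (\<lambda>q. amp \<sigma> n (fst q))"
    by (simp add: amp_def divide_inverse)
  show "Ck_on k ({- delta n<..} \<times> (UNIV :: plane set)) (\<lambda>q. len \<sigma> n (fst q))"
    unfolding len_def power2_eq_square by (intro Ck_on_add Ck_on_mult Ck_on_const amp)
qed

text \<open>The extension to \<open>t > - \<delta>\<^sub>n\<close> makes the domain open. Three kinds of neighbourhoods cover it: where the
  wrapped point lies beyond \<open>r\<^sub>0\<close> the field vanishes, near the centre it is \<open>(A\<^sub>n(t), 0)\<close>, and elsewhere
  \<open>vortex_eq\<close> expresses it by smooth functions of \<open>s = |p|\<^sup>2\<close>, \<open>A\<close> and \<open>L\<close>.\<close>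

lemma vortex_wrapped_smooth:
  assumes \<sigma>: "\<sigma> > 0" and r0: "0 < r\<^sub>0" "r\<^sub>0 < pi" and \<Theta>: "cutoff_profile \<Theta>"
  shows "Ck_on k ({- delta n<..} \<times> UNIV) (\<lambda>(t, x). u_seq \<sigma> r\<^sub>0 \<Theta> x\<^sub>0 n t x)"
proof (rule Ck_on_local)
  let ?S = "{- delta n<..} \<times> (UNIV :: plane set)"
  let ?u = "\<lambda>(t, x). u_seq \<sigma> r\<^sub>0 \<Theta> x\<^sub>0 n t x"
  let ?y = "\<lambda>q. snd q - (x\<^sub>0 + fst q *\<^sub>R w_dir)"
  let ?A = "\<lambda>q :: real \<times> plane. amp \<sigma> n (fst q)" and ?L = "\<lambda>q :: real \<times> plane. len \<sigma> n (fst q)"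
  have u: "?u q = vortex r\<^sub>0 \<Theta> (?A q) (?L q) (wrap (?y q))" for q
    by (simp add: u_seq_def case_prod_beta)
  have S: "open ?S" by (intro open_Times) auto
  have Lpos: "?L q > 0" if "q \<in> ?S" for q
    using len_ge_1[OF \<sigma>, of n "fst q"] that by auto
  have Lc: "continuous_on ?S ?L"
    by (rule Ck_on_imp_continuous_on[OF Ck_on_amp_len(2)[OF \<sigma>]])
  fix q assume q: "q \<in> ?S"
  have yc: "continuous_on UNIV ?y" by (intro continuous_intros)
  have glue: "\<exists>U. open U \<and> q \<in> U \<and> Ck_on k U ?u"
    if "open V" "q \<in> V" "V \<subseteq> ?S" "Ck_on k ?S f" "\<And>q. q \<in> V \<Longrightarrow> ?u q = f q" for V f
    using that Ck_on_cong[OF Ck_on_subset[OF that(4,3)], of ?u] by blast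
  show "\<exists>U. open U \<and> q \<in> U \<and> Ck_on k U ?u"
    using r0
  proof (cases rule: wrap_local[where y = "?y q", case_names inside outside])
    case (outside U)
    have o: "open (?S \<inter> ?y -` U)" using S open_vimage[OF outside(1) yc] by auto
    show ?thesis
    proof (rule glue[OF o _ _ Ck_on_const])
      fix q assume "q \<in> ?S \<inter> ?y -` U"
      then show "?u q = 0"
        unfolding u using Lpos[of q] outside(3) by (intro vortex_outside[OF r0(1) \<Theta>]) auto
    qed (use q outside in auto)
  next
    case (inside U m)
    have o: "open (?S \<inter> ?y -` U)" using S open_vimage[OF inside(1) yc] by auto
    let ?p = "\<lambda>q. ?y q - m"
    have pc: "continuous_on UNIV ?p" by (intro continuous_intros)
    show ?thesis
    proof (cases "?p q = 0")
      case True
      have c1: "continuous_on ?S (\<lambda>q. norm (?p q))"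
        by (intro continuous_on_norm continuous_on_subset[OF pc]) auto
      have c2: "continuous_on ?S (\<lambda>q. r\<^sub>0 * exp (- ?L q))"
        by (intro continuous_intros Lc)
      obtain W where W: "open W" "W \<inter> ?S = {q \<in> ?S. norm (?p q) < r\<^sub>0 * exp (- ?L q)}"
        using open_Collect_less_Int[OF c1 c2] by (elim exE conjE)
      have o: "open ((W \<inter> ?S) \<inter> ?y -` U)"
        by (intro open_Int W(1) S open_vimage[OF inside(1) yc])
      show ?thesis
      proof (rule glue[OF o])
        show "q \<in> W \<inter> ?S \<inter> ?y -` U"
          unfolding W(2) using q inside(2) True r0 by simp
        show "Ck_on k ?S (\<lambda>q. (?A q, 0 :: real))"
          by (intro Ck_on_Pair Ck_on_amp_len[OF \<sigma>] Ck_on_const)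
        fix q' assume q': "q' \<in> W \<inter> ?S \<inter> ?y -` U"
        then have "q' \<in> {q \<in> ?S. norm (?p q) < r\<^sub>0 * exp (- ?L q)}" "?y q' \<in> U"
          unfolding W(2) by (blast, blast)
        then have q'S: "q' \<in> ?S" "norm (?p q') < r\<^sub>0 * exp (- ?L q')" "?y q' \<in> U" by blast+
        show "?u q' = (?A q', 0)"
          unfolding u inside(3)[OF q'S(3)] by (rule vortex_core[OF r0(1) \<Theta> Lpos[OF q'S(1)] q'S(2)])
      qed blast
    next
      case False
      let ?V = "?S \<inter> {q. ?p q \<noteq> 0}"
      let ?s = "\<lambda>q. fst (?p q) * fst (?p q) + snd (?p q) * snd (?p q)"
      let ?z = "\<lambda>q. (ln r\<^sub>0 - ln (?s q) * (1/2)) * inverse (?L q)"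
      let ?f = "\<lambda>q. (?A q * \<Theta> (?z q)
          - ?A q * inverse (?L q) * (snd (?p q) * snd (?p q) * inverse (?s q) * deriv \<Theta> (?z q)),
         ?A q * inverse (?L q) * (fst (?p q) * snd (?p q) * inverse (?s q) * deriv \<Theta> (?z q)))"
      have spos: "?s q > 0" if "q \<in> ?V" for q
        using that by (auto simp: prod_eq_iff sum_squares_gt_zero_iff)
      have pk: "Ck_on k ?V (\<lambda>q. fst (?p q))" "Ck_on k ?V (\<lambda>q. snd (?p q))"
        using Ck_on_diff[OF Ck_on_diff[OF Ck_on_coord(2) Ck_on_const[of k ?V "fst x\<^sub>0 + fst m"]]
            Ck_on_coord(1)]
          Ck_on_diff[OF Ck_on_coord(3) Ck_on_const[of k ?V "snd x\<^sub>0 + snd m"]]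
        by (simp_all add: w_dir_def algebra_simps)
      have AL: "Ck_on k ?V ?A" "Ck_on k ?V ?L"
        using Ck_on_subset[OF Ck_on_amp_len(1)[OF \<sigma>]] Ck_on_subset[OF Ck_on_amp_len(2)[OF \<sigma>]] by auto
      have sk: "Ck_on k ?V ?s" by (intro Ck_on_add Ck_on_mult pk)
      have si: "Ck_on k ?V (\<lambda>q. inverse (?s q))"
        by (rule Ck_on_inverse[OF sk]) (use spos in fastforce)
      have iL: "Ck_on k ?V (\<lambda>q. inverse (?L q))"
        by (rule Ck_on_inverse[OF AL(2)]) (use Lpos in fastforce)
      have zk: "Ck_on k ?V ?z"
        by (intro Ck_on_mult Ck_on_diff Ck_on_const iL Ck_on_ln sk spos)
      have \<Theta>k: "Ck_on k UNIV \<Theta>" "Ck_on k UNIV (deriv \<Theta>)"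
        using \<Theta>_smooth[OF r0(1) \<Theta>] by (auto simp: smooth_on_def)
      have fk: "Ck_on k ?V ?f"
        by (intro Ck_on_Pair Ck_on_diff Ck_on_mult AL(1) iL pk si
            Ck_on_compose[OF \<Theta>k(1) zk] Ck_on_compose[OF \<Theta>k(2) zk] UNIV_I)
      have "open {q. ?p q \<noteq> 0}" by (intro open_Collect_neq pc continuous_on_const)
      then have o: "open (?V \<inter> ?y -` U)" using S open_vimage[OF inside(1) yc] by auto
      have eq: "?u q = ?f q" if q: "q \<in> ?V \<inter> ?y -` U" for q
      proof -
        let ?r = "norm (?p q)"
        have "?y q \<in> U" and p: "?p q \<noteq> 0" and "q \<in> ?S" using q by auto
        have s: "?s q = ?r * ?r" using norm_plane_sq[of "?p q"] by (simp add: power2_eq_square)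
        have "ln (?s q) * (1/2) = ln ?r" using p unfolding s by (simp add: ln_mult)
        moreover have "a * b * inverse (?s q) = a / ?r * (b / ?r)" for a b
          unfolding s by (simp add: divide_inverse)
        ultimately show ?thesis
          unfolding u inside(3)[OF \<open>?y q \<in> U\<close>] vortex_eq[OF r0(1) \<Theta> Lpos[OF \<open>q \<in> ?S\<close>] p]
          by (simp only: divide_inverse)
      qed
      have "Ck_on k (?V \<inter> ?y -` U) ?u"
        by (rule Ck_on_cong[OF Ck_on_subset[OF fk] eq]) auto
      with o q inside(2) False show ?thesis by blast
    qed
  qed
qed

lemma u_seq_smooth_coeff:
  assumes \<sigma>: "\<sigma> > 0" and r0: "0 < r\<^sub>0" "r\<^sub>0 < pi" and \<Theta>: "cutoff_profile \<Theta>"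
  shows "smooth_coeff T (u_seq \<sigma> r\<^sub>0 \<Theta> x\<^sub>0 n)"
proof -
  have "{0..T} \<times> UNIV \<subseteq> {- delta n<..} \<times> (UNIV :: plane set)" using delta_pos[of n] by auto
  then have "smooth_on ({0..T} \<times> UNIV) (\<lambda>(t, x). u_seq \<sigma> r\<^sub>0 \<Theta> x\<^sub>0 n t x)"
    unfolding smooth_on_def using Ck_on_subset[OF vortex_wrapped_smooth[OF assms]] by blast
  moreover have "periodic (u_seq \<sigma> r\<^sub>0 \<Theta> x\<^sub>0 n t)" for t
  proof -
    have "wrap1 (a + 2*pi - b) = wrap1 (a - b)" for a b
      using wrap1_periodic[of "a - b"] by (simp add: algebra_simps)
    then show ?thesis by (simp add: periodic_def u_seq_def wrap_eq_wrap1)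
  qed
  ultimately show ?thesis by (simp add: smooth_coeff_def)
qed

section \<open>The energy of a vortex\<close>

definition h1_density :: "(plane \<Rightarrow> plane) \<Rightarrow> plane \<Rightarrow> real" where
  "h1_density f x = (norm (f x))\<^sup>2 + (norm (pd1 f x))\<^sup>2 + (norm (pd2 f x))\<^sup>2"

lemma h1_density_le:
  assumes "der_bound f x B"
  shows "h1_density f x \<le> (norm (f x))\<^sup>2 + 2 * B\<^sup>2"
  using power_mono[OF der_bound_pd(1)[OF assms] norm_ge_zero, of 2]
    power_mono[OF der_bound_pd(2)[OF assms] norm_ge_zero, of 2]
  by (simp add: h1_density_def)

lemma der_bound_wrapped:
  assumes r0: "0 < r\<^sub>0" "r\<^sub>0 < pi" and V: "\<forall>p. norm p > r\<^sub>0 \<longrightarrow> V p = 0"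
    and B: "der_bound V (wrap (x - c)) B" "B \<ge> 0"
  shows "der_bound (\<lambda>x. V (wrap (x - c))) x B"
  using r0
proof (cases rule: wrap_local[where y = "x - c", case_names inside outside])
  case (outside U)
  have o: "open ((\<lambda>x. x - c) -` U)"
    by (intro open_vimage[OF outside(1)] continuous_intros)
  have "der_bound (\<lambda>x. V (wrap (x - c))) x 0"
  proof (rule der_bound_transform[OF der_bound_const[of 0] o])
    fix q assume "q \<in> (\<lambda>x. x - c) -` U"
    then show "V (wrap (q - c)) = 0" using outside(3)[of "q - c"] V[rule_format, of "wrap (q - c)"] by simp
  qed (use outside in simp)
  then show ?thesis by (rule der_bound_mono) (rule B(2))
next
  case (inside U m)
  have o: "open ((\<lambda>x. x - c) -` U)"
    by (intro open_vimage[OF inside(1)] continuous_intros)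
  have "wrap (x - c) = x - (c + m)" using inside(3)[OF inside(2)] by (simp add: algebra_simps)
  with B(1) have "der_bound V (x - (c + m)) B" by simp
  from der_bound_translate[OF this] show ?thesis
  proof (rule der_bound_transform[OF _ o])
    fix q assume "q \<in> (\<lambda>x. x - c) -` U"
    then have "wrap (q - c) = q - (c + m)" using inside(3)[of "q - c"] by (simp add: algebra_simps)
    then show "V (wrap (q - c)) = V (q - (c + m))" by simp
  qed (use inside in simp)
qed

lemma le_exp_nat: "1 + real j \<le> exp (real j)"
  by (rule exp_ge_add_one_self)

text \<open>The shell index is \<open>j = \<lfloor>log (r\<^sub>0/|p|)\<rfloor>\<close>, cut off at \<open>\<lfloor>L\<rfloor>\<close> in the core. On the shells \<open>\<Theta>(z) \<le> Cz\<close> makes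
  the field itself of order \<open>(A/L)(j + 1)\<close>, which \<open>(A/L)e\<^sup>j\<close> dominates just as it does the derivatives;
  in the core the field is \<open>A = (A/L)L\<close>, and \<open>L \<le> e\<^sup>j\<close>.\<close>

lemma vortex_density_bound:
  fixes x c :: plane
  assumes r0: "0 < r\<^sub>0" "r\<^sub>0 < pi" and \<Theta>: "cutoff_profile \<Theta>"
    and C: "C \<ge> 1" "\<And>z. \<bar>deriv \<Theta> z\<bar> \<le> C" "\<And>z. \<bar>deriv (deriv \<Theta>) z\<bar> \<le> C"
      "\<forall>z\<in>{0..1}. \<Theta> z \<le> C * z"
    and L: "L \<ge> 1" and A: "A \<ge> 0"
  defines "f \<equiv> \<lambda>x. vortex r\<^sub>0 \<Theta> A L (wrap (x - c))"
  defines "Q \<equiv> C\<^sup>2 * (9 + 242 * (exp 1)\<^sup>2 / r\<^sub>0\<^sup>2)"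
  shows "h1_density f x \<le> 0 \<or> (\<exists>j\<le>nat \<lfloor>L\<rfloor>. norm (wrap (x - c)) \<le> r\<^sub>0 * exp (- real j) \<and>
      h1_density f x \<le> Q * (A / L)\<^sup>2 * (exp (real j))\<^sup>2)"
proof -
  let ?V = "vortex r\<^sub>0 \<Theta> A L" and ?q = "wrap (x - c)"
  let ?r = "norm ?q"
  have L0: "L > 0" using L by simp
  have out: "\<forall>p. norm p > r\<^sub>0 \<longrightarrow> ?V p = 0" using vortex_outside[OF r0(1) \<Theta> L0] by blast
  note wrapped = der_bound_wrapped[OF r0, where V = ?V, OF out]
  have Q: "Q \<ge> 1"
  proof -
    have "1 * 1 \<le> C\<^sup>2 * (9 + 242 * (exp 1)\<^sup>2 / r\<^sub>0\<^sup>2)"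
      using C(1) by (intro mult_mono) (auto simp: one_le_power add_increasing2)
    then show ?thesis by (simp add: Q_def)
  qed
  consider "?r > r\<^sub>0" | "?r < r\<^sub>0 * exp (- L)" | "r\<^sub>0 * exp (- L) \<le> ?r" "?r \<le> r\<^sub>0" by linarith
  then show ?thesis
  proof cases
    case 1
    have o: "open {p :: plane. norm p > r\<^sub>0}" by (intro open_Collect_less continuous_intros)
    have "der_bound ?V ?q 0"
      by (rule der_bound_transform[OF der_bound_const[of 0] o]) (use 1 out in auto)
    from h1_density_le[OF wrapped[OF this]] 1 show ?thesis by (simp add: f_def out)
  next
    case 2
    have o: "open {p :: plane. norm p < r\<^sub>0 * exp (- L)}" by (intro open_Collect_less continuous_intros)
    have core: "?V p = (A, 0)" if "norm p < r\<^sub>0 * exp (- L)" for p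
      using vortex_core[OF r0(1) \<Theta> L0 that] .
    have "der_bound ?V ?q 0"
      by (rule der_bound_transform[OF der_bound_const[of "(A, 0)"] o]) (use 2 core in auto)
    from h1_density_le[OF wrapped[OF this]] have d: "h1_density f x \<le> A\<^sup>2"
      using core[OF 2] by (simp add: f_def)
    define j where "j = nat \<lfloor>L\<rfloor>"
    have j: "real j \<le> L" "L \<le> 1 + real j" unfolding j_def using L by linarith+
    have "L\<^sup>2 \<le> (exp (real j))\<^sup>2" using order_trans[OF j(2) le_exp_nat] L by (intro power_mono) auto
    then have "(A / L)\<^sup>2 * L\<^sup>2 \<le> (A / L)\<^sup>2 * (exp (real j))\<^sup>2" by (intro mult_left_mono) auto
    then have "A\<^sup>2 \<le> (A / L)\<^sup>2 * (exp (real j))\<^sup>2" using L by (simp add: power_divide)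
    also have "\<dots> = 1 * ((A / L)\<^sup>2 * (exp (real j))\<^sup>2)" by simp
    also have "\<dots> \<le> Q * ((A / L)\<^sup>2 * (exp (real j))\<^sup>2)" using Q by (intro mult_right_mono) auto
    finally have "h1_density f x \<le> Q * (A / L)\<^sup>2 * (exp (real j))\<^sup>2" using d by (simp add: mult.assoc)
    moreover have "r\<^sub>0 * exp (- L) \<le> r\<^sub>0 * exp (- real j)" using j r0 by simp
    then have "?r \<le> r\<^sub>0 * exp (- real j)" using 2 by linarith
    ultimately show ?thesis by (intro disjI2 exI[of _ j]) (simp add: j_def)
  next
    case 3
    have r: "?r > 0" using 3(1) r0 by (meson exp_gt_zero mult_pos_pos order_less_le_trans)
    then have q0: "?q \<noteq> 0" by auto
    define ell where "ell = ln r\<^sub>0 - ln ?r"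
    have "ln ?r \<le> ln r\<^sub>0" using 3(2) r r0 by (intro ln_mono) auto
    then have ell0: "ell \<ge> 0" by (simp add: ell_def)
    have "ln (r\<^sub>0 * exp (- L)) \<le> ln ?r" using 3(1) r r0 by (intro ln_mono) auto
    then have ellL: "ell \<le> L" using r0 by (simp add: ell_def ln_mult)
    have r_eq: "?r = r\<^sub>0 * exp (- ell)" using r r0 by (simp add: ell_def exp_diff)
    define a where "a = A * C / L"
    have a: "a \<ge> 0" using A C L by (simp add: a_def)
    define j where "j = nat \<lfloor>ell\<rfloor>"
    have j: "real j \<le> ell" "ell \<le> real j + 1" unfolding j_def using ell0 by linarith+
    have jL: "j \<le> nat \<lfloor>L\<rfloor>" unfolding j_def by (intro nat_mono floor_mono ellL)
    have db: "der_bound f x (11 * a / ?r)"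
      unfolding f_def a_def
      by (intro wrapped vortex_der_bound[OF r0(1) \<Theta> C(1-3) L A q0]) (use A C L r in auto)
    let ?z = "ell / L" let ?e1 = "fst ?q / ?r" and ?e2 = "snd ?q / ?r"
    have fx: "f x = (A * \<Theta> ?z - A / L * (?e2 * ?e2 * deriv \<Theta> ?z), A / L * (?e1 * ?e2 * deriv \<Theta> ?z))"
      unfolding f_def ell_def by (rule vortex_eq[OF r0(1) \<Theta> L0 q0])
    have e: "\<bar>?e1\<bar> \<le> 1" "\<bar>?e2\<bar> \<le> 1"
      using abs_fst_le_norm[of ?q] abs_snd_le_norm[of ?q] r by (auto simp: divide_le_eq)
    have t: "\<bar>A / L * (u * v * deriv \<Theta> ?z)\<bar> \<le> a" if "\<bar>u\<bar> \<le> 1" "\<bar>v\<bar> \<le> 1" for u v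
    proof -
      have "\<bar>u * v * deriv \<Theta> ?z\<bar> \<le> 1 * 1 * C"
        unfolding abs_mult using that C by (intro mult_mono) auto
      then have "\<bar>A / L\<bar> * \<bar>u * v * deriv \<Theta> ?z\<bar> \<le> A / L * C"
        using A L by (intro mult_mono) auto
      then show ?thesis by (simp add: a_def abs_mult)
    qed
    have "\<Theta> ?z \<le> C * ?z" using ell0 ellL L by (intro C(4)[rule_format]) auto
    then have "A * \<Theta> ?z \<le> A * (C * ?z)" using A by (intro mult_left_mono) auto
    also have "\<dots> = a * ell" by (simp add: a_def)
    finally have t0: "\<bar>A * \<Theta> ?z\<bar> \<le> a * ell" using A \<Theta>_range[OF r0(1) \<Theta>] by simp
    have "norm (f x) \<le> \<bar>fst (f x)\<bar> + \<bar>snd (f x)\<bar>"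
      using norm_Pair_le[of "fst (f x)" "snd (f x)"] by simp
    also have "\<dots> \<le> (a * ell + a) + a"
      using t0 t[OF e(2) e(2)] t[OF e(1) e(2)] unfolding fx fst_conv snd_conv by linarith
    also have "\<dots> = a * (ell + 2)" by (simp add: algebra_simps)
    also have "\<dots> \<le> a * (3 * exp (real j))"
    proof (rule mult_left_mono[OF _ a])
      show "ell + 2 \<le> 3 * exp (real j)" using j(2) le_exp_nat[of j] by linarith
    qed
    finally have n: "(norm (f x))\<^sup>2 \<le> (a * (3 * exp (real j)))\<^sup>2" by (intro power_mono) auto
    have "inverse ?r = exp ell / r\<^sub>0" unfolding r_eq by (simp add: exp_minus divide_inverse)
    also have "\<dots> \<le> exp 1 * exp (real j) / r\<^sub>0"
      using j(2) r0 by (intro divide_right_mono) (auto simp: mult_exp_exp add.commute)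
    finally have "11 * a / ?r \<le> 11 * a * (exp 1 * exp (real j) / r\<^sub>0)"
      unfolding divide_inverse[of "11 * a"] using a by (intro mult_left_mono) auto
    then have p: "(11 * a / ?r)\<^sup>2 \<le> (11 * a * (exp 1 * exp (real j) / r\<^sub>0))\<^sup>2"
      using a r by (intro power_mono) auto
    have "h1_density f x \<le> (a * (3 * exp (real j)))\<^sup>2 + 2 * (11 * a * (exp 1 * exp (real j) / r\<^sub>0))\<^sup>2"
      using h1_density_le[OF db] n p by linarith
    also have "\<dots> = Q * (A / L)\<^sup>2 * (exp (real j))\<^sup>2"
      by (simp add: Q_def a_def power_mult_distrib power_divide algebra_simps)
    finally have "h1_density f x \<le> Q * (A / L)\<^sup>2 * (exp (real j))\<^sup>2" .
    moreover have "?r \<le> r\<^sub>0 * exp (- real j)" unfolding r_eq using j(1) r0 by simp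
    ultimately show ?thesis using jL by (intro disjI2 exI[of _ j]) simp
  qed
qed

text \<open>A translate of a disk meets the cell in at most four of its lattice copies.\<close>

lemma wrap1_small_cover:
  fixes a c :: real
  assumes "0 \<le> a" "a < 2*pi"
  defines "k\<^sub>0 \<equiv> \<lfloor>(pi - c) / (2*pi)\<rfloor>"
  shows "\<exists>k\<in>{k\<^sub>0, k\<^sub>0 + 1}. wrap1 (a - c) = a - (c + 2*pi * real_of_int k)"
proof -
  define k where "k = \<lfloor>(a - c + pi) / (2*pi)\<rfloor>"
  have "wrap1 (a - c) = a - (c + 2*pi * real_of_int k)"
    by (simp add: wrap1_def k_def)
  moreover have "(pi - c) / (2*pi) \<le> (a - c + pi) / (2*pi)"
    using assms by (intro divide_right_mono) auto
  then have "k\<^sub>0 \<le> k" unfolding k_def k\<^sub>0_def by (rule floor_mono)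
  moreover have "(a - c + pi) / (2*pi) < (pi - c) / (2*pi) + 1"
    using assms by (simp add: field_simps)
  then have "k < k\<^sub>0 + 2" unfolding k_def k\<^sub>0_def by linarith
  ultimately show ?thesis by (intro bexI[of _ k]) auto
qed

definition lattice_square :: "plane \<Rightarrow> real \<Rightarrow> int \<times> int \<Rightarrow> plane set" where
  "lattice_square c \<rho> k =
     {fst c + 2*pi * real_of_int (fst k) - \<rho> .. fst c + 2*pi * real_of_int (fst k) + \<rho>} \<times>
     {snd c + 2*pi * real_of_int (snd k) - \<rho> .. snd c + 2*pi * real_of_int (snd k) + \<rho>}"

definition lattice_window :: "plane \<Rightarrow> (int \<times> int) set" where
  "lattice_window c = {\<lfloor>(pi - fst c) / (2*pi)\<rfloor>, \<lfloor>(pi - fst c) / (2*pi)\<rfloor> + 1}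
     \<times> {\<lfloor>(pi - snd c) / (2*pi)\<rfloor>, \<lfloor>(pi - snd c) / (2*pi)\<rfloor> + 1}"

lemma finite_lattice_window [simp]: "finite (lattice_window c)"
  and card_lattice_window: "card (lattice_window c) = 4"
  by (simp_all add: lattice_window_def card_cartesian_product)

lemma wrap_small_cover:
  assumes "x \<in> space torus" "norm (wrap (x - c)) \<le> \<rho>"
  shows "\<exists>k\<in>lattice_window c. x \<in> lattice_square c \<rho> k"
proof -
  have x: "0 \<le> fst x" "fst x < 2*pi" "0 \<le> snd x" "snd x < 2*pi"
    using assms(1) by (auto simp: space_torus)
  obtain k l where k: "k \<in> {\<lfloor>(pi - fst c) / (2*pi)\<rfloor>, \<lfloor>(pi - fst c) / (2*pi)\<rfloor> + 1}"
      "wrap1 (fst x - fst c) = fst x - (fst c + 2*pi * real_of_int k)"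
    and l: "l \<in> {\<lfloor>(pi - snd c) / (2*pi)\<rfloor>, \<lfloor>(pi - snd c) / (2*pi)\<rfloor> + 1}"
      "wrap1 (snd x - snd c) = snd x - (snd c + 2*pi * real_of_int l)"
    using wrap1_small_cover[OF x(1,2), of "fst c"] wrap1_small_cover[OF x(3,4), of "snd c"] by blast
  have "\<bar>wrap1 (fst x - fst c)\<bar> \<le> \<rho>" "\<bar>wrap1 (snd x - snd c)\<bar> \<le> \<rho>"
    using assms(2) abs_fst_le_norm[of "wrap (x - c)"] abs_snd_le_norm[of "wrap (x - c)"]
    by (auto simp: wrap_eq_wrap1)
  then have "x \<in> lattice_square c \<rho> (k, l)"
    unfolding k(2) l(2) lattice_square_def by (auto simp: mem_Times_iff)
  moreover have "(k, l) \<in> lattice_window c" unfolding lattice_window_def using k(1) l(1) by blast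
  ultimately show ?thesis by blast
qed

lemma lattice_square_measure:
  assumes "\<rho> \<ge> 0"
  shows "integrable torus (\<lambda>x. indicator (lattice_square c \<rho> k) x :: real)"
    "(\<integral>x. indicator (lattice_square c \<rho> k) x \<partial>torus) \<le> 4 * \<rho>\<^sup>2"
proof -
  let ?S = "lattice_square c \<rho> k"
  have S: "?S = cbox (fst c + 2*pi * real_of_int (fst k) - \<rho>, snd c + 2*pi * real_of_int (snd k) - \<rho>)
     (fst c + 2*pi * real_of_int (fst k) + \<rho>, snd c + 2*pi * real_of_int (snd k) + \<rho>)"
    by (simp add: lattice_square_def cbox_Pair_eq)
  have b: "?S \<in> sets borel" unfolding S by simp
  then have m: "(\<lambda>x. indicator ?S x :: real) \<in> borel_measurable torus"
    by (intro borel_measurable_torus borel_measurable_indicator) simp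
  show "integrable torus (\<lambda>x. indicator ?S x :: real)"
    by (rule torus.integrable_const_bound[of _ 1]) (use m in auto)
  have "emeasure lborel ?S = ennreal (4 * \<rho>\<^sup>2)"
    unfolding S using assms
    by (subst emeasure_lborel_cbox) (auto simp: Basis_prod_def inner_prod_def prod.union_disjoint
        prod.insert power2_eq_square)
  moreover have "(\<integral>\<^sup>+x. ennreal (indicator ?S x) \<partial>torus) \<le> emeasure lborel ?S"
  proof -
    have "(\<integral>\<^sup>+x. ennreal (indicator ?S x) \<partial>torus)
        = (\<integral>\<^sup>+x. ennreal (indicator ?S x) * indicator ({0..<2*pi} \<times> {0..<2*pi}) x \<partial>lborel)"
      unfolding torus_def by (subst nn_integral_restrict_space) auto
    also have "\<dots> \<le> (\<integral>\<^sup>+x. indicator ?S x \<partial>lborel)"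
      by (intro nn_integral_mono) (auto simp: indicator_def)
    also have "\<dots> = emeasure lborel ?S" using b by simp
    finally show ?thesis .
  qed
  ultimately have "(\<integral>\<^sup>+x. ennreal (indicator ?S x) \<partial>torus) \<le> ennreal (4 * \<rho>\<^sup>2)" by simp
  then show "(\<integral>x. indicator ?S x \<partial>torus) \<le> 4 * \<rho>\<^sup>2"
    by (intro integral_real_bounded) auto
qed


text \<open>The density \<open>e\<^sup>2\<^sup>j\<close> of the shell \<open>j\<close> cancels its area, so the sum over the shells is
  \<open>(A/L)\<^sup>2\<close> times their number, which is at most \<open>2L\<close>.\<close>

lemma vortex_energy_bound:
  fixes c :: plane
  assumes r0: "0 < r\<^sub>0" "r\<^sub>0 < pi" and \<Theta>: "cutoff_profile \<Theta>"
    and C: "C \<ge> 1" "\<And>z. \<bar>deriv \<Theta> z\<bar> \<le> C" "\<And>z. \<bar>deriv (deriv \<Theta>) z\<bar> \<le> C"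
      "\<forall>z\<in>{0..1}. \<Theta> z \<le> C * z"
    and L: "L \<ge> 1" and A: "A \<ge> 0"
  defines "f \<equiv> \<lambda>x. vortex r\<^sub>0 \<Theta> A L (wrap (x - c))"
  defines "Q \<equiv> C\<^sup>2 * (9 + 242 * (exp 1)\<^sup>2 / r\<^sub>0\<^sup>2)"
  shows "(\<integral>x. h1_density f x \<partial>torus) \<le> 32 * Q * r\<^sub>0\<^sup>2 * (A\<^sup>2 / L)"
proof -
  let ?J = "nat \<lfloor>L\<rfloor>" and ?\<rho> = "\<lambda>j. r\<^sub>0 * exp (- real j)"
  let ?h = "\<lambda>j x. \<Sum>k\<in>lattice_window c. indicator (lattice_square c (?\<rho> j) k) x :: real"
  let ?G = "\<lambda>x. \<Sum>j\<le>?J. Q * (A / L)\<^sup>2 * (exp (real j))\<^sup>2 * ?h j x"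
  have Q: "Q \<ge> 0" by (simp add: Q_def)
  have G0: "?G x \<ge> 0" for x using Q by (intro sum_nonneg mult_nonneg_nonneg) auto
  have le: "h1_density f x \<le> ?G x" if x: "x \<in> space torus" for x
    using vortex_density_bound[OF r0 \<Theta> C L A, where x = x and c = c]
  proof (elim disjE exE conjE)
    assume "h1_density (\<lambda>x. vortex r\<^sub>0 \<Theta> A L (wrap (x - c))) x \<le> 0"
    then show ?thesis using G0[of x] by (simp add: f_def)
  next
    fix j assume j: "j \<le> ?J" "norm (wrap (x - c)) \<le> ?\<rho> j"
      and d: "h1_density (\<lambda>x. vortex r\<^sub>0 \<Theta> A L (wrap (x - c))) x
        \<le> C\<^sup>2 * (9 + 242 * (exp 1)\<^sup>2 / r\<^sub>0\<^sup>2) * (A / L)\<^sup>2 * (exp (real j))\<^sup>2"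
    from wrap_small_cover[OF x j(2)] obtain k
      where k: "k \<in> lattice_window c" "x \<in> lattice_square c (?\<rho> j) k" by blast
    have "1 \<le> ?h j x"
      using member_le_sum[OF k(1), of "\<lambda>k. indicator (lattice_square c (?\<rho> j) k) x :: real"] k(2) by simp
    then have "Q * (A / L)\<^sup>2 * (exp (real j))\<^sup>2 * 1 \<le> Q * (A / L)\<^sup>2 * (exp (real j))\<^sup>2 * ?h j x"
      using Q by (intro mult_left_mono) auto
    also have "\<dots> \<le> ?G x"
      using j(1) Q
      by (intro member_le_sum[of j "{..?J}" "\<lambda>j. Q * (A / L)\<^sup>2 * (exp (real j))\<^sup>2 * ?h j x"]
          mult_nonneg_nonneg sum_nonneg) auto
    finally show ?thesis using d by (simp add: f_def Q_def)
  qed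
  note sq = lattice_square_measure[of "?\<rho> _" c]
  have \<rho>: "?\<rho> j \<ge> 0" for j using r0 by simp
  have hint: "integrable torus (?h j)" for j
    by (intro Bochner_Integration.integrable_sum sq \<rho>)
  have hle: "(\<integral>x. ?h j x \<partial>torus) \<le> 16 * (?\<rho> j)\<^sup>2" for j
  proof -
    have "(\<integral>x. ?h j x \<partial>torus) = (\<Sum>k\<in>lattice_window c. \<integral>x. indicator (lattice_square c (?\<rho> j) k) x \<partial>torus)"
      by (intro Bochner_Integration.integral_sum sq \<rho>)
    also have "\<dots> \<le> (\<Sum>k\<in>lattice_window c. 4 * (?\<rho> j)\<^sup>2)" by (intro sum_mono sq \<rho>)
    finally show ?thesis by (simp add: card_lattice_window)
  qed
  have "(\<integral>x. h1_density f x \<partial>torus) \<le> (\<integral>x. ?G x \<partial>torus)"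
    by (intro integral_mono' le G0 Bochner_Integration.integrable_sum integrable_mult_right hint)
  also have "\<dots> = (\<Sum>j\<le>?J. Q * (A / L)\<^sup>2 * (exp (real j))\<^sup>2 * (\<integral>x. ?h j x \<partial>torus))"
    by (subst Bochner_Integration.integral_sum) (intro integrable_mult_right hint, simp)
  also have "\<dots> \<le> (\<Sum>j\<le>?J. Q * (A / L)\<^sup>2 * (exp (real j))\<^sup>2 * (16 * (?\<rho> j)\<^sup>2))"
    using Q by (intro sum_mono mult_left_mono hle) auto
  also have "\<dots> = (\<Sum>j\<le>?J. 16 * Q * r\<^sub>0\<^sup>2 * (A / L)\<^sup>2)"
    by (intro sum.cong refl) (simp add: power_mult_distrib exp_minus field_simps)
  also have "\<dots> = 16 * Q * r\<^sub>0\<^sup>2 * (A / L)\<^sup>2 * (real ?J + 1)" by simp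
  also have "\<dots> \<le> 16 * Q * r\<^sub>0\<^sup>2 * (A / L)\<^sup>2 * (2 * L)"
    using Q L by (intro mult_left_mono) (auto, linarith)
  also have "\<dots> = 32 * Q * r\<^sub>0\<^sup>2 * (A\<^sup>2 / L)"
    using L by (simp add: power2_eq_square)
  finally show ?thesis .
qed

lemma amp_sq_div_len_le:
  assumes \<sigma>: "\<sigma> > 0" and t: "t \<ge> 0"
  shows "(amp \<sigma> n t)\<^sup>2 / len \<sigma> n t \<le> 1"
    and "\<tau> > 0 \<Longrightarrow> \<tau> \<le> t \<Longrightarrow> n \<ge> 1 \<Longrightarrow> (amp \<sigma> n t)\<^sup>2 / len \<sigma> n t \<le> (1 + 2 / (\<sigma> * \<tau>))\<^sup>2 / real n"
proof -
  have td: "t > - delta n" using t delta_pos[of n] by linarith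
  note l1 = len_ge_1[OF \<sigma> td] and a1 = amp_ge_1[OF \<sigma> td]
  show "(amp \<sigma> n t)\<^sup>2 / len \<sigma> n t \<le> 1"
    using l1 by (subst divide_le_eq_1_pos) (auto simp: len_def)
  assume \<tau>: "\<tau> > 0" "\<tau> \<le> t" and n: "n \<ge> 1"
  have "2 / (\<sigma> * (t + delta n)) \<le> 2 / (\<sigma> * \<tau>)"
    using \<tau> \<sigma> delta_pos[of n] by (intro divide_left_mono mult_left_mono mult_pos_pos) auto
  then have "(amp \<sigma> n t)\<^sup>2 \<le> (1 + 2 / (\<sigma> * \<tau>))\<^sup>2"
    using a1 by (intro power_mono) (auto simp: amp_def)
  then show "(amp \<sigma> n t)\<^sup>2 / len \<sigma> n t \<le> (1 + 2 / (\<sigma> * \<tau>))\<^sup>2 / real n"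
    using n by (intro frac_le) (auto simp: len_def)
qed

lemma L2H1_norm_eq:
  "L2H1_norm T u = sqrt (\<integral>t. indicator {0..T} t * (\<integral>x. h1_density (u t) x \<partial>torus) \<partial>lborel)"
  by (simp add: L2H1_norm_def set_lebesgue_integral_def h1_density_def)

text \<open>The spatial energy at time \<open>t\<close> is at most a multiple of \<open>A\<^sub>n\<^sup>2/(n + A\<^sub>n\<^sup>2)\<close>. It is bounded by \<open>1\<close>
  near \<open>t = 0\<close>, where \<open>A\<^sub>n\<close> is large, and by a multiple of \<open>1/n\<close> after a fixed time \<open>\<tau>\<close>.\<close>

lemma u_seq_L2H1_small:
  assumes T: "T > 0" and \<sigma>: "\<sigma> > 0" and r0: "0 < r\<^sub>0" "r\<^sub>0 < pi" and \<Theta>: "cutoff_profile \<Theta>"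
    and e: "e > 0"
  shows "\<forall>\<^sub>F n in sequentially. L2H1_norm T (u_seq \<sigma> r\<^sub>0 \<Theta> x\<^sub>0 n) < e"
proof -
  obtain C where C: "C \<ge> 1" "\<And>z. \<bar>deriv \<Theta> z\<bar> \<le> C" "\<And>z. \<bar>deriv (deriv \<Theta>) z\<bar> \<le> C"
    "\<forall>z\<in>{0..1}. \<Theta> z \<le> C * z" using cutoff_profile_bounds[OF \<Theta>] by blast
  define K where "K = 32 * (C\<^sup>2 * (9 + 242 * (exp 1)\<^sup>2 / r\<^sub>0\<^sup>2)) * r\<^sub>0\<^sup>2"
  have K: "K > 0"
    unfolding K_def using C(1) r0 by (intro mult_pos_pos add_pos_nonneg) auto
  define \<tau> where "\<tau> = min T (e\<^sup>2 / (4 * K))"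
  have \<tau>: "\<tau> > 0" "\<tau> \<le> T" "K * \<tau> \<le> e\<^sup>2 / 4"
    using T e K by (auto simp: \<tau>_def min_def field_simps)
  define D where "D = (1 + 2 / (\<sigma> * \<tau>))\<^sup>2"
  have small: "L2H1_norm T (u_seq \<sigma> r\<^sub>0 \<Theta> x\<^sub>0 n) < e" if n: "n \<ge> 1" "K * D * T / real n < e\<^sup>2 / 4" for n
  proof -
    let ?g = "\<lambda>t. K * indicator {0..\<tau>} t + K * D / real n * indicator {0..T} t :: real"
    have dens: "(\<integral>x. h1_density (u_seq \<sigma> r\<^sub>0 \<Theta> x\<^sub>0 n t) x \<partial>torus) \<le> K * ((amp \<sigma> n t)\<^sup>2 / len \<sigma> n t)"
      if t: "t \<ge> 0" for t
    proof -
      have td: "t > - delta n" using t delta_pos[of n] by linarith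
      have u: "u_seq \<sigma> r\<^sub>0 \<Theta> x\<^sub>0 n t = (\<lambda>x. vortex r\<^sub>0 \<Theta> (amp \<sigma> n t) (len \<sigma> n t) (wrap (x - (x\<^sub>0 + t *\<^sub>R w_dir))))"
        by (simp add: u_seq_def fun_eq_iff)
      show ?thesis
        unfolding u K_def using amp_ge_1[OF \<sigma> td]
        by (intro vortex_energy_bound[OF r0 \<Theta> C len_ge_1[OF \<sigma> td]]) auto
    qed
    have le: "indicator {0..T} t * (\<integral>x. h1_density (u_seq \<sigma> r\<^sub>0 \<Theta> x\<^sub>0 n t) x \<partial>torus) \<le> ?g t" for t
    proof (cases "t \<in> {0..T}")
      case True
      have "K * ((amp \<sigma> n t)\<^sup>2 / len \<sigma> n t) \<le> ?g t"
      proof (cases "t \<le> \<tau>")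
        case le: True
        have "K * ((amp \<sigma> n t)\<^sup>2 / len \<sigma> n t) \<le> K * 1"
          using True K by (intro mult_left_mono amp_sq_div_len_le(1) \<sigma>) auto
        moreover have "0 \<le> K * D / real n" using K by (simp add: D_def)
        ultimately show ?thesis using le True by simp
      next
        case False
        have "K * ((amp \<sigma> n t)\<^sup>2 / len \<sigma> n t) \<le> K * (D / real n)"
          unfolding D_def using True False K \<tau> n by (intro mult_left_mono amp_sq_div_len_le(2) \<sigma>) auto
        then show ?thesis using True False by simp
      qed
      then show ?thesis using dens[of t] True by simp
    next
      case False
      moreover have "t \<notin> {0..\<tau>}" using False \<tau>(2) by auto
      ultimately show ?thesis by simp
    qed
    have ii: "integrable lborel (\<lambda>t. indicator {a..b} t :: real)" for a b :: real
      by (rule integrable_real_indicator) (auto simp: emeasure_lborel_Icc_eq)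
    have gi: "integrable lborel ?g"
      by (intro Bochner_Integration.integrable_add integrable_mult_right ii)
    have "0 \<le> K * D / real n" using K by (simp add: D_def)
    then have g0: "0 \<le> ?g t" for t using K by (intro add_nonneg_nonneg mult_nonneg_nonneg) auto
    have "(\<integral>t. indicator {0..T} t * (\<integral>x. h1_density (u_seq \<sigma> r\<^sub>0 \<Theta> x\<^sub>0 n t) x \<partial>torus) \<partial>lborel)
        \<le> (\<integral>t. ?g t \<partial>lborel)"
      by (rule integral_mono'[OF gi le g0])
    also have "\<dots> = K * \<tau> + K * D / real n * T"
      using \<tau> T by (subst Bochner_Integration.integral_add[OF integrable_mult_right[OF ii]
          integrable_mult_right[OF ii]]) simp
    also have "K * D / real n * T = K * D * T / real n" by simp
    also have "K * \<tau> + K * D * T / real n < e\<^sup>2"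
      using \<tau>(3) n(2) zero_less_power[OF e, of 2] by linarith
    finally have "L2H1_norm T (u_seq \<sigma> r\<^sub>0 \<Theta> x\<^sub>0 n) < sqrt (e\<^sup>2)"
      unfolding L2H1_norm_eq by (rule real_sqrt_less_mono)
    then show ?thesis using e by simp
  qed
  have "(\<lambda>n. K * D * T / real n) \<longlonglongrightarrow> 0" by (rule lim_const_over_n)
  then have "\<forall>\<^sub>F n in sequentially. K * D * T / real n < e\<^sup>2 / 4"
    by (rule order_tendstoD) (use e in simp)
  with eventually_ge_at_top[of 1] show ?thesis
    by eventually_elim (rule small)
qed

section \<open>Integration by parts on the torus\<close>

lemma torus_integral_eq:
  fixes f :: "plane \<Rightarrow> real"
  assumes f: "continuous_on UNIV f"
  shows "(\<integral>x. f x \<partial>torus) = integral (cbox (0, 0) (2*pi, 2*pi)) f"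
proof -
  let ?C = "{0..<2*pi} \<times> {0..<2*pi} :: plane set"
  have "integrable torus f" by (rule continuous_integrable_torus[OF f])
  then have si: "set_integrable lborel ?C f"
    unfolding torus_def set_integrable_def by (subst (asm) integrable_restrict_space) auto
  have "(\<integral>x. f x \<partial>torus) = (LINT x:?C|lborel. f x)"
    unfolding torus_def set_lebesgue_integral_def by (subst integral_restrict_space) auto
  also have "\<dots> = integral ?C f" by (rule set_borel_integral_eq_integral(2)[OF si])
  also have "\<dots> = integral (cbox (0, 0) (2*pi, 2*pi)) f"
  proof (rule integral_spike_set)
    have "box (0, 0) (2*pi, 2*pi) \<subseteq> ?C" "?C \<subseteq> cbox (0, 0) (2*pi, 2*pi)"
      by (auto simp: box_def cbox_Pair_eq Basis_prod_def)
    then have "?C - cbox (0, 0) (2*pi, 2*pi) = {}"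
      "cbox (0, 0) (2*pi, 2*pi) - ?C \<subseteq> cbox (0, 0) (2*pi, 2*pi) - box (0, 0) (2*pi, 2*pi)" by blast+
    then show "negligible {x \<in> ?C - cbox (0, 0) (2*pi, 2*pi). f x \<noteq> 0}"
      "negligible {x \<in> cbox (0, 0) (2*pi, 2*pi) - ?C. f x \<noteq> 0}"
      by (auto intro: negligible_subset[OF negligible_frontier_interval])
  qed
  finally show ?thesis .
qed

lemma torus_integral_iterated:
  fixes f :: "plane \<Rightarrow> real"
  assumes f: "continuous_on UNIV f"
  shows "(\<integral>x. f x \<partial>torus) = integral {0..2*pi} (\<lambda>x. integral {0..2*pi} (\<lambda>y. f (x, y)))"
  unfolding torus_integral_eq[OF f]
  using integral_prod_continuous[OF continuous_on_subset[OF f subset_UNIV], of 0 0 "2*pi" "2*pi"] by simp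

lemma torus_integral_iterated_swap:
  fixes f :: "plane \<Rightarrow> real"
  assumes f: "continuous_on UNIV f"
  shows "(\<integral>x. f x \<partial>torus) = integral {0..2*pi} (\<lambda>y. integral {0..2*pi} (\<lambda>x. f (x, y)))"
proof -
  have "continuous_on (cbox (0, 0) (2*pi, 2*pi)) (\<lambda>(x, y). f (x, y))"
    using continuous_on_subset[OF f subset_UNIV] by simp
  from integral_swap_continuous[of 0 0 "2*pi" "2*pi" "\<lambda>x y. f (x, y)", OF this]
  show ?thesis unfolding torus_integral_iterated[OF f] by simp
qed

lemma integral_derivative_periodic:
  fixes f f' :: "real \<Rightarrow> real"
  assumes "\<And>x. (f has_real_derivative f' x) (at x)" "f (2*pi) = f 0"
  shows "integral {0..2*pi} f' = 0"
proof -
  have "(f' has_integral f (2*pi) - f 0) {0..2*pi}"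
    using assms(1)
    by (intro fundamental_theorem_of_calculus)
      (auto simp: has_real_derivative_iff_has_vector_derivative[symmetric] intro: has_field_derivative_at_within)
  then show ?thesis using assms(2) by (simp add: integral_unique)
qed

lemma periodic_boundary:
  "periodic f \<Longrightarrow> f (2*pi, y) = f (0, y)" "periodic f \<Longrightarrow> f (x, 2*pi) = f (x, 0)"
  unfolding periodic_def by (metis add_0)+

lemma torus_integral_partial1:
  assumes "continuous_on UNIV f'" "periodic f"
    "\<And>x y. ((\<lambda>s. f (s, y)) has_real_derivative f' (x, y)) (at x)"
  shows "(\<integral>x. f' x \<partial>torus) = 0"
proof -
  have "integral {0..2*pi} (\<lambda>x. f' (x, y)) = 0" for y
    by (rule integral_derivative_periodic[OF assms(3)]) (rule periodic_boundary[OF assms(2)])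
  then show ?thesis unfolding torus_integral_iterated_swap[OF assms(1)] by simp
qed

lemma torus_integral_partial2:
  assumes "continuous_on UNIV f'" "periodic f"
    "\<And>x y. ((\<lambda>s. f (x, s)) has_real_derivative f' (x, y)) (at y)"
  shows "(\<integral>x. f' x \<partial>torus) = 0"
proof -
  have "integral {0..2*pi} (\<lambda>y. f' (x, y)) = 0" for x
    by (rule integral_derivative_periodic[OF assms(3)]) (rule periodic_boundary[OF assms(2)])
  then show ?thesis unfolding torus_integral_iterated[OF assms(1)] by simp
qed

lemma test_fun_partials:
  assumes "test_fun \<phi>"
  shows "continuous_on UNIV \<phi>" "periodic \<phi>" "continuous_on UNIV (pd1 \<phi>)" "continuous_on UNIV (pd2 \<phi>)"
    and "((\<lambda>s. \<phi> (s, y)) has_real_derivative pd1 \<phi> (x, y)) (at x)"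
    and "((\<lambda>s. \<phi> (x, s)) has_real_derivative pd2 \<phi> (x, y)) (at y)"
proof -
  have ck: "Ck_on (Suc 0) UNIV \<phi>" "Ck_on 0 UNIV \<phi>" and p: "periodic \<phi>"
    using assms unfolding test_fun_def smooth_on_def by blast+
  from ck(2) show "continuous_on UNIV \<phi>" by simp
  show "periodic \<phi>" by (rule p)
  obtain f' where F: "\<forall>x\<in>UNIV. (\<phi> has_derivative f' x) (at x)" "\<forall>v. Ck_on 0 UNIV (\<lambda>x. f' x v)"
    using ck(1) unfolding Ck_on.simps(2) by blast
  have D: "(\<phi> has_derivative f' x) (at x)" for x using F(1) by blast
  have pd: "pd1 \<phi> = (\<lambda>x. f' x (1, 0))" "pd2 \<phi> = (\<lambda>x. f' x (0, 1))"
    by (simp_all add: fun_eq_iff pd1_def pd2_def frechet_derivative_at[OF D, symmetric])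
  show "continuous_on UNIV (pd1 \<phi>)" "continuous_on UNIV (pd2 \<phi>)"
    unfolding pd using F(2) by auto
  have lin: "linear (f' x)" for x by (rule has_derivative_linear[OF D])
  have "((\<lambda>s. (s, y)) has_derivative (\<lambda>v. (v, 0))) (at x)"
    by (auto intro!: derivative_eq_intros)
  from has_derivative_compose[OF this D]
  have "((\<lambda>s. \<phi> (s, y)) has_derivative (\<lambda>v. f' (x, y) (v, 0))) (at x)" .
  moreover have "f' (x, y) (v, 0) = pd1 \<phi> (x, y) * v" for v
    using linear_scale[OF lin[of "(x, y)"], of v "(1, 0)"] by (simp add: pd mult.commute)
  ultimately show "((\<lambda>s. \<phi> (s, y)) has_real_derivative pd1 \<phi> (x, y)) (at x)"
    by (simp only: has_field_derivative_def)
  have "((\<lambda>s. (x, s)) has_derivative (\<lambda>v. (0, v))) (at y)"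
    by (auto intro!: derivative_eq_intros)
  from has_derivative_compose[OF this D]
  have "((\<lambda>s. \<phi> (x, s)) has_derivative (\<lambda>v. f' (x, y) (0, v))) (at y)" .
  moreover have "f' (x, y) (0, v) = pd2 \<phi> (x, y) * v" for v
    using linear_scale[OF lin[of "(x, y)"], of v "(0, 1)"] by (simp add: pd mult.commute)
  ultimately show "((\<lambda>s. \<phi> (x, s)) has_real_derivative pd2 \<phi> (x, y)) (at y)"
    by (simp only: has_field_derivative_def)
qed

text \<open>A function together with its two partial derivatives, which appear as data so that weak
  derivatives can be read off.\<close>

definition C1_periodic :: "(plane \<Rightarrow> real) \<Rightarrow> (plane \<Rightarrow> real) \<Rightarrow> (plane \<Rightarrow> real) \<Rightarrow> bool" where
  "C1_periodic f f1 f2 \<longleftrightarrow> periodic f \<and> continuous_on UNIV f \<and> continuous_on UNIV f1 \<and> continuous_on UNIV f2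
     \<and> (\<forall>x y. ((\<lambda>s. f (s, y)) has_real_derivative f1 (x, y)) (at x))
     \<and> (\<forall>x y. ((\<lambda>s. f (x, s)) has_real_derivative f2 (x, y)) (at y))"

text \<open>The derivative of the product \<open>\<phi>f\<close> integrates to zero along every closed coordinate circle.\<close>

lemma torus_by_parts:
  assumes \<phi>: "test_fun \<phi>" and f: "C1_periodic f f1 f2"
  shows "(\<integral>x. \<phi> x * f1 x \<partial>torus) = - (\<integral>x. f x * pd1 \<phi> x \<partial>torus)"
    "(\<integral>x. \<phi> x * f2 x \<partial>torus) = - (\<integral>x. f x * pd2 \<phi> x \<partial>torus)"
proof -
  note t = test_fun_partials[OF \<phi>]
  have c: "continuous_on UNIV f" "continuous_on UNIV f1" "continuous_on UNIV f2" and p: "periodic f"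
    using f by (auto simp: C1_periodic_def)
  have per: "periodic (\<lambda>x. \<phi> x * f x)" using t(2) p by (simp add: periodic_def)
  have ii: "integrable torus (\<lambda>x. \<phi> x * f1 x)" "integrable torus (\<lambda>x. f x * pd1 \<phi> x)"
    "integrable torus (\<lambda>x. \<phi> x * f2 x)" "integrable torus (\<lambda>x. f x * pd2 \<phi> x)"
    by (intro continuous_integrable_torus continuous_intros c t)+
  have "((\<lambda>s. \<phi> (s, y) * f (s, y)) has_real_derivative \<phi> (x, y) * f1 (x, y) + f (x, y) * pd1 \<phi> (x, y)) (at x)" for x y
    using DERIV_mult[OF t(5)[of y x], of "\<lambda>s. f (s, y)" "f1 (x, y)"] f
    by (simp add: C1_periodic_def algebra_simps)
  moreover have "continuous_on UNIV (\<lambda>x. \<phi> x * f1 x + f x * pd1 \<phi> x)"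
    by (intro continuous_intros c t)
  ultimately have "(\<integral>x. \<phi> x * f1 x + f x * pd1 \<phi> x \<partial>torus) = 0"
    by (intro torus_integral_partial1[OF _ per])
  then show "(\<integral>x. \<phi> x * f1 x \<partial>torus) = - (\<integral>x. f x * pd1 \<phi> x \<partial>torus)"
    using ii by simp
  have "((\<lambda>s. \<phi> (x, s) * f (x, s)) has_real_derivative \<phi> (x, y) * f2 (x, y) + f (x, y) * pd2 \<phi> (x, y)) (at y)" for x y
    using DERIV_mult[OF t(6)[of x y], of "\<lambda>s. f (x, s)" "f2 (x, y)"] f
    by (simp add: C1_periodic_def algebra_simps)
  moreover have "continuous_on UNIV (\<lambda>x. \<phi> x * f2 x + f x * pd2 \<phi> x)"
    by (intro continuous_intros c t)
  ultimately have "(\<integral>x. \<phi> x * f2 x + f x * pd2 \<phi> x \<partial>torus) = 0"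
    by (intro torus_integral_partial2[OF _ per])
  then show "(\<integral>x. \<phi> x * f2 x \<partial>torus) = - (\<integral>x. f x * pd2 \<phi> x \<partial>torus)"
    using ii by simp
qed

lemma integral_rep_abs:
  fixes f :: "plane \<Rightarrow> 'b::euclidean_space" and F :: "plane \<Rightarrow> 'b \<Rightarrow> 'c::euclidean_space"
  assumes f: "continuous_on UNIV f" and F: "continuous_on UNIV (\<lambda>z. F (fst z) (snd z))"
  shows "(\<integral>x. F x (rep_L2 (abs_L2 f) x) \<partial>torus) = (\<integral>x. F x (f x) \<partial>torus)"
proof (rule integral_cong_AE)
  have Fm: "(\<lambda>z. F (fst z) (snd z)) \<in> borel_measurable borel"
    by (rule borel_measurable_continuous_onI[OF F])
  have id: "(\<lambda>x. x) \<in> borel_measurable torus" by (rule borel_measurable_torus) simp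
  have r: "rep_L2 (abs_L2 f) \<in> borel_measurable torus"
    using rep_L2_sq[of "abs_L2 f"] by (simp add: sq_integrable_def)
  have "(\<lambda>x. (x, rep_L2 (abs_L2 f) x)) \<in> torus \<rightarrow>\<^sub>M borel"
    using id r by (rule borel_measurable_Pair)
  from measurable_compose[OF this Fm]
  show "(\<lambda>x. F x (rep_L2 (abs_L2 f) x)) \<in> borel_measurable torus" by simp
  have "(\<lambda>x. (x, f x)) \<in> torus \<rightarrow>\<^sub>M borel"
    using id borel_measurable_torus[OF borel_measurable_continuous_onI[OF f]] by (rule borel_measurable_Pair)
  from measurable_compose[OF this Fm]
  show "(\<lambda>x. F x (f x)) \<in> borel_measurable torus" by simp
  show "AE x in torus. F x (rep_L2 (abs_L2 f) x) = F x (f x)"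
    by (rule AE_mp[OF rep_abs_L2_AE[OF continuous_sq_integrable[OF f]]]) simp
qed

lemma weak_grad_abs:
  assumes f: "C1_periodic f f1 f2"
  shows "weak_grad (abs_L2 f) (abs_L2 (\<lambda>x. (f1 x, f2 x)))"
  unfolding weak_grad_def
proof (intro allI impI)
  fix \<phi> assume \<phi>: "test_fun \<phi>"
  note t = test_fun_partials[OF \<phi>]
  have c: "continuous_on UNIV f" "continuous_on UNIV f1" "continuous_on UNIV f2"
    using f by (auto simp: C1_periodic_def)
  have "(\<integral>x. \<phi> x *\<^sub>R rep_L2 (abs_L2 (\<lambda>x. (f1 x, f2 x))) x \<partial>torus) = (\<integral>x. \<phi> x *\<^sub>R (f1 x, f2 x) \<partial>torus)"
    by (intro integral_rep_abs[where F = "\<lambda>x z. \<phi> x *\<^sub>R z"] continuous_intros c continuous_on_compose2[OF t(1)]) auto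
  moreover have "(\<integral>x. rep_L2 (abs_L2 f) x *\<^sub>R grad \<phi> x \<partial>torus) = (\<integral>x. f x *\<^sub>R grad \<phi> x \<partial>torus)"
    unfolding grad_def
    by (intro integral_rep_abs[where F = "\<lambda>x z. z *\<^sub>R (pd1 \<phi> x, pd2 \<phi> x)"] continuous_intros c
        continuous_on_compose2[OF t(3)] continuous_on_compose2[OF t(4)]) auto
  moreover have "(\<integral>x. \<phi> x *\<^sub>R (f1 x, f2 x) \<partial>torus) = - (\<integral>x. f x *\<^sub>R grad \<phi> x \<partial>torus)"
  proof -
    have i: "integrable torus (\<lambda>x. \<phi> x *\<^sub>R (f1 x, f2 x))" "integrable torus (\<lambda>x. f x *\<^sub>R grad \<phi> x)"
      unfolding grad_def by (intro continuous_integrable_torus continuous_intros c t)+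
    show ?thesis
      unfolding prod_eq_iff fst_uminus snd_uminus
        integral_bounded_linear[OF bounded_linear_fst i(1), symmetric]
        integral_bounded_linear[OF bounded_linear_snd i(1), symmetric]
        integral_bounded_linear[OF bounded_linear_fst i(2), symmetric]
        integral_bounded_linear[OF bounded_linear_snd i(2), symmetric]
      using torus_by_parts[OF \<phi> f] by (simp add: grad_def)
  qed
  ultimately show "(\<integral>x. \<phi> x *\<^sub>R rep_L2 (abs_L2 (\<lambda>x. (f1 x, f2 x))) x \<partial>torus)
      = - (\<integral>x. rep_L2 (abs_L2 f) x *\<^sub>R grad \<phi> x \<partial>torus)" by simp
qed

lemma weak_curl_abs:
  assumes e: "C1_periodic e e1 e2" and d: "C1_periodic d d1 d2"
  shows "weak_curl (abs_L2 (\<lambda>x. (e x, d x))) (abs_L2 (\<lambda>x. d1 x - e2 x))"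
  unfolding weak_curl_def
proof (intro allI impI)
  fix \<phi> assume \<phi>: "test_fun \<phi>"
  note t = test_fun_partials[OF \<phi>]
  have c: "continuous_on UNIV e" "continuous_on UNIV e2" "continuous_on UNIV d" "continuous_on UNIV d1"
    using e d by (auto simp: C1_periodic_def)
  have "(\<integral>x. \<phi> x * rep_L2 (abs_L2 (\<lambda>x. d1 x - e2 x)) x \<partial>torus) = (\<integral>x. \<phi> x * (d1 x - e2 x) \<partial>torus)"
    by (intro integral_rep_abs[where F = "\<lambda>x z. \<phi> x * z"] continuous_intros c continuous_on_compose2[OF t(1)]) auto
  moreover have "(\<integral>x. snd (rep_L2 (abs_L2 (\<lambda>x. (e x, d x))) x) * pd1 \<phi> x
        - fst (rep_L2 (abs_L2 (\<lambda>x. (e x, d x))) x) * pd2 \<phi> x \<partial>torus)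
      = (\<integral>x. snd (e x, d x) * pd1 \<phi> x - fst (e x, d x) * pd2 \<phi> x \<partial>torus)"
    by (intro integral_rep_abs[where F = "\<lambda>x z. snd z * pd1 \<phi> x - fst z * pd2 \<phi> x"] continuous_intros c
        continuous_on_compose2[OF t(3)] continuous_on_compose2[OF t(4)]) auto
  moreover have i: "integrable torus (\<lambda>x. \<phi> x * d1 x)" "integrable torus (\<lambda>x. \<phi> x * e2 x)"
    "integrable torus (\<lambda>x. d x * pd1 \<phi> x)" "integrable torus (\<lambda>x. e x * pd2 \<phi> x)"
    by (intro continuous_integrable_torus continuous_intros c t)+
  then have "(\<integral>x. \<phi> x * (d1 x - e2 x) \<partial>torus)
      = - (\<integral>x. snd (e x, d x) * pd1 \<phi> x - fst (e x, d x) * pd2 \<phi> x \<partial>torus)"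
    using torus_by_parts[OF \<phi> e] torus_by_parts[OF \<phi> d] by (simp add: right_diff_distrib)
  ultimately show "(\<integral>x. \<phi> x * rep_L2 (abs_L2 (\<lambda>x. d1 x - e2 x)) x \<partial>torus)
      = - (\<integral>x. snd (rep_L2 (abs_L2 (\<lambda>x. (e x, d x))) x) * pd1 \<phi> x
        - fst (rep_L2 (abs_L2 (\<lambda>x. (e x, d x))) x) * pd2 \<phi> x \<partial>torus)" by simp
qed

text \<open>Classical periodic fields lie in the domain of the generator, which acts on them by its
  differential expression.\<close>

lemma maxwell_ohm_abs:
  assumes e: "C1_periodic e e1 e2" and d: "C1_periodic d d1 d2" and b: "C1_periodic b b1 b2"
  shows "maxwell_ohm \<sigma> (abs_L2 (\<lambda>x. (e x, d x)), abs_L2 b)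
    (abs_L2 (\<lambda>x. (b2 x - \<sigma> * e x, - b1 x - \<sigma> * d x)), abs_L2 (\<lambda>x. e2 x - d1 x))"
proof -
  have c: "continuous_on UNIV e" "continuous_on UNIV e2" "continuous_on UNIV d" "continuous_on UNIV d1"
    "continuous_on UNIV b1" "continuous_on UNIV b2"
    using e d b by (auto simp: C1_periodic_def)
  let ?g = "\<lambda>x. (b1 x, b2 x)"
  have sq: "sq_integrable ?g" "sq_integrable (\<lambda>x. Rot (?g x))" "sq_integrable (\<lambda>x. (e x, d x))"
    "sq_integrable (\<lambda>x. \<sigma> *\<^sub>R (e x, d x))" "sq_integrable (\<lambda>x. d1 x - e2 x)"
    by (intro continuous_sq_integrable continuous_intros c)+
  have "abs_L2 (\<lambda>x. Rot (rep_L2 (abs_L2 ?g) x)) = abs_L2 (\<lambda>x. Rot (?g x))"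
  proof (rule abs_L2_eqI[OF _ sq(2)])
    have r: "rep_L2 (abs_L2 ?g) \<in> borel_measurable torus"
      using rep_L2_sq[of "abs_L2 ?g"] by (simp add: sq_integrable_def)
    have "Rot \<in> borel_measurable borel"
      by (intro borel_measurable_continuous_onI linear_continuous_on bounded_linear_Rot)
    from measurable_compose[OF r this]
    show "sq_integrable (\<lambda>x. Rot (rep_L2 (abs_L2 ?g) x))"
      by (rule sq_integrable_dominated[OF rep_L2_sq[of "abs_L2 ?g"], where C = 1]) simp
    show "AE x in torus. Rot (rep_L2 (abs_L2 ?g) x) = Rot (?g x)"
      by (rule AE_mp[OF rep_abs_L2_AE[OF sq(1)]]) simp
  qed
  then have "(abs_L2 (\<lambda>x. (b2 x - \<sigma> * e x, - b1 x - \<sigma> * d x)), abs_L2 (\<lambda>x. e2 x - d1 x))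
      = (abs_L2 (\<lambda>x. Rot (rep_L2 (abs_L2 ?g) x)) - \<sigma> *\<^sub>R fst (abs_L2 (\<lambda>x. (e x, d x)), abs_L2 b),
        - abs_L2 (\<lambda>x. d1 x - e2 x))"
    using sq by (simp add: abs_L2_scaleR abs_L2_diff abs_L2_uminus Rot_def)
  then show ?thesis
    unfolding maxwell_ohm_def using weak_grad_abs[OF b] weak_curl_abs[OF e d] by auto
qed

section \<open>Profiles on the circle\<close>

definition circle_norm :: "(real \<Rightarrow> real) \<Rightarrow> real" where
  "circle_norm f = sqrt (integral {0..2*pi} (\<lambda>x. (f x)\<^sup>2))"

text \<open>The integral over \<open>[a, a + 2\<pi>]\<close> has the derivative \<open>f(a + 2\<pi>) - f(a) = 0\<close> in \<open>a\<close>.\<close>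

lemma periodic_integral_shift:
  fixes f :: "real \<Rightarrow> real"
  assumes f: "continuous_on UNIV f" and p: "\<And>x. f (x + 2*pi) = f x"
  shows "integral {0..2*pi} (\<lambda>x. f (x - s)) = integral {0..2*pi} f"
proof -
  have fi: "f integrable_on {a..b}" for a b
    by (intro integrable_continuous_real continuous_on_subset[OF f]) auto
  define g where "g a = integral {a..a + 2*pi} f" for a
  have "(g has_real_derivative 0) (at a)" for a
  proof -
    define I where "I x = integral {a - 1..x} f" for x
    have DI: "(I has_real_derivative f x) (at x)" if x: "x > a - 1" for x
    proof -
      have "(I has_real_derivative f x) (at x within {a - 1..x + 1})"
        unfolding I_def using x
        by (intro integral_has_real_derivative continuous_on_subset[OF f]) auto
      then show ?thesis using x by (simp add: at_within_Icc_at)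
    qed
    have shift: "((\<lambda>x. x + 2*pi) has_real_derivative 1) (at a)"
      by (auto intro!: derivative_eq_intros)
    have "a - 1 < a + 2*pi" using pi_gt_zero by linarith
    from DERIV_diff[OF DERIV_chain2[OF DI[OF this] shift] DI[of a]]
    have "((\<lambda>x. I (x + 2*pi) - I x) has_real_derivative f (a + 2*pi) * 1 - f a) (at a)" by simp
    then have "((\<lambda>x. I (x + 2*pi) - I x) has_real_derivative 0) (at a)" by (simp add: p)
    then show ?thesis
    proof (rule has_field_derivative_transform_within[where d = 1])
      fix x assume "dist x a < 1"
      then have "a - 1 \<le> x" by (simp add: dist_real_def abs_less_iff)
      then have "I x + g x = I (x + 2*pi)"
        unfolding I_def g_def using pi_gt_zero by (intro Henstock_Kurzweil_Integration.integral_combine fi) auto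
      then show "I (x + 2*pi) - I x = g x" by simp
    qed simp_all
  qed
  then have "g (- s) = g 0" by (intro DERIV_isconst_all allI)
  moreover have "integral {0..2*pi} (\<lambda>x. f (x - s)) = g (- s)"
  proof -
    have "(f has_integral g (- s)) {0 + (- s)..2*pi + (- s)}"
      using integrable_integral[OF fi[of "- s" "- s + 2*pi"]] by (simp add: g_def add.commute)
    then have "((f \<circ> ((+) (- s))) has_integral g (- s)) {0..2*pi}"
      by (subst has_integral_shift_Icc_real)
    moreover have "f \<circ> ((+) (- s)) = (\<lambda>x. f (x - s))" by (auto simp: fun_eq_iff algebra_simps)
    ultimately show ?thesis by (simp add: integral_unique)
  qed
  ultimately show ?thesis by (simp add: g_def)
qed

lemma circle_norm_shift:
  assumes "continuous_on UNIV f" "\<And>x. f (x + 2*pi) = f x"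
  shows "circle_norm (\<lambda>x. f (x - s)) = circle_norm f"
  unfolding circle_norm_def
  using periodic_integral_shift[of "\<lambda>x. (f x)\<^sup>2" s] assms by (simp add: continuous_intros)

lemma circle_norm_nonneg: "continuous_on UNIV f \<Longrightarrow> circle_norm f \<ge> 0"
  unfolding circle_norm_def
  by (intro real_sqrt_ge_zero integral_nonneg integrable_continuous_real)
    (auto intro!: continuous_intros elim: continuous_on_subset)

lemma circle_norm_sq:
  "continuous_on UNIV f \<Longrightarrow> (circle_norm f)\<^sup>2 = integral {0..2*pi} (\<lambda>x. (f x)\<^sup>2)"
  unfolding circle_norm_def
  by (intro real_sqrt_pow2 integral_nonneg integrable_continuous_real)
    (auto intro!: continuous_intros elim: continuous_on_subset)

lemma circle_norm_pos:
  assumes f: "continuous_on UNIV f" and nz: "f 0 \<noteq> 0"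
  shows "circle_norm f > 0"
proof -
  have "integral {0..2*pi} (\<lambda>x. (f x)\<^sup>2) = 0 \<longleftrightarrow> (\<forall>x\<in>{0..2*pi}. (f x)\<^sup>2 = 0)"
    by (rule integral_eq_0_iff) (auto intro!: continuous_intros continuous_on_subset[OF f])
  moreover have "0 \<in> {0..2*pi}" by simp
  ultimately have "integral {0..2*pi} (\<lambda>x. (f x)\<^sup>2) \<noteq> 0" using nz by auto
  then show ?thesis
    using circle_norm_sq[OF f] circle_norm_nonneg[OF f] by (metis order_le_less zero_power2)
qed

lemma norm_abs_L2_product:
  assumes f: "continuous_on UNIV f" and g: "continuous_on UNIV g"
    and fp: "\<And>x. f (x + 2*pi) = f x" and gp: "\<And>x. g (x + 2*pi) = g x"
  shows "norm (abs_L2 (\<lambda>x :: plane. f (fst x - s) * g (snd x - s'))) = circle_norm f * circle_norm g"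
proof -
  have c1: "continuous_on UNIV (\<lambda>x :: plane. f (fst x - s))"
    by (intro continuous_on_compose2[OF f] continuous_intros) auto
  have c2: "continuous_on UNIV (\<lambda>x :: plane. g (snd x - s'))"
    by (intro continuous_on_compose2[OF g] continuous_intros) auto
  have c: "continuous_on UNIV (\<lambda>x :: plane. f (fst x - s) * g (snd x - s'))"
    by (intro continuous_intros c1 c2)
  have cf: "continuous_on UNIV (\<lambda>x. f (x - s))" "continuous_on UNIV (\<lambda>x. g (x - s'))"
    by (intro continuous_on_compose2[OF f] continuous_on_compose2[OF g] continuous_intros; simp)+
  have "(norm (abs_L2 (\<lambda>x :: plane. f (fst x - s) * g (snd x - s'))))\<^sup>2
      = (\<integral>x. (f (fst x - s) * g (snd x - s'))\<^sup>2 \<partial>torus)"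
    using norm_abs_L2[OF continuous_sq_integrable[OF c]] by simp
  also have "\<dots> = integral {0..2*pi} (\<lambda>x. integral {0..2*pi} (\<lambda>y. (f (x - s) * g (y - s'))\<^sup>2))"
    by (subst torus_integral_iterated) (auto intro!: continuous_intros c)
  also have "\<dots> = (circle_norm (\<lambda>x. f (x - s)))\<^sup>2 * (circle_norm (\<lambda>x. g (x - s')))\<^sup>2"
    unfolding circle_norm_sq[OF cf(1)] circle_norm_sq[OF cf(2)] power_mult_distrib by simp
  also have "\<dots> = (circle_norm f * circle_norm g)\<^sup>2"
    by (simp add: circle_norm_shift[OF f fp] circle_norm_shift[OF g gp] power_mult_distrib)
  finally show ?thesis
    using circle_norm_nonneg[OF f] circle_norm_nonneg[OF g] by (simp add: power2_eq_iff_nonneg)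
qed

lemma norm_abs_L2_Pair_le:
  fixes e d :: "plane \<Rightarrow> real"
  assumes e: "continuous_on UNIV e" and d: "continuous_on UNIV d"
  shows "norm (abs_L2 (\<lambda>x. (e x, d x))) \<le> norm (abs_L2 e) + norm (abs_L2 d)"
proof (rule power2_le_imp_le)
  have c: "continuous_on UNIV (\<lambda>x. (e x, d x))" by (intro continuous_intros e d)
  have i: "integrable torus (\<lambda>x. (e x)\<^sup>2)" "integrable torus (\<lambda>x. (d x)\<^sup>2)"
    by (intro continuous_integrable_torus continuous_intros e d)+
  have "(norm (abs_L2 (\<lambda>x. (e x, d x))))\<^sup>2 = (\<integral>x. (e x)\<^sup>2 + (d x)\<^sup>2 \<partial>torus)"
    unfolding norm_abs_L2[OF continuous_sq_integrable[OF c]] by (simp add: norm_plane_sq)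
  also have "\<dots> = (norm (abs_L2 e))\<^sup>2 + (norm (abs_L2 d))\<^sup>2"
    using norm_abs_L2[OF continuous_sq_integrable[OF e]] norm_abs_L2[OF continuous_sq_integrable[OF d]] i
    by simp
  also have "\<dots> \<le> (norm (abs_L2 e) + norm (abs_L2 d))\<^sup>2" by (simp add: power2_sum)
  finally show "(norm (abs_L2 (\<lambda>x. (e x, d x))))\<^sup>2 \<le> (norm (abs_L2 e) + norm (abs_L2 d))\<^sup>2" .
qed simp

text \<open>The positive part of \<open>cos x - c\<close> is periodic and supported on a short arc around the multiples of
  \<open>2\<pi>\<close> when \<open>c\<close> is close to \<open>1\<close>. Its cube is twice continuously differentiable, which is the regularity
  that the leading part \<open>h'\<close> of the packet needs.\<close>

definition cap :: "real \<Rightarrow> real \<Rightarrow> real" where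
  "cap c x = max 0 (cos x - c)"

definition bump :: "real \<Rightarrow> real \<Rightarrow> real" where "bump c x = cap c x ^ 3"
definition bump' :: "real \<Rightarrow> real \<Rightarrow> real" where "bump' c x = - 3 * sin x * cap c x ^ 2"
definition bump'' :: "real \<Rightarrow> real \<Rightarrow> real" where
  "bump'' c x = - 3 * cos x * cap c x ^ 2 + 6 * (sin x)\<^sup>2 * cap c x"

lemma DERIV_positive_part_power:
  fixes y :: real
  shows "((\<lambda>y. max 0 y ^ Suc (Suc k)) has_real_derivative real (Suc (Suc k)) * max 0 y ^ Suc k) (at y)"
proof (cases y "0 :: real" rule: linorder_cases)
  case less
  have "((\<lambda>y. 0 :: real) has_real_derivative 0) (at y)" by simp
  then have "((\<lambda>y. max 0 y ^ Suc (Suc k)) has_real_derivative 0) (at y)"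
    by (rule has_field_derivative_transform_within[where d = "- y"]) (use less in \<open>auto simp: dist_real_def max_def\<close>)
  with less show ?thesis by (simp add: max_def)
next
  case greater
  have "((\<lambda>y. y ^ Suc (Suc k)) has_real_derivative real (Suc (Suc k)) * y ^ Suc k) (at y)"
    using DERIV_pow[of "Suc (Suc k)" y] by simp
  then have "((\<lambda>y. max 0 y ^ Suc (Suc k)) has_real_derivative real (Suc (Suc k)) * y ^ Suc k) (at y)"
    by (rule has_field_derivative_transform_within[where d = y]) (use greater in \<open>auto simp: dist_real_def max_def\<close>)
  with greater show ?thesis by (simp add: max_def)
next
  case equal
  have "((\<lambda>h. max 0 h ^ Suc (Suc k) / h) \<longlongrightarrow> 0) (at (0::real))"
  proof (rule Lim_null_comparison)
    have "norm (max 0 h ^ Suc (Suc k) / h) \<le> max 0 h ^ Suc k" for h :: real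
      by (cases "h > 0") (auto simp: max_def)
    then show "\<forall>\<^sub>F h in at (0::real). norm (max 0 h ^ Suc (Suc k) / h) \<le> max 0 h ^ Suc k" by simp
    have "((\<lambda>h :: real. max 0 h ^ Suc k) \<longlongrightarrow> max 0 0 ^ Suc k) (at 0)" by (intro tendsto_intros)
    then show "((\<lambda>h :: real. max 0 h ^ Suc k) \<longlongrightarrow> 0) (at 0)" by simp
  qed
  then show ?thesis using equal by (simp add: DERIV_def)
qed

lemma bump_deriv:
  "(bump c has_real_derivative bump' c x) (at x)" "(bump' c has_real_derivative bump'' c x) (at x)"
proof -
  have c: "((\<lambda>x. cos x - c) has_real_derivative - sin x) (at x)"
    by (auto intro!: derivative_eq_intros)
  have 3: "((\<lambda>x. cap c x ^ 3) has_real_derivative 3 * cap c x ^ 2 * (- sin x)) (at x)"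
    using DERIV_chain2[OF DERIV_positive_part_power[of 1] c] by (simp add: cap_def eval_nat_numeral)
  have 2: "((\<lambda>x. cap c x ^ 2) has_real_derivative 2 * cap c x * (- sin x)) (at x)"
    using DERIV_chain2[OF DERIV_positive_part_power[of 0] c] by (simp add: cap_def eval_nat_numeral)
  show "(bump c has_real_derivative bump' c x) (at x)"
    using 3 by (simp add: bump_def[abs_def] bump'_def mult_ac)
  have "((\<lambda>x. (- 3 * sin x) * cap c x ^ 2) has_real_derivative
      (- 3 * cos x) * cap c x ^ 2 + (2 * cap c x * (- sin x)) * (- 3 * sin x)) (at x)"
    by (rule DERIV_mult[OF _ 2]) (auto intro!: derivative_eq_intros)
  then show "(bump' c has_real_derivative bump'' c x) (at x)"
    by (simp add: bump'_def[abs_def] bump''_def power2_eq_square mult_ac)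
qed

lemma bump_continuous:
  "continuous_on UNIV (bump c)" "continuous_on UNIV (bump' c)" "continuous_on UNIV (bump'' c)"
  unfolding bump_def[abs_def] bump'_def[abs_def] bump''_def[abs_def] cap_def
  by (intro continuous_intros)+

lemma bump_periodic:
  "bump c (x + 2*pi) = bump c x" "bump' c (x + 2*pi) = bump' c x" "bump'' c (x + 2*pi) = bump'' c x"
  by (simp_all add: bump_def bump'_def bump''_def cap_def)

lemma bump_outside: "cos x \<le> c \<Longrightarrow> bump c x = 0" "cos x \<le> c \<Longrightarrow> bump' c x = 0"
  by (simp_all add: bump_def bump'_def cap_def)

text \<open>The integral of \<open>(sin x h\<^sup>2)' = cos x h\<^sup>2 + 2 sin x h h'\<close> over the circle vanishes. On the support of
  \<open>h\<close> one has \<open>cos x \<ge> c \<ge> 1/2\<close> and \<open>sin\<^sup>2 x \<le> 1 - c\<^sup>2\<close>; completing the square gives the estimate.\<close>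

lemma bump_poincare:
  assumes c: "1 / 2 \<le> c" "c < 1"
  shows "(circle_norm (bump c))\<^sup>2 \<le> 16 * (1 - c\<^sup>2) * (circle_norm (bump' c))\<^sup>2"
proof -
  let ?h = "bump c" and ?h1 = "bump' c"
  let ?D = "\<lambda>x. cos x * (?h x)\<^sup>2 + 2 * sin x * ?h x * ?h1 x"
  have "((\<lambda>x. sin x * (?h x)\<^sup>2) has_real_derivative ?D x) (at x)" for x
    by (auto intro!: derivative_eq_intros bump_deriv simp: power2_eq_square)
  from integral_derivative_periodic[OF this] have D0: "integral {0..2*pi} ?D = 0" by simp
  have cont: "continuous_on {0..2*pi} ?h" "continuous_on {0..2*pi} ?h1"
    using bump_continuous continuous_on_subset by blast+
  have pw: "1 / 4 * (?h x)\<^sup>2 - 4 * (1 - c\<^sup>2) * (?h1 x)\<^sup>2 \<le> ?D x" for x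
  proof (cases "cos x \<le> c")
    case True
    then show ?thesis by (simp add: bump_outside)
  next
    case False
    have "(1/2) * (?h x)\<^sup>2 \<le> cos x * (?h x)\<^sup>2" using False c by (intro mult_right_mono) auto
    moreover have "c\<^sup>2 \<le> (cos x)\<^sup>2" using False c by (intro power_mono) auto
    then have "(sin x)\<^sup>2 \<le> 1 - c\<^sup>2" using sin_cos_squared_add[of x] by linarith
    then have "4 * ((sin x)\<^sup>2 * (?h1 x)\<^sup>2) \<le> 4 * ((1 - c\<^sup>2) * (?h1 x)\<^sup>2)"
      by (intro mult_left_mono mult_right_mono) auto
    moreover have "0 \<le> (?h x / 2 + 2 * (sin x * ?h1 x))\<^sup>2" by simp
    then have "0 \<le> (?h x)\<^sup>2 / 4 + 2 * sin x * ?h x * ?h1 x + 4 * ((sin x)\<^sup>2 * (?h1 x)\<^sup>2)"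
      by (simp add: power2_sum power_mult_distrib power_divide algebra_simps)
    ultimately have "1 / 4 * (?h x)\<^sup>2 - 4 * ((1 - c\<^sup>2) * (?h1 x)\<^sup>2) \<le> ?D x" by linarith
    then show ?thesis by (simp only: mult.assoc)
  qed
  have "integral {0..2*pi} (\<lambda>x. 1 / 4 * (?h x)\<^sup>2 - 4 * (1 - c\<^sup>2) * (?h1 x)\<^sup>2) \<le> integral {0..2*pi} ?D"
    by (intro integral_le pw integrable_continuous_real continuous_intros cont)
  also have "integral {0..2*pi} (\<lambda>x. 1 / 4 * (?h x)\<^sup>2 - 4 * (1 - c\<^sup>2) * (?h1 x)\<^sup>2)
      = integral {0..2*pi} (\<lambda>x. 1 / 4 * (?h x)\<^sup>2) - integral {0..2*pi} (\<lambda>x. 4 * (1 - c\<^sup>2) * (?h1 x)\<^sup>2)"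
    by (intro Henstock_Kurzweil_Integration.integral_diff integrable_continuous_real continuous_intros cont)
  also have "\<dots> = 1 / 4 * (circle_norm ?h)\<^sup>2 - 4 * (1 - c\<^sup>2) * (circle_norm ?h1)\<^sup>2"
    by (simp only: circle_norm_sq bump_continuous integral_mult_right)
  finally show ?thesis unfolding D0 by (simp add: algebra_simps)
qed

lemma bump_norm_pos:
  assumes c: "1 / 2 \<le> c" "c < 1"
  shows "circle_norm (bump c) > 0" "circle_norm (bump' c) > 0"
proof -
  show pos: "circle_norm (bump c) > 0"
    by (rule circle_norm_pos[OF bump_continuous(1)]) (use c in \<open>simp add: bump_def cap_def\<close>)
  show "circle_norm (bump' c) > 0"
  proof (rule ccontr)
    assume "\<not> ?thesis"
    then have "circle_norm (bump' c) = 0" using circle_norm_nonneg[OF bump_continuous(2)] by (simp add: order_antisym)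
    with bump_poincare[OF c] pos show False by simp
  qed
qed

lemma thin_bump_exists:
  assumes \<kappa>: "\<kappa> > 0" and c0: "c\<^sub>0 < 1"
  shows "\<exists>c\<ge>c\<^sub>0. 1 / 2 \<le> c \<and> c < 1 \<and> circle_norm (bump c) \<le> \<kappa> * circle_norm (bump' c)"
proof -
  define \<eta> where "\<eta> = min (min (1 - c\<^sub>0) (1/2)) (\<kappa>\<^sup>2 / 32)"
  define c where "c = 1 - \<eta>"
  have \<eta>: "\<eta> > 0" "\<eta> \<le> 1 - c\<^sub>0" "\<eta> \<le> 1 / 2" "\<eta> \<le> \<kappa>\<^sup>2 / 32" 
    using \<kappa> c0 zero_less_power[OF \<kappa>, of 2] unfolding \<eta>_def by linarith+
  then have c: "c\<^sub>0 \<le> c" "1 / 2 \<le> c" "c < 1" by (auto simp: c_def)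
  have "16 * (1 - c\<^sup>2) \<le> \<kappa>\<^sup>2"
  proof -
    have "1 - c\<^sup>2 = \<eta> * (2 - \<eta>)" by (simp add: c_def power2_eq_square algebra_simps)
    also have "\<dots> \<le> \<eta> * 2" using \<eta> by (intro mult_left_mono) auto
    finally show ?thesis using \<eta>(4) by simp
  qed
  then have "16 * (1 - c\<^sup>2) * (circle_norm (bump' c))\<^sup>2 \<le> \<kappa>\<^sup>2 * (circle_norm (bump' c))\<^sup>2"
    by (intro mult_right_mono) auto
  with bump_poincare[OF c(2,3)] have "(circle_norm (bump c))\<^sup>2 \<le> (\<kappa> * circle_norm (bump' c))\<^sup>2"
    by (simp add: power_mult_distrib)
  then have "circle_norm (bump c) \<le> \<kappa> * circle_norm (bump' c)"
    by (rule power2_le_imp_le) (use \<kappa> circle_norm_nonneg[OF bump_continuous(2)] in simp)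
  with c show ?thesis by blast
qed

section \<open>The amplified wave packet\<close>

text \<open>The profile \<open>p\<close> travels with the centre \<open>z + tw\<close> of the vortex, \<open>q\<close> is at rest in the transversal
  direction.\<close>

definition tensor :: "plane \<Rightarrow> (real \<Rightarrow> real) \<Rightarrow> (real \<Rightarrow> real) \<Rightarrow> real \<Rightarrow> plane \<Rightarrow> real" where
  "tensor z p q t x = p (fst x - (fst z + t)) * q (snd x - snd z)"

lemma tensor_continuous_joint:
  assumes "continuous_on UNIV p" "continuous_on UNIV q"
  shows "continuous_on D (\<lambda>w. tensor z p q (fst w) (snd w))"
  unfolding tensor_def
  by (intro continuous_intros continuous_on_compose2[OF assms(1)] continuous_on_compose2[OF assms(2)]) auto

lemma tensor_continuous:
  assumes "continuous_on UNIV p" "continuous_on UNIV q"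
  shows "continuous_on D (tensor z p q t)"
  unfolding tensor_def
  by (intro continuous_intros continuous_on_compose2[OF assms(1)] continuous_on_compose2[OF assms(2)]) auto

lemma tensor_time_deriv:
  assumes "\<And>x. (p has_real_derivative p' x) (at x)"
  shows "((\<lambda>t. tensor z p q t x) has_real_derivative - tensor z p' q t x) (at t)"
  unfolding tensor_def
  by (auto intro!: derivative_eq_intros DERIV_chain2[OF assms])

lemma tensor_C1_periodic:
  assumes p: "\<And>x. (p has_real_derivative p' x) (at x)" "continuous_on UNIV p" "continuous_on UNIV p'"
      "\<And>x. p (x + 2*pi) = p x"
    and q: "\<And>x. (q has_real_derivative q' x) (at x)" "continuous_on UNIV q" "continuous_on UNIV q'"
      "\<And>x. q (x + 2*pi) = q x"
  shows "C1_periodic (tensor z p q t) (tensor z p' q t) (tensor z p q' t)"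
proof -
  have "p (x + 2*pi - c) = p (x - c)" "q (x + 2*pi - c) = q (x - c)" for x c
    using p(4)[of "x - c"] q(4)[of "x - c"] by (simp_all add: algebra_simps)
  then have "periodic (tensor z p q t)"
    by (simp add: periodic_def tensor_def)
  moreover have "((\<lambda>s. tensor z p q t (s, y)) has_real_derivative tensor z p' q t (x, y)) (at x)" for x y
    unfolding tensor_def by (auto intro!: derivative_eq_intros DERIV_chain2[OF p(1)])
  moreover have "((\<lambda>s. tensor z p q t (x, s)) has_real_derivative tensor z p q' t (x, y)) (at y)" for x y
    unfolding tensor_def by (auto intro!: derivative_eq_intros DERIV_chain2[OF q(1)])
  ultimately show ?thesis
    using p q by (simp add: C1_periodic_def tensor_continuous)
qed

lemma C1_periodic_cmult:
  "C1_periodic f f1 f2 \<Longrightarrow> C1_periodic (\<lambda>x. r * f x) (\<lambda>x. r * f1 x) (\<lambda>x. r * f2 x)"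
  by (auto simp: C1_periodic_def periodic_def intro!: continuous_intros DERIV_cmult)

lemma C1_periodic_add:
  "C1_periodic f f1 f2 \<Longrightarrow> C1_periodic g g1 g2 \<Longrightarrow>
    C1_periodic (\<lambda>x. f x + g x) (\<lambda>x. f1 x + g1 x) (\<lambda>x. f2 x + g2 x)"
  by (auto simp: C1_periodic_def periodic_def intro!: continuous_intros DERIV_add)

lemma norm_abs_L2_cmult:
  fixes f :: "plane \<Rightarrow> real"
  assumes "continuous_on UNIV f"
  shows "norm (abs_L2 (\<lambda>x. r * f x)) = \<bar>r\<bar> * norm (abs_L2 f)"
  using abs_L2_scaleR[OF continuous_sq_integrable[OF assms], of r, symmetric] by simp

lemma norm_abs_L2_lin_bounds:
  fixes f g :: "plane \<Rightarrow> real"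
  assumes f: "continuous_on UNIV f" and g: "continuous_on UNIV g"
  shows "norm (abs_L2 (\<lambda>x. r * f x + s * g x)) \<le> \<bar>r\<bar> * norm (abs_L2 f) + \<bar>s\<bar> * norm (abs_L2 g)"
    "\<bar>r\<bar> * norm (abs_L2 f) - \<bar>s\<bar> * norm (abs_L2 g) \<le> norm (abs_L2 (\<lambda>x. r * f x + s * g x))"
proof -
  have c: "continuous_on UNIV (\<lambda>x. r * f x)" "continuous_on UNIV (\<lambda>x. s * g x)"
    by (intro continuous_intros f g)+
  have "abs_L2 (\<lambda>x. r * f x + s * g x) = abs_L2 (\<lambda>x. r * f x) + abs_L2 (\<lambda>x. s * g x)"
    by (rule abs_L2_add[OF continuous_sq_integrable[OF c(1)] continuous_sq_integrable[OF c(2)], symmetric])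
  then show "norm (abs_L2 (\<lambda>x. r * f x + s * g x)) \<le> \<bar>r\<bar> * norm (abs_L2 f) + \<bar>s\<bar> * norm (abs_L2 g)"
    "\<bar>r\<bar> * norm (abs_L2 f) - \<bar>s\<bar> * norm (abs_L2 g) \<le> norm (abs_L2 (\<lambda>x. r * f x + s * g x))"
    using norm_triangle_ineq[of "abs_L2 (\<lambda>x. r * f x)" "abs_L2 (\<lambda>x. s * g x)"]
      norm_diff_ineq[of "abs_L2 (\<lambda>x. r * f x)" "abs_L2 (\<lambda>x. s * g x)"]
    by (simp_all add: norm_abs_L2_cmult f g)
qed

lemma wrap1_close_to_0:
  assumes \<rho>: "0 < \<rho>" "\<rho> < pi" and c: "cos a > cos \<rho>"
  shows "\<bar>wrap1 a\<bar> < \<rho>"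
proof (rule ccontr)
  assume "\<not> ?thesis"
  then have "cos \<bar>wrap1 a\<bar> \<le> cos \<rho>"
    using wrap1_bounds[of a] \<rho> by (intro cos_monotone_0_pi_le) auto
  moreover have "cos (wrap1 a) = cos a"
  proof -
    have "wrap1 a = a - 2*pi * real_of_int \<lfloor>(a + pi) / (2*pi)\<rfloor>" by (simp add: wrap1_def)
    then show ?thesis by (simp only: cos_diff cos_int_2pin sin_int_2pin)
  qed
  ultimately show False using c by (simp add: cos_abs_real)
qed

lemma amp_antimono:
  assumes "\<sigma> > 0" "0 \<le> t"
  shows "amp \<sigma> n t \<le> amp \<sigma> n 0" "len \<sigma> n t \<le> len \<sigma> n 0"
proof -
  have d: "delta n > 0" by (rule delta_pos)
  then show a: "amp \<sigma> n t \<le> amp \<sigma> n 0"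
    using assms unfolding amp_def by (intro add_left_mono divide_left_mono mult_left_mono mult_pos_pos) auto
  have "amp \<sigma> n t \<ge> 1" using amp_ge_1[of \<sigma> n t] assms d by simp
  then show "len \<sigma> n t \<le> len \<sigma> n 0" unfolding len_def using a by (intro add_left_mono power_mono) auto
qed

text \<open>The core shrinks as \<open>L\<close> grows and is smallest at time \<open>0\<close>, so one radius serves for all times.\<close>

lemma u_seq_near_center:
  assumes \<sigma>: "\<sigma> > 0" and r0: "0 < r\<^sub>0" "r\<^sub>0 < pi" and \<Theta>: "cutoff_profile \<Theta>" and t: "0 \<le> t"
    and \<rho>: "0 < \<rho>" "\<rho> < pi" "2 * \<rho> \<le> r\<^sub>0 * exp (- len \<sigma> n 0)"
    and x: "cos (fst x - (fst z + t)) > cos \<rho>" "cos (snd x - snd z) > cos \<rho>"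
  shows "u_seq \<sigma> r\<^sub>0 \<Theta> z n t x = (amp \<sigma> n t, 0)"
proof -
  let ?y = "x - (z + t *\<^sub>R w_dir)"
  have y: "fst ?y = fst x - (fst z + t)" "snd ?y = snd x - snd z" by (simp_all add: w_dir_def)
  have "norm (wrap ?y) \<le> \<bar>wrap1 (fst ?y)\<bar> + \<bar>wrap1 (snd ?y)\<bar>"
    using norm_Pair_le[of "wrap1 (fst ?y)" "wrap1 (snd ?y)"] by (simp add: wrap_eq_wrap1)
  also have "\<dots> < 2 * \<rho>"
    using wrap1_close_to_0[OF \<rho>(1,2), of "fst ?y"] wrap1_close_to_0[OF \<rho>(1,2), of "snd ?y"] x
    unfolding y by linarith
  also have "2 * \<rho> \<le> r\<^sub>0 * exp (- len \<sigma> n 0)" by (rule \<rho>(3))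
  also have "\<dots> \<le> r\<^sub>0 * exp (- len \<sigma> n t)" using amp_antimono(2)[OF \<sigma> t, of n] r0 by simp
  finally have "norm (wrap ?y) < r\<^sub>0 * exp (- len \<sigma> n t)" .
  moreover have "len \<sigma> n t > 0" using len_ge_1[OF \<sigma>, of n t] delta_pos[of n] t by simp
  ultimately show ?thesis unfolding u_seq_def by (intro vortex_core[OF r0(1) \<Theta>])
qed

text \<open>The packet is \<open>E = (e, d)\<close> with magnetic part \<open>b\<close>, where \<open>b + d = m h'g\<close>, \<open>b - d = \<alpha> h g\<close> and
  \<open>e = - m h g'/2\<close>; the profiles \<open>h\<close>, \<open>g\<close> are bumps in the variables \<open>x\<^sub>1 - z\<^sub>1 - t\<close>, \<open>x\<^sub>2 - z\<^sub>2\<close>. The three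
  coefficients are forced by the requirement that no derivative of \<open>h\<close> survives in the residual:
  the terms in \<open>h'g\<close> of the equation for \<open>b + d\<close> give \<open>m' = \<sigma>(A - 1)m/2\<close>, those of the equation for
  \<open>b - d\<close> give \<open>\<alpha> = m'/2\<close>, and the terms in \<open>h'g'\<close> of the equation for \<open>e\<close> give the factor \<open>- m/2\<close>.

  The order of the choices matters. The core radius and with it \<open>g\<close>, the stability constant \<open>K\<close> and all
  constants made from them depend on \<open>n\<close> only; the width of \<open>h\<close> is chosen last, so thin that the
  errors proportional to \<open>\<parallel>h\<parallel>\<close> are negligible against \<open>\<parallel>h'\<parallel>\<close>. The factor \<open>1/8\<close> leaves room for them.\<close>

lemma evolution_norm_lower_bound:
  fixes T \<sigma> r\<^sub>0 :: real and z :: plane and S :: "real \<Rightarrow> state \<Rightarrow>\<^sub>L state"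
  assumes T: "T > 0" and \<sigma>: "\<sigma> > 0" and r0: "0 < r\<^sub>0" "r\<^sub>0 < pi" and \<Theta>: "cutoff_profile \<Theta>"
    and S: "contraction_semigroup S" and gen: "generated_by S (maxwell_ohm \<sigma>)"
  shows "(T + delta n) / (8 * delta n) \<le> norm (evolution \<sigma> S T (u_seq \<sigma> r\<^sub>0 \<Theta> z n))"
proof -
  let ?u = "u_seq \<sigma> r\<^sub>0 \<Theta> z n" and ?A = "amp \<sigma> n"
  define \<delta> where "\<delta> = delta n"
  have \<delta>: "\<delta> > 0" unfolding \<delta>_def by (rule delta_pos)
  define \<alpha> where "\<alpha> = 1 / (2 * \<delta>)"
  define m where "m t = (t + \<delta>) / \<delta>" for t
  have \<alpha>: "\<alpha> > 0" using \<delta> by (simp add: \<alpha>_def)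
  have m0: "m 0 = 1" using \<delta> by (simp add: m_def)
  have mpos: "m t > 0" if "t \<ge> 0" for t using \<delta> that by (simp add: m_def)
  have mT: "m t \<le> m T" if "t \<le> T" for t using \<delta> that by (simp add: m_def divide_right_mono)
  \<comment> \<open>The amplitude of the vortex is tuned to this identity, which is \<open>m' = \<sigma>(A - 1)m/2\<close> with \<open>m' = 2\<alpha>\<close>.\<close>
  have growth: "\<sigma> * m t * ?A t = \<sigma> * m t + 4 * \<alpha>" if "t \<ge> 0" for t
  proof -
    define w where "w = t + \<delta>"
    have "w > 0" using that \<delta> by (simp add: w_def)
    have mt: "m t = w / \<delta>" and At: "?A t = 1 + 2 / (\<sigma> * w)"
      by (simp_all add: m_def amp_def w_def \<delta>_def)
    show ?thesis unfolding mt At \<alpha>_def using \<open>w > 0\<close> \<sigma> \<delta> by (simp add: field_simps)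
  qed
  have v: "continuous_on ({0..T} \<times> UNIV) (\<lambda>(t, x). ?u t x)"
    using u_seq_smooth_coeff[OF \<sigma> r0 \<Theta>, of T z n]
    unfolding smooth_coeff_def smooth_on_def by (metis Ck_on.simps(1))
  have "T \<ge> 0" using T by simp
  from evolution_close_to_approximation[OF S gen this v] obtain K where K: "K \<ge> 0" and
    close: "\<And>Y Y' r \<rho>. \<lbrakk>\<And>s. s \<in> {0..T} \<Longrightarrow> (Y has_vector_derivative Y' s) (at s within {0..T});
      \<And>s. s \<in> {0..T} \<Longrightarrow> maxwell_ohm \<sigma> (Y s) (Y' s - (ohm_source \<sigma> (?u s) (Y s) + r s));
      continuous_on {0..T} r; \<And>s. s \<in> {0..T} \<Longrightarrow> norm (r s) \<le> \<rho>\<rbrakk>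
      \<Longrightarrow> norm (evolution \<sigma> S T ?u (Y 0) - Y T) \<le> K * \<rho>" by blast
  \<comment> \<open>Both coordinates of a point of the packet lie within \<open>R\<close> of the centre, hence the point within \<open>2R\<close>;
    the bound \<open>\<pi>/3\<close> yields \<open>cos R \<ge> 1/2\<close>, as \<open>bump_poincare\<close> requires.\<close>
  define R where "R = min (pi / 3) (r\<^sub>0 * exp (- len \<sigma> n 0) / 2)"
  have R: "0 < R" "R \<le> pi / 3" "2 * R \<le> r\<^sub>0 * exp (- len \<sigma> n 0)"
    using r0 by (auto simp: R_def min_def)
  then have R': "R < pi" using pi_gt_zero by linarith
  define c\<^sub>0 where "c\<^sub>0 = cos R"
  have "cos (pi / 3) \<le> cos R" using R by (intro cos_monotone_0_pi_le) auto
  then have c0: "1 / 2 \<le> c\<^sub>0" by (simp add: c\<^sub>0_def cos_60)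
  have "cos R < cos 0" using R R' by (intro cos_monotone_0_pi) auto
  then have c01: "c\<^sub>0 < 1" by (simp add: c\<^sub>0_def)
  let ?g = "bump c\<^sub>0" and ?g1 = "bump' c\<^sub>0" and ?g2 = "bump'' c\<^sub>0"
  define G0 G1 G2 where "G0 = circle_norm ?g" and "G1 = circle_norm ?g1" and "G2 = circle_norm ?g2"
  have G: "G0 > 0" "G1 \<ge> 0" "G2 \<ge> 0"
    unfolding G0_def G1_def G2_def
    using bump_norm_pos[OF c0 c01] by (auto intro: circle_norm_nonneg bump_continuous)
  \<comment> \<open>Multiples of \<open>\<parallel>h\<parallel>\<close>: \<open>K1\<close> bounds the residual, \<open>K2\<close> the loss at time \<open>T\<close>, \<open>K3\<close> the corrections in the
    initial state.\<close>
  define K1 where "K1 = (3 * \<alpha> / 2 + \<sigma> * m T / 2) * G1 + \<sigma> * \<alpha> * (1 + ?A 0) / 2 * G0 + m T / 2 * G2"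
  define K2 where "K2 = \<alpha> / 2 * G0 + K * K1"
  define K3 where "K3 = \<alpha> * G0 + G1 / 2"
  have A0: "?A 0 \<ge> 1" using amp_ge_1[OF \<sigma>, of n 0] \<delta> by (simp add: \<delta>_def)
  have MT: "m T > 0" using mpos T by simp
  have K1: "K1 \<ge> 0" using G \<alpha> \<sigma> MT A0 by (simp add: K1_def)
  have K2: "K2 \<ge> 0" using G \<alpha> K K1 by (simp add: K2_def)
  have K3: "K3 \<ge> 0" using G \<alpha> by (simp add: K3_def)
  define \<kappa> where "\<kappa> = min (m T * G0 / (4 * (K2 + 1))) (G0 / (K3 + 1))"
  have \<kappa>: "\<kappa> > 0" "K2 * \<kappa> \<le> m T * G0 / 4" "K3 * \<kappa> \<le> G0"
  proof -
    show \<kappa>0: "\<kappa> > 0" using MT G K2 K3 by (simp add: \<kappa>_def)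
    have "(K2 + 1) * \<kappa> \<le> (K2 + 1) * (m T * G0 / (4 * (K2 + 1)))"
      using K2 by (intro mult_left_mono) (auto simp: \<kappa>_def)
    also have "\<dots> = m T * G0 / 4" using K2 by (simp add: field_simps)
    finally show "K2 * \<kappa> \<le> m T * G0 / 4" using \<kappa>0 by (simp add: algebra_simps)
    have "(K3 + 1) * \<kappa> \<le> (K3 + 1) * (G0 / (K3 + 1))"
      using K3 by (intro mult_left_mono) (auto simp: \<kappa>_def)
    also have "\<dots> = G0" using K3 by (simp add: field_simps)
    finally show "K3 * \<kappa> \<le> G0" using \<kappa>0 by (simp add: algebra_simps)
  qed
  obtain c where c: "c\<^sub>0 \<le> c" "1 / 2 \<le> c" "c < 1" "circle_norm (bump c) \<le> \<kappa> * circle_norm (bump' c)"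
    using thin_bump_exists[OF \<kappa>(1) c01] by blast
  let ?h = "bump c" and ?h1 = "bump' c" and ?h2 = "bump'' c"
  define H H' where "H = circle_norm ?h" and "H' = circle_norm ?h1"
  have H: "H \<ge> 0" "H' > 0" "H \<le> \<kappa> * H'"
    unfolding H_def H'_def using bump_norm_pos[OF c(2,3)] c(4) by auto
  note bc = bump_continuous and bp = bump_periodic and bd = bump_deriv
  let ?hg = "tensor z ?h ?g" and ?h1g = "tensor z ?h1 ?g" and ?h2g = "tensor z ?h2 ?g"
    and ?hg1 = "tensor z ?h ?g1" and ?h1g1 = "tensor z ?h1 ?g1" and ?hg2 = "tensor z ?h ?g2"
  have tc: "continuous_on D (?hg t)" "continuous_on D (?h1g t)" "continuous_on D (?h2g t)"
    "continuous_on D (?hg1 t)" "continuous_on D (?h1g1 t)" "continuous_on D (?hg2 t)" for D t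
    by (intro tensor_continuous bc)+
  have jc: "continuous_on D (\<lambda>w. ?hg (fst w) (snd w))" "continuous_on D (\<lambda>w. ?h1g (fst w) (snd w))"
    "continuous_on D (\<lambda>w. ?h2g (fst w) (snd w))" "continuous_on D (\<lambda>w. ?hg1 (fst w) (snd w))"
    "continuous_on D (\<lambda>w. ?h1g1 (fst w) (snd w))" "continuous_on D (\<lambda>w. ?hg2 (fst w) (snd w))" for D
    by (intro tensor_continuous_joint bc)+
  have nrm: "norm (abs_L2 (?hg t)) = H * G0" "norm (abs_L2 (?h1g t)) = H' * G0"
    "norm (abs_L2 (?hg1 t)) = H * G1" "norm (abs_L2 (?hg2 t)) = H * G2" for t
    unfolding tensor_def[abs_def] H_def H'_def G0_def G1_def G2_def
    by (intro norm_abs_L2_product bc bp)+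
  have mc: "continuous_on D (\<lambda>w. m (fst w))" for D :: "(real \<times> plane) set"
    unfolding m_def using \<delta> by (auto intro!: continuous_intros)
  have td: "((\<lambda>t. ?hg t x) has_real_derivative - ?h1g t x) (at t)"
    "((\<lambda>t. ?h1g t x) has_real_derivative - ?h2g t x) (at t)"
    "((\<lambda>t. ?hg1 t x) has_real_derivative - ?h1g1 t x) (at t)" for t x
    by (intro tensor_time_deriv bd)+
  have md: "(m has_real_derivative 2 * \<alpha>) (at t)" for t
    unfolding m_def using \<delta> by (auto intro!: derivative_eq_intros simp: \<alpha>_def)
  define e where "e t x = - m t / 2 * ?hg1 t x" for t x
  define d where "d t x = m t / 2 * ?h1g t x + (- \<alpha> / 2) * ?hg t x" for t x
  define b where "b t x = m t / 2 * ?h1g t x + \<alpha> / 2 * ?hg t x" for t x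
  define e' where "e' t x = - \<alpha> * ?hg1 t x + m t / 2 * ?h1g1 t x" for t x
  define d' where "d' t x = 3 * \<alpha> / 2 * ?h1g t x - m t / 2 * ?h2g t x" for t x
  define b' where "b' t x = \<alpha> / 2 * ?h1g t x - m t / 2 * ?h2g t x" for t x
  define r1 where "r1 t x = (- 3 * \<alpha> / 2 - \<sigma> * m t / 2) * ?hg1 t x" for t x
  define r2 where "r2 t x = - (\<sigma> * \<alpha> * (1 + ?A t) / 2) * ?hg t x" for t x
  define r3 where "r3 t x = m t / 2 * ?hg2 t x" for t x
  define Y where "Y t = (abs_L2 (\<lambda>x. (e t x, d t x)), abs_L2 (b t))" for t
  define Y' where "Y' t = (abs_L2 (\<lambda>x. (e' t x, d' t x)), abs_L2 (b' t))" for t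
  define r where "r t = (abs_L2 (\<lambda>x. (r1 t x, r2 t x)), abs_L2 (r3 t))" for t
  note defs = e_def d_def b_def e'_def d'_def b'_def r1_def r2_def r3_def
  have sc: "continuous_on UNIV (e t)" "continuous_on UNIV (d t)" "continuous_on UNIV (b t)"
    "continuous_on UNIV (e' t)" "continuous_on UNIV (d' t)" "continuous_on UNIV (b' t)"
    "continuous_on UNIV (r1 t)" "continuous_on UNIV (r2 t)" "continuous_on UNIV (r3 t)" for t
    unfolding defs by (intro continuous_intros tc)+
  have Ac: "continuous_on ({0..T} \<times> (UNIV :: plane set)) (\<lambda>w. ?A (fst w))"
    unfolding amp_def using \<delta> \<sigma> by (intro continuous_intros) (auto simp: \<delta>_def)
  have sjc: "continuous_on D (\<lambda>w. (e (fst w) (snd w), d (fst w) (snd w)))" "continuous_on D (\<lambda>w. b (fst w) (snd w))"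
    "continuous_on D (\<lambda>w. (e' (fst w) (snd w), d' (fst w) (snd w)))" "continuous_on D (\<lambda>w. b' (fst w) (snd w))"
    "continuous_on D (\<lambda>w. r3 (fst w) (snd w))" for D
    unfolding defs by (intro continuous_intros jc mc; simp)+
  have rjc: "continuous_on ({0..T} \<times> UNIV) (\<lambda>w. (r1 (fst w) (snd w), r2 (fst w) (snd w)))"
    unfolding defs by (intro continuous_intros jc mc Ac; simp)
  have der: "((\<lambda>t. e t x) has_real_derivative e' t x) (at t)" "((\<lambda>t. d t x) has_real_derivative d' t x) (at t)"
    "((\<lambda>t. b t x) has_real_derivative b' t x) (at t)" for t x
    unfolding defs by (auto intro!: derivative_eq_intros td md simp: field_simps)
  have Yder: "(Y has_vector_derivative Y' s) (at s within {0..T})" if s: "s \<in> {0..T}" for s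
    unfolding Y_def Y'_def
  proof (rule has_vector_derivative_Pair)
    have dv: "((\<lambda>t. e t x) has_vector_derivative e' t x) (at t within {0..T})"
      "((\<lambda>t. d t x) has_vector_derivative d' t x) (at t within {0..T})"
      "((\<lambda>t. b t x) has_vector_derivative b' t x) (at t within {0..T})" for t x
      using der[of x t]
      by (auto simp: has_real_derivative_iff_has_vector_derivative intro: has_vector_derivative_at_within)
    show "((\<lambda>t. abs_L2 (\<lambda>x. (e t x, d t x))) has_vector_derivative abs_L2 (\<lambda>x. (e' s x, d' s x)))
        (at s within {0..T})"
      by (rule abs_L2_has_vector_derivative[OF _ _ has_vector_derivative_Pair[OF dv(1) dv(2)] s])
        (use sjc in \<open>simp_all add: case_prod_beta\<close>)
    show "((\<lambda>t. abs_L2 (b t)) has_vector_derivative abs_L2 (b' s)) (at s within {0..T})"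
      by (rule abs_L2_has_vector_derivative[OF _ _ dv(3) s]) (use sjc in \<open>simp_all add: case_prod_beta\<close>)
  qed
  have rc: "continuous_on {0..T} r"
    unfolding r_def
    by (intro continuous_on_Pair abs_L2_continuous_on) (use rjc sjc(5) in \<open>simp_all add: case_prod_beta\<close>)
  have rn: "norm (r t) \<le> K1 * H" if t: "t \<in> {0..T}" for t
  proof -
    have "norm (r t) \<le> norm (abs_L2 (r1 t)) + norm (abs_L2 (r2 t)) + norm (abs_L2 (r3 t))"
      unfolding r_def
      using norm_Pair_le[of "abs_L2 (\<lambda>x. (r1 t x, r2 t x))" "abs_L2 (r3 t)"]
        norm_abs_L2_Pair_le[OF sc(7,8), of t t] by linarith
    also have "\<dots> = \<bar>- 3 * \<alpha> / 2 - \<sigma> * m t / 2\<bar> * (H * G1) + \<bar>- (\<sigma> * \<alpha> * (1 + ?A t) / 2)\<bar> * (H * G0)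
        + \<bar>m t / 2\<bar> * (H * G2)"
      unfolding r1_def r2_def r3_def by (simp only: norm_abs_L2_cmult[OF tc(4)] norm_abs_L2_cmult[OF tc(1)]
          norm_abs_L2_cmult[OF tc(6)] nrm)
    also have "\<dots> \<le> (3 * \<alpha> / 2 + \<sigma> * m T / 2) * (H * G1) + \<sigma> * \<alpha> * (1 + ?A 0) / 2 * (H * G0)
        + m T / 2 * (H * G2)"
    proof (intro add_mono mult_right_mono)
      have "\<sigma> * m t \<le> \<sigma> * m T" "0 \<le> \<sigma> * m t" using mT[of t] mpos[of t] t \<sigma> by auto
      then show "\<bar>- 3 * \<alpha> / 2 - \<sigma> * m t / 2\<bar> \<le> 3 * \<alpha> / 2 + \<sigma> * m T / 2" using \<alpha> by linarith
      have "?A t \<le> ?A 0" "?A t \<ge> 1"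
        using amp_antimono(1)[OF \<sigma>, of t n] amp_ge_1[OF \<sigma>, of n t] t \<delta> by (auto simp: \<delta>_def)
      then show "\<bar>- (\<sigma> * \<alpha> * (1 + ?A t) / 2)\<bar> \<le> \<sigma> * \<alpha> * (1 + ?A 0) / 2"
        using \<sigma> \<alpha> by (simp add: abs_mult)
      show "\<bar>m t / 2\<bar> \<le> m T / 2" using mT[of t] mpos[of t] t by auto
    qed (use H G in auto)
    also have "\<dots> = K1 * H" by (simp add: K1_def algebra_simps)
    finally show ?thesis .
  qed
  have dom: "maxwell_ohm \<sigma> (Y s) (Y' s - (ohm_source \<sigma> (?u s) (Y s) + r s))" if s: "s \<in> {0..T}" for s
  proof -
    have s0: "s \<ge> 0" using s by simp
    have uc: "continuous_on UNIV (?u s)" by (rule continuous_slice[OF v s])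
    \<comment> \<open>The field has this simple form only on the core; outside of it the packet vanishes.\<close>
    have src: "(- \<sigma> * b s x) *\<^sub>R Rot (?u s x) = (0, \<sigma> * ?A s * b s x)" for x
    proof (cases "cos (fst x - (fst z + s)) > c \<and> cos (snd x - snd z) > c\<^sub>0")
      case True
      then have "?u s x = (?A s, 0)"
        using c(1) by (intro u_seq_near_center[OF \<sigma> r0 \<Theta> s0 R(1) R' R(3)]) (auto simp: c\<^sub>0_def)
      then show ?thesis by (simp add: Rot_def)
    next
      case False
      then have "b s x = 0" unfolding b_def tensor_def by (auto simp: bump_outside not_less)
      then show ?thesis by (simp add: zero_prod_def)
    qed
    have source: "ohm_source \<sigma> (?u s) (Y s) = (abs_L2 (\<lambda>x. (0, \<sigma> * ?A s * b s x)), 0)"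
      unfolding Y_def ohm_source_abs[OF uc continuous_sq_integrable[OF sc(3)]] src ..
    have C: "C1_periodic (?hg s) (?h1g s) (?hg1 s)" "C1_periodic (?h1g s) (?h2g s) (?h1g1 s)"
      "C1_periodic (?hg1 s) (?h1g1 s) (?hg2 s)"
      by (intro tensor_C1_periodic bd bc bp)+
    note Ce = C1_periodic_cmult[OF C(3), of "- m s / 2"]
    note Cd = C1_periodic_add[OF C1_periodic_cmult[OF C(2), of "m s / 2"] C1_periodic_cmult[OF C(1), of "- \<alpha> / 2"]]
    note Cb = C1_periodic_add[OF C1_periodic_cmult[OF C(2), of "m s / 2"] C1_periodic_cmult[OF C(1), of "\<alpha> / 2"]]
    note mo = maxwell_ohm_abs[OF Ce Cd Cb, of \<sigma>]
    have Y_eq: "(abs_L2 (\<lambda>x. (- m s / 2 * ?hg1 s x, m s / 2 * ?h1g s x + - \<alpha> / 2 * ?hg s x)),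
        abs_L2 (\<lambda>x. m s / 2 * ?h1g s x + \<alpha> / 2 * ?hg s x)) = Y s"
      unfolding Y_def e_def d_def b_def ..
    have cc: "continuous_on UNIV (\<lambda>x. (e' s x, d' s x))" "continuous_on UNIV (\<lambda>x. (0 :: real, \<sigma> * ?A s * b s x))"
      "continuous_on UNIV (\<lambda>x. (r1 s x, r2 s x))"
      by (intro continuous_intros sc)+
    note sq = cc[THEN continuous_sq_integrable]
    have fst_eq: "abs_L2 (\<lambda>x. (e' s x, d' s x)) - (abs_L2 (\<lambda>x. (0, \<sigma> * ?A s * b s x)) + abs_L2 (\<lambda>x. (r1 s x, r2 s x)))
        = abs_L2 (\<lambda>x. (e' s x, d' s x) - ((0, \<sigma> * ?A s * b s x) + (r1 s x, r2 s x)))"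
      unfolding abs_L2_add[OF sq(2,3)] by (rule abs_L2_diff[OF sq(1) sq_integrable_add[OF sq(2,3)]])
    have snd_eq: "abs_L2 (b' s) - (0 + abs_L2 (r3 s)) = abs_L2 (\<lambda>x. b' s x - r3 s x)"
      using abs_L2_diff[OF continuous_sq_integrable[OF sc(6)] continuous_sq_integrable[OF sc(9)]] by simp
    \<comment> \<open>Here the derivatives of \<open>h\<close> cancel.\<close>
    have pt1: "(e' s x, d' s x) - ((0, \<sigma> * ?A s * b s x) + (r1 s x, r2 s x))
      = ((m s / 2 * ?h1g1 s x + \<alpha> / 2 * ?hg1 s x) - \<sigma> * (- m s / 2 * ?hg1 s x),
        - (m s / 2 * ?h2g s x + \<alpha> / 2 * ?h1g s x) - \<sigma> * (m s / 2 * ?h1g s x + - \<alpha> / 2 * ?hg s x))" for x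
    proof -
      have "\<sigma> * ?A s * b s x = (\<sigma> * m s * ?A s) / 2 * ?h1g s x + \<sigma> * ?A s * \<alpha> / 2 * ?hg s x"
        by (simp add: b_def algebra_simps)
      also have "\<dots> = (\<sigma> * m s + 4 * \<alpha>) / 2 * ?h1g s x + \<sigma> * ?A s * \<alpha> / 2 * ?hg s x"
        unfolding growth[OF s0] ..
      finally show ?thesis by (simp add: e'_def d'_def r1_def r2_def field_simps)
    qed
    have pt2: "b' s x - r3 s x = - m s / 2 * ?hg2 s x - (m s / 2 * ?h2g s x + - \<alpha> / 2 * ?h1g s x)" for x
      by (simp add: b'_def r3_def algebra_simps)
    have "Y' s - (ohm_source \<sigma> (?u s) (Y s) + r s)
      = (abs_L2 (\<lambda>x. (e' s x, d' s x) - ((0, \<sigma> * ?A s * b s x) + (r1 s x, r2 s x))), abs_L2 (\<lambda>x. b' s x - r3 s x))"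
      unfolding source Y'_def r_def add_Pair diff_Pair fst_eq snd_eq ..
    with mo show ?thesis unfolding Y_eq pt1 pt2 by simp
  qed
  from close[OF Yder dom rc rn] have near: "norm (evolution \<sigma> S T ?u (Y 0) - Y T) \<le> K * (K1 * H)" .
  have YT: "m T / 2 * (H' * G0) - \<alpha> / 2 * (H * G0) \<le> norm (Y T)"
  proof -
    have "m T / 2 * (H' * G0) - \<alpha> / 2 * (H * G0) \<le> norm (abs_L2 (b T))"
      using norm_abs_L2_lin_bounds(2)[OF tc(2) tc(1), of "m T / 2" T "\<alpha> / 2" T] MT \<alpha>
      unfolding b_def nrm by simp
    also have "\<dots> \<le> norm (Y T)"
      unfolding Y_def by (rule norm_snd_le)
    finally show ?thesis .
  qed
  have Y0: "norm (Y 0) \<le> H' * G0 + K3 * H"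
  proof -
    have "norm (Y 0) \<le> norm (abs_L2 (e 0)) + norm (abs_L2 (d 0)) + norm (abs_L2 (b 0))"
      unfolding Y_def
      using norm_Pair_le[of "abs_L2 (\<lambda>x. (e 0 x, d 0 x))" "abs_L2 (b 0)"]
        norm_abs_L2_Pair_le[OF sc(1,2), of 0 0] by linarith
    moreover have "norm (abs_L2 (e 0)) = H * G1 / 2"
      unfolding e_def norm_abs_L2_cmult[OF tc(4)] nrm m0 by simp
    moreover have "norm (abs_L2 (d 0)) \<le> H' * G0 / 2 + \<alpha> * (H * G0) / 2"
      using norm_abs_L2_lin_bounds(1)[OF tc(2) tc(1), of "m 0 / 2" 0 "- \<alpha> / 2" 0] \<alpha>
      unfolding d_def nrm m0 by simp
    moreover have "norm (abs_L2 (b 0)) \<le> H' * G0 / 2 + \<alpha> * (H * G0) / 2"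
      using norm_abs_L2_lin_bounds(1)[OF tc(2) tc(1), of "m 0 / 2" 0 "\<alpha> / 2" 0] \<alpha>
      unfolding b_def nrm m0 by simp
    ultimately show ?thesis by (simp add: K3_def algebra_simps)
  qed
  let ?N = "norm (evolution \<sigma> S T ?u)"
  have "K2 * H \<le> K2 * (\<kappa> * H')" using K2 H by (intro mult_left_mono) auto
  also have "\<dots> \<le> m T * G0 / 4 * H'" using \<kappa>(2) H by (simp add: mult_right_mono flip: mult.assoc)
  finally have l1: "K2 * H \<le> m T * G0 / 4 * H'" .
  have "K3 * H \<le> K3 * (\<kappa> * H')" using K3 H by (intro mult_left_mono) auto
  also have "\<dots> \<le> G0 * H'" using \<kappa>(3) H by (simp add: mult_right_mono flip: mult.assoc)
  finally have l2: "K3 * H \<le> G0 * H'" .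
  have "m T / 4 * (H' * G0) \<le> m T / 2 * (H' * G0) - K2 * H" using l1 by (simp add: mult_ac)
  also have "\<dots> = m T / 2 * (H' * G0) - \<alpha> / 2 * (H * G0) - K * (K1 * H)"
    by (simp add: K2_def algebra_simps)
  also have "\<dots> \<le> norm (Y T) - norm (evolution \<sigma> S T ?u (Y 0) - Y T)" using YT near by linarith
  also have "\<dots> \<le> norm (evolution \<sigma> S T ?u (Y 0))"
    using norm_triangle_sub[of "Y T" "evolution \<sigma> S T ?u (Y 0)"] by (simp add: norm_minus_commute)
  also have "\<dots> \<le> ?N * norm (Y 0)" by (rule norm_blinfun)
  also have "\<dots> \<le> ?N * (2 * (H' * G0))"
    using Y0 l2 by (intro mult_left_mono) (auto simp: mult.commute)
  finally have "m T / 8 * (2 * (H' * G0)) \<le> ?N * (2 * (H' * G0))" by (simp add: mult_ac)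
  then have "m T / 8 \<le> ?N" using H(2) G(1) by (simp add: mult_le_cancel_right)
  then show ?thesis using \<delta> by (simp add: m_def \<delta>_def)
qed


section \<open>Divergence of the evolution operators\<close>

theorem proposition3p7:
  fixes T \<sigma> r\<^sub>0 :: real and \<Theta> :: "real \<Rightarrow> real" and x\<^sub>0 :: plane
    and S :: "real \<Rightarrow> state \<Rightarrow>\<^sub>L state"
  assumes "T > 0" and "\<sigma> > 0"
    and "0 < r\<^sub>0" and "r\<^sub>0 < pi"
    and "cutoff_profile \<Theta>"
    and "contraction_semigroup S" and "generated_by S (maxwell_ohm \<sigma>)"
  defines "U \<equiv> evolution \<sigma> S T"
  defines "u \<equiv> u_seq \<sigma> r\<^sub>0 \<Theta> x\<^sub>0"
  shows "filterlim (\<lambda>n. norm (U (u n) - U (\<lambda>t x. 0))) at_top sequentially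
    \<and> (\<exists>X. X \<noteq> 0
        \<and> (SUP n\<in>{1..}. ereal (norm (U (u n) X - U (\<lambda>t x. 0) X))) = \<infinity>
        \<and> \<not> (\<forall>\<epsilon>>0. \<exists>\<delta>>0. \<forall>v. smooth_coeff T v \<and> L2H1_norm T v < \<delta>
              \<longrightarrow> norm (U v X - U (\<lambda>t x. 0) X) < \<epsilon>))"
proof -
  let ?U0 = "U (\<lambda>t x. 0)"
  have U0: "norm ?U0 \<le> 1"
  proof (rule norm_blinfun_bound)
    show "norm (?U0 X) \<le> 1 * norm X" for X
      using evolution_zero[OF assms(6), of T \<sigma> X] semigroup_norm_le[OF assms(6), of T X] assms(1)
      by (simp add: U_def)
  qed simp
  \<comment> \<open>The amplification factor is \<open>(T + \<delta>\<^sub>n)/\<delta>\<^sub>n \<ge> T e\<^sup>n\<close>.\<close>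
  have lower: "T / 8 * exp (real n) - 1 \<le> norm (U (u n) - ?U0)" for n
  proof -
    have "T / 8 * exp (real n) \<le> (T + delta n) / (8 * delta n)"
      by (simp add: delta_def exp_minus field_simps)
    also have "\<dots> \<le> norm (U (u n))"
      unfolding U_def u_def by (rule evolution_norm_lower_bound) (rule assms)+
    also have "\<dots> \<le> norm (U (u n) - ?U0) + norm ?U0"
      by (rule norm_triangle_sub[of "U (u n)" ?U0, unfolded add.commute[of "norm ?U0"]])
    finally show ?thesis using U0 by simp
  qed
  have "filterlim (\<lambda>n. exp (real n)) at_top sequentially"
    by (rule filterlim_compose[OF exp_at_top filterlim_real_sequentially])
  from filterlim_tendsto_pos_mult_at_top[OF tendsto_const _ this, of "T / 8"]
  have "filterlim (\<lambda>n. T / 8 * exp (real n)) at_top sequentially" using assms(1) by simp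
  then have "filterlim (\<lambda>n. - 1 + T / 8 * exp (real n)) at_top sequentially"
    by (rule filterlim_tendsto_add_at_top[OF tendsto_const])
  then have diverge: "filterlim (\<lambda>n. norm (U (u n) - ?U0)) at_top sequentially"
    by (rule filterlim_at_top_mono) (use lower in \<open>simp add: add.commute\<close>)
  \<comment> \<open>The index is shifted by one because the supremum runs over \<open>n \<ge> 1\<close>.\<close>
  have "\<exists>X. \<forall>K. \<exists>n\<ge>1. K < norm (U (u n) X - ?U0 X)"
  proof (rule ccontr)
    assume "\<not> ?thesis"
    then have "\<exists>K. \<forall>n. norm ((U (u (Suc n)) - ?U0) X) \<le> K" for X
      by (metis blinfun.diff_left le_add1 not_less plus_1_eq_Suc)
    from uniform_boundedness[OF this] obtain K where K: "\<And>n. norm (U (u (Suc n)) - ?U0) \<le> K" by blast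
    have "\<forall>\<^sub>F n in sequentially. K + 1 \<le> norm (U (u n) - ?U0)"
      using diverge by (simp add: filterlim_at_top)
    then obtain N where "\<forall>n\<ge>N. K + 1 \<le> norm (U (u n) - ?U0)" by (auto simp: eventually_sequentially)
    then have "K + 1 \<le> norm (U (u (Suc N)) - ?U0)" by simp
    with K[of N] show False by linarith
  qed
  then obtain X where X: "\<And>K. \<exists>n\<ge>1. K < norm (U (u n) X - ?U0 X)" by blast
  have "X \<noteq> 0" using X[of 0] by (auto simp: blinfun.zero_right)
  moreover have "(SUP n\<in>{1..}. ereal (norm (U (u n) X - ?U0 X))) = \<infinity>"
  proof (rule ereal_top)
    fix B
    obtain n where "n \<ge> 1" "B < norm (U (u n) X - ?U0 X)" using X by blast
    then show "ereal B \<le> (SUP n\<in>{1..}. ereal (norm (U (u n) X - ?U0 X)))"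
      by (intro SUP_upper2[of n]) auto
  qed
  moreover have "\<not> (\<forall>\<epsilon>>0. \<exists>\<delta>>0. \<forall>v. smooth_coeff T v \<and> L2H1_norm T v < \<delta>
      \<longrightarrow> norm (U v X - ?U0 X) < \<epsilon>)"
  proof
    assume "\<forall>\<epsilon>>0. \<exists>\<delta>>0. \<forall>v. smooth_coeff T v \<and> L2H1_norm T v < \<delta> \<longrightarrow> norm (U v X - ?U0 X) < \<epsilon>"
    then obtain \<delta> where "\<delta> > 0"
      and \<delta>: "\<And>v. smooth_coeff T v \<Longrightarrow> L2H1_norm T v < \<delta> \<Longrightarrow> norm (U v X - ?U0 X) < 1"
      by (metis zero_less_one)
    have "\<forall>\<^sub>F n in sequentially. L2H1_norm T (u n) < \<delta>"
      unfolding u_def by (rule u_seq_L2H1_small) (rule assms \<open>\<delta> > 0\<close>)+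
    then obtain N where N: "\<And>n. n \<ge> N \<Longrightarrow> L2H1_norm T (u n) < \<delta>"
      unfolding eventually_sequentially by blast
    let ?f = "\<lambda>n. norm (U (u n) X - ?U0 X)"
    \<comment> \<open>Continuity bounds all but finitely many members of a sequence that is unbounded at \<open>X\<close>.\<close>
    have "?f n \<le> 1 + (\<Sum>i<N. ?f i)" for n
    proof (cases "n < N")
      case True
      then have "?f n \<le> (\<Sum>i<N. ?f i)" by (intro member_le_sum) auto
      then show ?thesis by simp
    next
      case False
      have "smooth_coeff T (u n)" unfolding u_def by (rule u_seq_smooth_coeff) (rule assms)+
      then have "?f n < 1" using N False by (intro \<delta>) auto
      moreover have "0 \<le> (\<Sum>i<N. ?f i)" by (intro sum_nonneg) auto
      ultimately show ?thesis by linarith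
    qed
    with X[of "1 + (\<Sum>i<N. ?f i)"] show False by (meson not_less)
  qed
  ultimately show ?thesis using diverge by blast
qed

end
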